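(* Given a string $w\in\Sigma^*$ and an $\varepsilon$NFA $A=(Q,\Sigma,q_0,q_f,\delta)$ with $n$ states and $m$ transitions, one can decide in time $O(|w|+m)$ whether there exists a string $u$ that is a supersequence of $w$ (i.e., $w$ is a subsequence of $u$) with $u\in\mathcal{L}(A)$.
   Context: An $\varepsilon$NFA is a tuple $A=(Q,\Sigma,q_0,q_f,\delta)$ with finite state set $Q$, finite alphabet $\Sigma$, single initial state $q_0$, single final state $q_f$, transitions $\delta\subseteq Q\times(\Sigma\cup\{\varepsilon\})\times Q$; $\mathcal{L}(A)$ is the set of strings labelling (ignoring $\varepsilon$) a path from $q_0$ to $q_f$. Standing assumptions: $A$ is trimmed (every state is reachable from $q_0$ and can reach $q_f$) and every symbol of $\Sigma$ labels at least one transition (so $n,|\Sigma|\in O(m)$). A string $w$ is a subsequence of $u$ if $w=u[j_1]\cdots u[j_{|w|}]$ for some $1\le j_1<\dots<j_{|w|}\le|u|$. Model: unit-cost word RAM with logarithmic word size; integer alphabet $\Sigma=\{1,\dots,|\Sigma|\}$, $Q=\{1,\dots,n\}$ (alphabet size not assumed constant). *)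

theory Defs
  imports Complex_Main "HOL-Library.Sublist"
begin

section \<open>Automata with \<open>\<epsilon>\<close>-transitions\<close>

text \<open>A transition labelled \<open>None\<close> is an \<open>\<epsilon>\<close>-transition.\<close>

record ('q, 'a) enfa =
  states :: "'q set"
  alphabet :: "'a set"
  initial :: 'q
  final :: 'q
  transitions :: "('q \<times> 'a option \<times> 'q) set"

definition is_enfa :: "('q, 'a) enfa \<Rightarrow> bool" where
  "is_enfa A \<longleftrightarrow>
     finite (states A) \<and> finite (alphabet A) \<and>
     initial A \<in> states A \<and> final A \<in> states A \<and>
     transitions A \<subseteq> states A \<times> (Some ` alphabet A \<union> {None}) \<times> states A"

inductive path :: "('q, 'a) enfa \<Rightarrow> 'q \<Rightarrow> 'a list \<Rightarrow> 'q \<Rightarrow> bool" for A where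
  path_refl: "q \<in> states A \<Longrightarrow> path A q [] q"
| path_eps: "(p, None, q) \<in> transitions A \<Longrightarrow> path A q u r \<Longrightarrow> path A p u r"
| path_sym: "(p, Some a, q) \<in> transitions A \<Longrightarrow> path A q u r \<Longrightarrow> path A p (a # u) r"

definition language :: "('q, 'a) enfa \<Rightarrow> 'a list set" where
  "language A = {u. path A (initial A) u (final A)}"

definition trimmed :: "('q, 'a) enfa \<Rightarrow> bool" where
  "trimmed A \<longleftrightarrow>
     (\<forall>q \<in> states A. (\<exists>u. path A (initial A) u q) \<and> (\<exists>u. path A q u (final A)))"

definition all_symbols_used :: "('q, 'a) enfa \<Rightarrow> bool" where
  "all_symbols_used A \<longleftrightarrow> (\<forall>a \<in> alphabet A. \<exists>p q. (p, Some a, q) \<in> transitions A)"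

definition integer_names :: "(nat, nat) enfa \<Rightarrow> bool" where
  "integer_names A \<longleftrightarrow>
     states A = {1..card (states A)} \<and> alphabet A = {1..card (alphabet A)}"


section \<open>The word RAM\<close>

text \<open>
  Words are the natural numbers below \<open>2 ^ b\<close>, where \<open>b\<close> is the word size. A program is a
  finite list of instructions; it is independent of the input and of \<open>b\<close>. A register operand is
  a constant index, so a program has access to a fixed finite set of registers; the
  memory is accessed indirectly, the address being the content of a register. Every
  instruction takes one time unit. Arithmetic is modulo \<open>2 ^ b\<close>, and division by zero yields
  zero.
\<close>

datatype binop = Add | Sub | Mul | Div | Mod | And | Or | Xor | Shl | Shr

fun word_op :: "nat \<Rightarrow> binop \<Rightarrow> nat \<Rightarrow> nat \<Rightarrow> nat" where
  "word_op b Add x y = take_bit b (x + y)"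
| "word_op b Sub x y = nat (take_bit b (int x - int y))"
| "word_op b Mul x y = take_bit b (x * y)"
| "word_op b Div x y = x div y"
| "word_op b Mod x y = (if y = 0 then 0 else x mod y)"
| "word_op b And x y = and x y"
| "word_op b Or x y = or x y"
| "word_op b Xor x y = xor x y"
| "word_op b Shl x y = take_bit b (push_bit y x)"
| "word_op b Shr x y = drop_bit y x"

datatype instr =
    Const nat nat           \<comment> \<open>\<open>Const d v\<close>: \<open>R[d] := v\<close>\<close>
  | Move nat nat            \<comment> \<open>\<open>Move d s\<close>: \<open>R[d] := R[s]\<close>\<close>
  | Bin binop nat nat nat   \<comment> \<open>\<open>Bin f d s t\<close>: \<open>R[d] := f(R[s], R[t])\<close>\<close>
  | Load nat nat            \<comment> \<open>\<open>Load d a\<close>: \<open>R[d] := M[R[a]]\<close>\<close>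
  | Store nat nat           \<comment> \<open>\<open>Store a s\<close>: \<open>M[R[a]] := R[s]\<close>\<close>
  | Jump nat                \<comment> \<open>absolute target\<close>
  | JumpEq nat nat nat      \<comment> \<open>\<open>JumpEq s t l\<close>: go to \<open>l\<close> if \<open>R[s] = R[t]\<close>\<close>
  | JumpLess nat nat nat    \<comment> \<open>\<open>JumpLess s t l\<close>: go to \<open>l\<close> if \<open>R[s] < R[t]\<close>\<close>

record ram =
  pc :: nat
  reg :: "nat \<Rightarrow> nat"
  mem :: "nat \<Rightarrow> nat"

fun exec :: "nat \<Rightarrow> instr \<Rightarrow> ram \<Rightarrow> ram" where
  "exec b (Const d v) s = s\<lparr>pc := pc s + 1, reg := (reg s)(d := take_bit b v)\<rparr>"
| "exec b (Move d r) s = s\<lparr>pc := pc s + 1, reg := (reg s)(d := reg s r)\<rparr>"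
| "exec b (Bin f d r t) s =
     s\<lparr>pc := pc s + 1, reg := (reg s)(d := word_op b f (reg s r) (reg s t))\<rparr>"
| "exec b (Load d a) s = s\<lparr>pc := pc s + 1, reg := (reg s)(d := mem s (reg s a))\<rparr>"
| "exec b (Store a r) s = s\<lparr>pc := pc s + 1, mem := (mem s)(reg s a := reg s r)\<rparr>"
| "exec b (Jump l) s = s\<lparr>pc := l\<rparr>"
| "exec b (JumpEq r t l) s = s\<lparr>pc := (if reg s r = reg s t then l else pc s + 1)\<rparr>"
| "exec b (JumpLess r t l) s = s\<lparr>pc := (if reg s r < reg s t then l else pc s + 1)\<rparr>"

definition halted :: "instr list \<Rightarrow> ram \<Rightarrow> bool" where
  "halted P s \<longleftrightarrow> length P \<le> pc s"

definition step :: "nat \<Rightarrow> instr list \<Rightarrow> ram \<Rightarrow> ram" where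
  "step b P s = (if halted P s then s else exec b (P ! pc s) s)"

text \<open>The input words occupy the memory from address 0 on; everything else is initially 0.\<close>

definition start :: "nat list \<Rightarrow> ram" where
  "start xs = \<lparr>pc = 0, reg = (\<lambda>_. 0), mem = (\<lambda>i. if i < length xs then xs ! i else 0)\<rparr>"

text \<open>The answer of a decision program is the content of register 0 when it halts.\<close>

definition ram_decides :: "nat \<Rightarrow> instr list \<Rightarrow> nat list \<Rightarrow> nat \<Rightarrow> bool \<Rightarrow> bool" where
  "ram_decides b P xs T answer \<longleftrightarrow>
     (\<exists>t \<le> T. let s = (step b P ^^ t) (start xs)
              in halted P s \<and> reg s 0 = (if answer then 1 else 0))"


section \<open>Input encoding\<close>

text \<open>
  Symbols are positive, so 0 can stand for \<open>\<epsilon>\<close>. The transition set is presented as a list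
  \<open>ts\<close>, in an order over which the algorithm has no control.
\<close>

definition encode_transition :: "nat \<times> nat option \<times> nat \<Rightarrow> nat list" where
  "encode_transition = (\<lambda>(p, a, q). [p, case a of None \<Rightarrow> 0 | Some x \<Rightarrow> x, q])"

definition encode_input ::
  "nat list \<Rightarrow> (nat, nat) enfa \<Rightarrow> (nat \<times> nat option \<times> nat) list \<Rightarrow> nat list" where
  "encode_input w A ts =
     [length w, card (states A), card (alphabet A), length ts, initial A, final A]
     @ w @ concat (map encode_transition ts)"

text \<open>
  The input consists of \<open>|w| + 3 m + 6\<close> words. A word size is logarithmic, with factor \<open>k\<close>, if
  it is at least \<open>k\<close> times the logarithm of \<open>|w| + m + 2\<close>. The offset 2 keeps the logarithm positive
  on the smallest inputs.
\<close>

definition word_size_ok :: "nat \<Rightarrow> nat \<Rightarrow> nat \<Rightarrow> bool" where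
  "word_size_ok k N b \<longleftrightarrow> real k * log 2 (real (N + 2)) \<le> real b"

end

theory Submission imports Defs "HOL-Library.Countable" begin

text \<open>
  Let \<open>R\<^sub>j\<close> be the set of states that are reachable from the initial state by a string with the first
  \<open>j\<close> letters of \<open>w\<close> as a subsequence; the question is whether the final state is in \<open>R\<^sub>|\<^sub>w\<^sub>|\<close>. These sets
  are closed under reachability and decreasing, and they are unions of strongly connected components.
  A component without a living predecessor survives exactly as long as the letters read label its own
  inner transitions, so the position at which it dies is the first one whose letter it lacks. That
  position is found by walking along the list of the next occurrences of all letters, in time linear
  in the number of inner transitions, because every letter skipped labels one of them. The list is built from right to left; all deletions are then undone while \<open>w\<close> is read.
  When a component dies, its outgoing transitions are processed once, which may free its successors.

  The components come from a double depth-first search. The whole algorithm is written in a small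
  structured language over registers and arrays, whose compilation to the word RAM costs a constant
  factor. No value exceeds the largest input plus the running time, hence words never overflow.
\<close>

section \<open>A structured language\<close>

text \<open>Computing every set \<open>alive j\<close> afresh would cost the whole automaton per
  letter. Two things make the costs add up instead. The exit of a component is searched only once no
  living component precedes it: from then on its survival depends on its own letters alone, so the
  exit can be fixed far ahead and filed under its position. And the search must not step over every
  position of the word: in the list for position \<open>j\<close> each letter appears only at its
  next occurrence, so every step passes a letter not passed before. From \<open>j + 1\<close> to
  \<open>j\<close> this list changes by one insertion and at most one deletion, easy to carry out
  from right to left; but letters are consumed from left to right, and one copy per position would
  be too expensive. Reversing the updates in order works because a deleted node still holds the two
  neighbours between which it belongs. The delicate case is a component whose last living
  predecessor dies at letter \<open>j\<close>: a transition from a dying predecessor may have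
  carried it over this very letter. Flags record exactly this.\<close>

datatype ('v, 'a) atom =
    Lit 'v nat
  | Copy 'v 'v
  | Inc 'v
  | Dec 'v
  | Input 'v 'v
  | Get 'v 'a 'v
  | Put 'a 'v 'v

datatype 'v cond = Same 'v 'v | Differ 'v 'v

datatype ('v, 'a) com =
    Do "('v, 'a) atom list"
  | Seq "('v, 'a) com" "('v, 'a) com" (infixr \<open>;;\<close> 60)
  | Branch "'v cond" "('v, 'a) com" "('v, 'a) com"
  | While "'v cond" "('v, 'a) com"

type_synonym ('v, 'a) state = "nat \<times> ('v \<Rightarrow> nat) \<times> ('a \<Rightarrow> nat \<Rightarrow> nat)"

text \<open>A literal \<open>n\<close> costs \<open>n + 1\<close> and \<open>Inc\<close> raises a
  value by one per time unit. This pricing keeps all stored values below the largest input plus the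
  clock.\<close>

fun atom_step :: "(nat \<Rightarrow> nat) \<Rightarrow> ('v, 'a) atom \<Rightarrow> ('v, 'a) state \<Rightarrow> ('v, 'a) state" where
  "atom_step inp (Lit x n) (t, v, a) = (t + Suc n, v(x := n), a)"
| "atom_step inp (Copy x y) (t, v, a) = (Suc t, v(x := v y), a)"
| "atom_step inp (Inc x) (t, v, a) = (Suc t, v(x := Suc (v x)), a)"
| "atom_step inp (Dec x) (t, v, a) = (Suc t, v(x := v x - 1), a)"
| "atom_step inp (Input x y) (t, v, a) = (Suc t, v(x := inp (v y)), a)"
| "atom_step inp (Get x b y) (t, v, a) = (Suc t, v(x := a b (v y)), a)"
| "atom_step inp (Put b x y) (t, v, a) = (Suc t, v, a(b := (a b)(v x := v y)))"

fun holds :: "'v cond \<Rightarrow> ('v \<Rightarrow> nat) \<Rightarrow> bool" where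
  "holds (Same x y) v \<longleftrightarrow> v x = v y"
| "holds (Differ x y) v \<longleftrightarrow> v x \<noteq> v y"

inductive big :: "(nat \<Rightarrow> nat) \<Rightarrow> ('v, 'a) com \<Rightarrow> ('v, 'a) state \<Rightarrow> ('v, 'a) state \<Rightarrow> bool" for inp where
  big_Nil: "big inp (Do []) s s"
| big_Cons: "big inp (Do as) (atom_step inp x s) s' \<Longrightarrow> big inp (Do (x # as)) s s'"
| big_Seq: "big inp c s s' \<Longrightarrow> big inp d s' s'' \<Longrightarrow> big inp (c ;; d) s s''"
| big_BranchT: "holds b v \<Longrightarrow> big inp c (Suc t, v, a) s' \<Longrightarrow> big inp (Branch b c d) (t, v, a) s'"
| big_BranchF: "\<not> holds b v \<Longrightarrow> big inp d (Suc t, v, a) s' \<Longrightarrow> big inp (Branch b c d) (t, v, a) s'"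
| big_WhileF: "\<not> holds b v \<Longrightarrow> big inp (While b c) (t, v, a) (Suc t, v, a)"
| big_WhileT: "holds b v \<Longrightarrow> big inp c (Suc t, v, a) s' \<Longrightarrow> big inp (While b c) s' s'' \<Longrightarrow>
    big inp (While b c) (t, v, a) s''"

section \<open>The clock and the frame of a run\<close>

lemma fst_atom_step: "fst s < fst (atom_step inp x s)"
  by (cases s; cases x) auto

lemma big_mono: "big inp c s s' \<Longrightarrow> fst s \<le> fst s'"
proof (induction rule: big.induct)
  case (big_Cons as x s s')
  then show ?case using fst_atom_step[of s inp x] by linarith
qed auto

fun wvars_atom :: "('v, 'a) atom \<Rightarrow> 'v set" where
  "wvars_atom (Lit x n) = {x}"
| "wvars_atom (Copy x y) = {x}"
| "wvars_atom (Inc x) = {x}"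
| "wvars_atom (Dec x) = {x}"
| "wvars_atom (Input x y) = {x}"
| "wvars_atom (Get x b y) = {x}"
| "wvars_atom (Put b x y) = {}"

fun warrs_atom :: "('v, 'a) atom \<Rightarrow> 'a set" where
  "warrs_atom (Put b x y) = {b}"
| "warrs_atom _ = {}"

fun wvars :: "('v, 'a) com \<Rightarrow> 'v set" where
  "wvars (Do []) = {}"
| "wvars (Do (x # as)) = wvars_atom x \<union> wvars (Do as)"
| "wvars (c ;; d) = wvars c \<union> wvars d"
| "wvars (Branch b c d) = wvars c \<union> wvars d"
| "wvars (While b c) = wvars c"

fun warrs :: "('v, 'a) com \<Rightarrow> 'a set" where
  "warrs (Do []) = {}"
| "warrs (Do (x # as)) = warrs_atom x \<union> warrs (Do as)"
| "warrs (c ;; d) = warrs c \<union> warrs d"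
| "warrs (Branch b c d) = warrs c \<union> warrs d"
| "warrs (While b c) = warrs c"

lemma big_frame:
  "big inp c s s' \<Longrightarrow> (\<forall>x. x \<notin> wvars c \<longrightarrow> fst (snd s') x = fst (snd s) x) \<and>
     (\<forall>b. b \<notin> warrs c \<longrightarrow> snd (snd s') b = snd (snd s) b)"
proof (induction rule: big.induct)
  case (big_Cons as x s s')
  then show ?case by (cases s; cases x) auto
qed auto

text \<open>Commands are deterministic, so the existence of one terminating run amounts to total
  correctness. The postcondition sees the clock, which makes a time bound an ordinary part of a
  specification.\<close>

definition wp :: "(nat \<Rightarrow> nat) \<Rightarrow> ('v, 'a) com \<Rightarrow> (nat \<Rightarrow> ('v \<Rightarrow> nat) \<Rightarrow> ('a \<Rightarrow> nat \<Rightarrow> nat) \<Rightarrow> bool) \<Rightarrow>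
    nat \<Rightarrow> ('v \<Rightarrow> nat) \<Rightarrow> ('a \<Rightarrow> nat \<Rightarrow> nat) \<Rightarrow> bool" where
  "wp inp c Q t v a \<longleftrightarrow> (\<exists>t' v' a'. big inp c (t, v, a) (t', v', a') \<and> Q t' v' a')"

inductive_cases big_NilE: "big inp (Do []) s s'"
inductive_cases big_ConsE: "big inp (Do (x # as)) s s'"
inductive_cases big_SeqE: "big inp (c ;; d) s s'"
inductive_cases big_BranchE: "big inp (Branch b c d) s s'"

lemma big_Nil_iff: "big inp (Do []) s s' \<longleftrightarrow> s' = s"
  by (auto elim: big_NilE intro: big.intros)

lemma big_Cons_iff: "big inp (Do (x # as)) s s' \<longleftrightarrow> big inp (Do as) (atom_step inp x s) s'"
  by (auto elim: big_ConsE intro: big.intros)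

lemma big_Branch_iff:
  "big inp (Branch b c d) (t, v, a) s' \<longleftrightarrow> big inp (if holds b v then c else d) (Suc t, v, a) s'"
  by (auto elim: big_BranchE intro: big.intros)

lemma wp_Nil [simp]: "wp inp (Do []) Q t v a \<longleftrightarrow> Q t v a"
  by (simp add: wp_def big_Nil_iff)

lemma wp_Cons [simp]:
  "wp inp (Do (Lit x n # as)) Q t v a \<longleftrightarrow> wp inp (Do as) Q (t + Suc n) (v(x := n)) a"
  "wp inp (Do (Copy x y # as)) Q t v a \<longleftrightarrow> wp inp (Do as) Q (Suc t) (v(x := v y)) a"
  "wp inp (Do (Inc x # as)) Q t v a \<longleftrightarrow> wp inp (Do as) Q (Suc t) (v(x := Suc (v x))) a"
  "wp inp (Do (Dec x # as)) Q t v a \<longleftrightarrow> wp inp (Do as) Q (Suc t) (v(x := v x - 1)) a"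
  "wp inp (Do (Input x y # as)) Q t v a \<longleftrightarrow> wp inp (Do as) Q (Suc t) (v(x := inp (v y))) a"
  "wp inp (Do (Get x b y # as)) Q t v a \<longleftrightarrow> wp inp (Do as) Q (Suc t) (v(x := a b (v y))) a"
  "wp inp (Do (Put b x y # as)) Q t v a \<longleftrightarrow>
     wp inp (Do as) Q (Suc t) v (a(b := (a b)(v x := v y)))"
  by (simp_all add: wp_def big_Cons_iff)

lemma wp_Seq [simp]: "wp inp (c ;; d) Q = wp inp c (wp inp d Q)"
proof (intro ext)
  fix t v a
  show "wp inp (c ;; d) Q t v a = wp inp c (wp inp d Q) t v a"
    unfolding wp_def by (auto intro: big_Seq elim!: big_SeqE) (metis prod.collapse)
qed

lemma wp_Branch [simp]:
  "wp inp (Branch b c d) Q t v a \<longleftrightarrow>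
     (if holds b v then wp inp c Q (Suc t) v a else wp inp d Q (Suc t) v a)"
  by (simp add: wp_def big_Branch_iff)

text \<open>Besides weakening, this supplies the frame: a specification only has to mention what its
  command changes, and the caller recovers the rest from \<open>wvars\<close> and
  \<open>warrs\<close>.\<close>

lemma wp_conseq:
  assumes "wp inp c Q t v a" "\<And>t' v' a'. t \<le> t' \<Longrightarrow> Q t' v' a' \<Longrightarrow>
    (\<And>x. x \<notin> wvars c \<Longrightarrow> v' x = v x) \<Longrightarrow> (\<And>b. b \<notin> warrs c \<Longrightarrow> a' b = a b) \<Longrightarrow> Q' t' v' a'"
  shows "wp inp c Q' t v a"
proof -
  obtain t' v' a' where *: "big inp c (t, v, a) (t', v', a')" "Q t' v' a'"
    using assms(1) unfolding wp_def by blast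
  have "Q' t' v' a'" using assms(2)[OF _ *(2)] big_mono[OF *(1)] big_frame[OF *(1)] by simp
  then show ?thesis using *(1) unfolding wp_def by blast
qed

text \<open>Every iteration costs time, so an invariant that bounds the time also gives termination.\<close>

lemma wp_While:
  assumes inv: "I t v a"
    and body: "\<And>t v a. I t v a \<Longrightarrow> holds b v \<Longrightarrow> wp inp c I (Suc t) v a"
    and post: "\<And>t v a. I t v a \<Longrightarrow> \<not> holds b v \<Longrightarrow> Q (Suc t) v a"
    and bound: "\<And>t v a. I t v a \<Longrightarrow> t \<le> T"
  shows "wp inp (While b c) Q t v a"
  using inv
proof (induction "T - t" arbitrary: t v a rule: less_induct)
  case less
  show ?case
  proof (cases "holds b v")
    case True
    then obtain t' v' a' where *: "big inp c (Suc t, v, a) (t', v', a')" "I t' v' a'"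
      using body[OF less.prems] unfolding wp_def by blast
    have "t < t'" using big_mono[OF *(1)] by simp
    moreover have "t' \<le> T" using bound *(2) by blast
    ultimately have "wp inp (While b c) Q t' v' a'" using less.hyps *(2) by simp
    then show ?thesis using big_WhileT[OF True *(1)] unfolding wp_def by blast
  next
    case False
    then show ?thesis using post[OF less.prems] big_WhileF unfolding wp_def by blast
  qed
qed

text \<open>Joining the frame to the invariant once and for all keeps the loop invariants below free
  of untouched registers and arrays.\<close>

lemma wp_While_frame:
  assumes inv: "I t v a"
    and body: "\<And>t' v' a'. I t' v' a' \<Longrightarrow> holds b v' \<Longrightarrow> t \<le> t' \<Longrightarrow>
      (\<And>x. x \<notin> wvars c \<Longrightarrow> v' x = v x) \<Longrightarrow> (\<And>d. d \<notin> warrs c \<Longrightarrow> a' d = a d) \<Longrightarrow>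
      wp inp c I (Suc t') v' a'"
    and post: "\<And>t' v' a'. I t' v' a' \<Longrightarrow> \<not> holds b v' \<Longrightarrow> t \<le> t' \<Longrightarrow>
      (\<And>x. x \<notin> wvars c \<Longrightarrow> v' x = v x) \<Longrightarrow> (\<And>d. d \<notin> warrs c \<Longrightarrow> a' d = a d) \<Longrightarrow>
      Q (Suc t') v' a'"
    and bound: "\<And>t' v' a'. I t' v' a' \<Longrightarrow> t' \<le> T"
  shows "wp inp (While b c) Q t v a"
proof (rule wp_While[where T = T and I = "\<lambda>t' v' a'. I t' v' a' \<and> t \<le> t' \<and>
    (\<forall>x. x \<notin> wvars c \<longrightarrow> v' x = v x) \<and> (\<forall>d. d \<notin> warrs c \<longrightarrow> a' d = a d)"])
  fix t' v' a'
  assume *: "I t' v' a' \<and> t \<le> t' \<and> (\<forall>x. x \<notin> wvars c \<longrightarrow> v' x = v x) \<and>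
    (\<forall>d. d \<notin> warrs c \<longrightarrow> a' d = a d)" and "holds b v'"
  then have "wp inp c I (Suc t') v' a'" using body by blast
  then show "wp inp c (\<lambda>t' v' a'. I t' v' a' \<and> t \<le> t' \<and>
      (\<forall>x. x \<notin> wvars c \<longrightarrow> v' x = v x) \<and> (\<forall>d. d \<notin> warrs c \<longrightarrow> a' d = a d)) (Suc t') v' a'"
    by (rule wp_conseq) (use * in auto)
qed (use inv post bound in auto)

section \<open>Compilation to the word RAM\<close>

text \<open>The arrays are interleaved behind the input, whose length is \<open>base\<close>: entry \<open>i\<close> of array number
  \<open>d\<close> among \<open>K\<close> arrays lives at address \<open>base + K i + d\<close>. Register 1 holds \<open>base\<close>, and registers 2 to 7
  are scratch.\<close>

definition width :: "'a::{finite, countable} itself \<Rightarrow> nat" where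
  "width _ = Suc (Max (range (to_nat :: 'a \<Rightarrow> nat)))"

lemma to_nat_less_width: "to_nat (x :: 'a::{finite, countable}) < width TYPE('a)"
  unfolding width_def by (simp add: less_Suc_eq_le)

definition vreg :: "'v::countable \<Rightarrow> nat" where
  "vreg x = 8 + to_nat x"

lemma vreg_eq [simp]: "vreg x = vreg y \<longleftrightarrow> x = y"
  by (simp add: vreg_def)

lemma vreg_neq [simp]: "i < 8 \<Longrightarrow> vreg x \<noteq> i" "i < 8 \<Longrightarrow> i \<noteq> vreg x"
  by (auto simp: vreg_def)

definition address :: "nat \<Rightarrow> 'a::{finite, countable} \<Rightarrow> nat \<Rightarrow> nat" where
  "address base d i = base + (width TYPE('a) * i + to_nat d)"

lemma address_eq [simp]:
  "address base (d :: 'a::{finite, countable}) i = address base d' i' \<longleftrightarrow> d = d' \<and> i = i'"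
proof
  assume "address base d i = address base d' i'"
  then have *: "width TYPE('a) * i + to_nat d = width TYPE('a) * i' + to_nat d'"
    by (simp add: address_def)
  from arg_cong[OF *, of "\<lambda>x. x mod width TYPE('a)"] arg_cong[OF *, of "\<lambda>x. x div width TYPE('a)"]
  show "d = d' \<and> i = i'"
    using to_nat_less_width[of d] to_nat_less_width[of d'] by simp
qed simp

definition address_code :: "'a::{finite, countable} \<Rightarrow> 'v::countable \<Rightarrow> instr list" where
  "address_code d x =
     [Const 2 (width TYPE('a)), Bin Mul 2 2 (vreg x), Const 3 (to_nat d), Bin Add 2 2 3, Bin Add 2 1 2]"

text \<open>\<open>Dec\<close> subtracts the quotient of \<open>x\<close> by itself, which is 0 for
  \<open>x = 0\<close>, and so truncates like subtraction on \<open>nat\<close>.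
  \<open>Input\<close> has to yield 0 behind the input, where the memory holds the arrays: register
  5 becomes 1 exactly if the address is at least \<open>base\<close>, and the loaded word is
  multiplied by 1 minus that.\<close>

fun atom_code :: "('v::countable, 'a::{finite, countable}) atom \<Rightarrow> instr list" where
  "atom_code (Lit x n) = [Const (vreg x) n]"
| "atom_code (Copy x y) = [Move (vreg x) (vreg y)]"
| "atom_code (Inc x) = [Const 2 1, Bin Add (vreg x) (vreg x) 2]"
| "atom_code (Dec x) = [Bin Div 2 (vreg x) (vreg x), Bin Sub (vreg x) (vreg x) 2]"
| "atom_code (Input x y) =
     [Load 4 (vreg y), Bin Div 5 (vreg y) 1, Bin Div 5 5 5, Const 6 1, Bin Sub 6 6 5,
      Bin Mul (vreg x) 4 6]"
| "atom_code (Get x d y) = address_code d y @ [Load (vreg x) 2]"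
| "atom_code (Put d x y) = address_code d x @ [Store 2 (vreg y)]"

fun branch_code :: "nat \<Rightarrow> 'v::countable cond \<Rightarrow> nat \<Rightarrow> instr list" where
  "branch_code i (Same x y) l = [JumpEq (vreg x) (vreg y) (i + 2), Jump l]"
| "branch_code i (Differ x y) l = [JumpEq (vreg x) (vreg y) l, Jump (i + 2)]"

fun code :: "nat \<Rightarrow> ('v::countable, 'a::{finite, countable}) com \<Rightarrow> instr list" where
  "code i (Do []) = []"
| "code i (Do (x # as)) = atom_code x @ code (i + length (atom_code x)) (Do as)"
| "code i (c ;; d) = (let cc = code i c in cc @ code (i + length cc) d)"
| "code i (Branch b c d) =
     (let cc = code (i + 2) c; l = i + 3 + length cc; dd = code l d
      in branch_code i b l @ cc @ Jump (l + length dd) # dd)"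
| "code i (While b c) =
     (let cc = code (i + 2) c in branch_code i b (i + 3 + length cc) @ cc @ [Jump i])"

lemma length_branch_code [simp]: "length (branch_code i b l) = 2"
  by (cases b) auto

definition placed :: "instr list \<Rightarrow> nat \<Rightarrow> instr list \<Rightarrow> bool" where
  "placed P i cs \<longleftrightarrow> (\<exists>xs ys. P = xs @ cs @ ys \<and> length xs = i)"

lemma at_append: "placed P i (cs @ ds) \<Longrightarrow> placed P i cs \<and> placed P (i + length cs) ds"
  unfolding placed_def by (metis append.assoc length_append)

lemma at_Cons: "placed P i (c # ds) \<Longrightarrow> i < length P \<and> P ! i = c \<and> placed P (Suc i) ds"
proof -
  assume *: "placed P i (c # ds)"
  then have "placed P (Suc i) ds" using at_append[of P i "[c]" ds] by simp
  moreover obtain xs ys where "P = xs @ (c # ds) @ ys" "length xs = i"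
    using * unfolding placed_def by blast
  ultimately show ?thesis by (auto simp: nth_append)
qed

lemma at_branch:
  assumes "placed P i (branch_code i b l @ cs @ ds)"
  shows "placed P i (branch_code i b l)" "placed P (i + 2) cs" "placed P (i + 2 + length cs) ds"
  using at_append[OF assms] at_append[of P "i + 2" cs ds] by simp_all

section \<open>Step counts of machine runs\<close>

definition runs :: "nat \<Rightarrow> instr list \<Rightarrow> nat \<Rightarrow> ram \<Rightarrow> ram \<Rightarrow> bool" where
  "runs b P k \<sigma> \<sigma>' \<longleftrightarrow> (\<exists>t \<le> k. (step b P ^^ t) \<sigma> = \<sigma>')"

lemma runs_refl: "runs b P k \<sigma> \<sigma>"
  unfolding runs_def by (rule exI[of _ 0]) simp

lemma runs_trans:
  assumes "runs b P k \<sigma> \<sigma>'" "runs b P l \<sigma>' \<sigma>''" "k + l \<le> n"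
  shows "runs b P n \<sigma> \<sigma>''"
proof -
  obtain t u where "t \<le> k" "(step b P ^^ t) \<sigma> = \<sigma>'" "u \<le> l" "(step b P ^^ u) \<sigma>' = \<sigma>''"
    using assms(1,2) unfolding runs_def by blast
  then have "(step b P ^^ (u + t)) \<sigma> = \<sigma>''" "u + t \<le> n" using assms(3) by (auto simp: funpow_add)
  then show ?thesis unfolding runs_def by blast
qed

lemma runs_step:
  assumes "pc \<sigma> < length P" "runs b P k (exec b (P ! pc \<sigma>) \<sigma>) \<sigma>'"
  shows "runs b P (Suc k) \<sigma> \<sigma>'"
proof -
  have "step b P \<sigma> = exec b (P ! pc \<sigma>) \<sigma>" using assms(1) by (simp add: step_def halted_def)
  then have "runs b P 1 \<sigma> (exec b (P ! pc \<sigma>) \<sigma>)" unfolding runs_def by (intro exI[of _ 1]) simp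
  then show ?thesis using runs_trans assms(2) by (metis Suc_eq_plus1_left order_refl)
qed

fun exec_list :: "nat \<Rightarrow> instr list \<Rightarrow> ram \<Rightarrow> ram" where
  "exec_list b [] \<sigma> = \<sigma>"
| "exec_list b (c # cs) \<sigma> = exec_list b cs (exec b c \<sigma>)"

fun straight :: "instr \<Rightarrow> bool" where
  "straight (Jump _) = False"
| "straight (JumpEq _ _ _) = False"
| "straight (JumpLess _ _ _) = False"
| "straight _ = True"

lemma pc_straight: "straight c \<Longrightarrow> pc (exec b c \<sigma>) = Suc (pc \<sigma>)"
  by (cases c) auto

lemma runs_straight:
  assumes "placed P (pc \<sigma>) cs" "list_all straight cs"
  shows "runs b P (length cs) \<sigma> (exec_list b cs \<sigma>)" "pc (exec_list b cs \<sigma>) = pc \<sigma> + length cs"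
proof -
  have "runs b P (length cs) \<sigma> (exec_list b cs \<sigma>) \<and> pc (exec_list b cs \<sigma>) = pc \<sigma> + length cs"
    using assms
  proof (induction cs arbitrary: \<sigma>)
    case Nil
    then show ?case by (simp add: runs_refl)
  next
    case (Cons c cs)
    have *: "pc \<sigma> < length P" "P ! pc \<sigma> = c" "placed P (Suc (pc \<sigma>)) cs"
      using at_Cons[OF Cons.prems(1)] by auto
    have "straight c" using Cons.prems(2) by simp
    note pc = pc_straight[OF this, of b \<sigma>]
    have "placed P (pc (exec b c \<sigma>)) cs" "list_all straight cs" using * pc Cons.prems(2) by auto
    from Cons.IH[OF this] show ?case using pc runs_step[of \<sigma> P b] * by auto
  qed
  then show "runs b P (length cs) \<sigma> (exec_list b cs \<sigma>)" "pc (exec_list b cs \<sigma>) = pc \<sigma> + length cs"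
    by auto
qed

lemma straight_atom_code: "list_all straight (atom_code x)"
  by (cases x) (auto simp: address_code_def)

section \<open>Correctness of the compiled code\<close>

locale simulation =
  fixes inp :: "nat \<Rightarrow> nat" and base X T b :: nat
    and ty :: "('v::countable \<times> 'a::{finite, countable}) itself"
  assumes base_pos: "base > 0"
    and inp_le: "inp i \<le> X"
    and inp_outside: "base \<le> i \<Longrightarrow> inp i = 0"
    and room: "base + width TYPE('a) * (X + T + 2) < 2 ^ b"
begin

definition bounded :: "('v, 'a) state \<Rightarrow> bool" where
  "bounded = (\<lambda>(t, v, a). (\<forall>x. v x \<le> X + t) \<and> (\<forall>d i. a d i \<le> X + t))"

definition sim :: "('v, 'a) state \<Rightarrow> ram \<Rightarrow> bool" where
  "sim = (\<lambda>(t, v, a) \<sigma>. (\<forall>x. reg \<sigma> (vreg x) = v x) \<and> reg \<sigma> 1 = base \<and>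
     (\<forall>i < base. mem \<sigma> i = inp i) \<and> (\<forall>d i. mem \<sigma> (address base d i) = a d i))"

lemma bounded_atom_step: "bounded s \<Longrightarrow> bounded (atom_step inp x s)"
proof (cases s)
  case (fields t v a)
  assume "bounded s"
  then have v: "\<And>x. v x \<le> X + t" and a: "\<And>d i. a d i \<le> X + t" by (auto simp: bounded_def fields)
  have le: "y \<le> Suc (X + (t + k))" "y \<le> Suc (X + t)" if "y \<le> X + t" for y k using that by auto
  have inp: "inp i \<le> X + t" for i using inp_le[of i] by simp
  have dec: "v x - Suc 0 \<le> X + t" for x using v[of x] by simp
  show ?thesis
    by (cases x) (auto simp: bounded_def fields v a dec inp intro!: le)
qed

lemma bounded_tick: "bounded (t, v, a) \<Longrightarrow> bounded (Suc t, v, a)"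
  unfolding bounded_def by (auto intro: le_SucI)

lemma bounded_big: "big inp c s s' \<Longrightarrow> bounded s \<Longrightarrow> bounded s'"
proof (induction rule: big.induct)
  case (big_Cons as x s s')
  then show ?case using bounded_atom_step by blast
qed (auto intro: bounded_tick)

text \<open>The slack of two array rows in \<open>room\<close> covers the successor of a value and
  the offset \<open>to_nat d\<close> within a row; hence no intermediate result of an address
  computation wraps around.\<close>

lemma small:
  assumes "x \<le> X + T"
  shows "x < 2 ^ b" "Suc x < 2 ^ b" "address base (d :: 'a) x < 2 ^ b"
    "width TYPE('a) * x + to_nat d < 2 ^ b" "width TYPE('a) * x < 2 ^ b"
    "width TYPE('a) < 2 ^ b" "to_nat d < 2 ^ b" "base < 2 ^ b"
proof -
  have w: "to_nat d < width TYPE('a)" by (rule to_nat_less_width)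
  then have w1: "1 \<le> width TYPE('a)" by simp
  have "width TYPE('a) * x \<le> width TYPE('a) * (X + T)" using assms by simp
  then have *: "base + (width TYPE('a) * x + width TYPE('a) + width TYPE('a)) < 2 ^ b"
    using room by (simp add: algebra_simps)
  have "x \<le> width TYPE('a) * x" using w1 by (metis mult_1 mult_le_mono1)
  then show "x < 2 ^ b" "Suc x < 2 ^ b" "address base (d :: 'a) x < 2 ^ b"
    "width TYPE('a) * x + to_nat d < 2 ^ b" "width TYPE('a) * x < 2 ^ b"
    "width TYPE('a) < 2 ^ b" "to_nat d < 2 ^ b" "base < 2 ^ b"
    using * w w1 base_pos unfolding address_def by linarith+
qed

lemma address_code:
  fixes y z :: 'v
  assumes "x = reg \<sigma> (vreg y)" "x \<le> X + T" "reg \<sigma> 1 = base"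
  shows "reg (exec_list b (address_code d y) \<sigma>) 2 = address base (d :: 'a) x"
    "reg (exec_list b (address_code d y) \<sigma>) (vreg z) = reg \<sigma> (vreg z)"
    "reg (exec_list b (address_code d y) \<sigma>) 1 = reg \<sigma> 1"
    "mem (exec_list b (address_code d y) \<sigma>) = mem \<sigma>"
  using small(3,4,7)[OF assms(2), of d] small(5,6,8)[OF assms(2)] assms
  by (auto simp: address_code_def address_def take_bit_nat_eq_self)

lemma exec_list_append: "exec_list b (cs @ ds) \<sigma> = exec_list b ds (exec_list b cs \<sigma>)"
  by (induction cs arbitrary: \<sigma>) auto

lemma address_ge: "base \<le> address base (d :: 'a) i"
  by (simp add: address_def)

lemma sim_atom:
  assumes s: "sim s \<sigma>" "bounded s" "fst (atom_step inp x s) \<le> T"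
  shows "sim (atom_step inp x s) (exec_list b (atom_code x) \<sigma>)"
proof (cases s)
  case (fields t v a)
  have v: "\<And>y. reg \<sigma> (vreg y) = v y" "reg \<sigma> 1 = base" "\<And>i. i < base \<Longrightarrow> mem \<sigma> i = inp i"
     "\<And>d i. mem \<sigma> (address base d i) = a d i" using s(1) by (auto simp: sim_def fields)
  have v1: "reg \<sigma> (Suc 0) = base" using v(2) by simp
  have t: "t \<le> T" using s(3) fst_atom_step[of s inp x] by (simp add: fields)
  then have bd: "v y \<le> X + T" "a d i \<le> X + T" for y d i
    using s(2) by (auto simp: bounded_def fields dest!: spec[of _ y]) (metis add_le_mono le_refl le_trans)
  note sm = small[OF bd(1)]
  show ?thesis
  proof (cases x)
    case (Lit y n)
    then have "n \<le> X + T" using s(3) by (simp add: fields)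
    then have "n < 2 ^ b" by (rule small(1))
    then show ?thesis using v by (auto simp: Lit sim_def fields take_bit_nat_eq_self)
  next
    case (Copy y z)
    then show ?thesis using v by (auto simp: sim_def fields)
  next
    case (Inc y)
    have "0 < b" using sm(2)[of y] by (cases b) auto
    then show ?thesis using v sm(2)[of y] by (auto simp: Inc sim_def fields take_bit_nat_eq_self)
  next
    case (Dec y)
    have "take_bit b (int (v y) - int (v y div v y)) = int (v y - 1)"
      using sm(1)[of y] by (cases "v y") (auto simp: take_bit_int_eq_self)
    then show ?thesis using v by (auto simp: Dec sim_def fields)
  next
    case (Input y z)
    have one: "Suc 0 < 2 ^ b" using sm(2)[of y] by linarith
    have "inp (v z) < 2 ^ b" using small(1)[of "inp (v z)"] inp_le[of "v z"] by simp
    then have "take_bit b (mem \<sigma> (v z) * nat (take_bit b (int (Suc 0) - int ((v z div base) div (v z div base))))) = inp (v z)"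
      using v(3)[of "v z"] inp_outside[of "v z"] base_pos one
      by (cases "v z < base") (auto simp: take_bit_nat_eq_self take_bit_int_eq_self div_greater_zero_iff)
    then show ?thesis using v v1 one by (auto simp: Input sim_def fields take_bit_nat_eq_self)
  next
    case (Get y d z)
    show ?thesis using v address_code[OF v(1)[symmetric] bd(1) v(2)]
      by (auto simp: Get sim_def fields exec_list_append)
  next
    case (Put d y z)
    show ?thesis using v address_code[OF v(1)[symmetric] bd(1) v(2)] address_ge
      by (auto simp: Put sim_def fields exec_list_append not_le[symmetric])
  qed
qed

lemma branch:
  assumes "sim (t, v, a) \<sigma>" "placed P (pc \<sigma>) (branch_code (pc \<sigma>) c l)"
  shows "runs b P 2 \<sigma> (\<sigma>\<lparr>pc := if holds c v then pc \<sigma> + 2 else l\<rparr>)"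
proof -
  have *: "\<And>y. reg \<sigma> (vreg y) = v y" using assms by (auto simp: sim_def)
  note at = at_Cons[of P]
  have mono: "runs b P 2 \<sigma> \<sigma>'" if "runs b P (Suc 0) \<sigma> \<sigma>'" for \<sigma>'
    using runs_trans[OF that runs_refl[of b P 0]] by simp
  show ?thesis
  proof (cases c)
    case (Same x y)
    have P: "pc \<sigma> < length P" "P ! pc \<sigma> = JumpEq (vreg x) (vreg y) (pc \<sigma> + 2)"
      "Suc (pc \<sigma>) < length P" "P ! Suc (pc \<sigma>) = Jump l"
      using assms(2) by (auto simp: Same dest!: at)
    show ?thesis
    proof (cases "v x = v y")
      case True
      then show ?thesis
        by (intro mono runs_step) (use P in \<open>auto simp: Same * runs_refl\<close>)
    next
      case False
      then show ?thesis unfolding numeral_2_eq_2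
        by (intro runs_step) (use P in \<open>auto simp: Same * runs_refl\<close>)
    qed
  next
    case (Differ x y)
    have P: "pc \<sigma> < length P" "P ! pc \<sigma> = JumpEq (vreg x) (vreg y) l"
      "Suc (pc \<sigma>) < length P" "P ! Suc (pc \<sigma>) = Jump (pc \<sigma> + 2)"
      using assms(2) by (auto simp: Differ dest!: at)
    show ?thesis
    proof (cases "v x = v y")
      case True
      then show ?thesis
        by (intro mono runs_step) (use P in \<open>auto simp: Differ * runs_refl\<close>)
    next
      case False
      then show ?thesis unfolding numeral_2_eq_2
        by (intro runs_step) (use P in \<open>auto simp: Differ * runs_refl\<close>)
    qed
  qed
qed

lemma sim_pc [simp]: "sim s (\<sigma>\<lparr>pc := i\<rparr>) = sim s \<sigma>"
  by (auto simp: sim_def)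

lemma sim_tick: "sim (t, v, a) \<sigma> \<Longrightarrow> sim (t', v, a) \<sigma>"
  by (auto simp: sim_def)

lemma jump:
  assumes "placed P (pc \<sigma>) (Jump l # ds)"
  shows "runs b P 1 \<sigma> (\<sigma>\<lparr>pc := l\<rparr>)"
  using runs_step[of \<sigma> P b 0] at_Cons[OF assms] runs_refl by auto

lemma length_atom_code: "length (atom_code x) \<le> 6"
  by (cases x) (auto simp: address_code_def)

text \<open>One time unit has to pay for the at most six instructions of an atom, or for the two of
  a test together with one jump, so 8 is ample. Only the final clock is bounded; since the clock
  never decreases, all intermediate values fit into words too.\<close>

theorem sim_big:
  assumes "big inp c s s'" "sim s \<sigma>" "bounded s" "fst s' \<le> T" "placed P (pc \<sigma>) (code (pc \<sigma>) c)"
  shows "\<exists>\<sigma>'. runs b P (8 * (fst s' - fst s)) \<sigma> \<sigma>' \<and> sim s' \<sigma>' \<and>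
    pc \<sigma>' = pc \<sigma> + length (code (pc \<sigma>) c)"
  using assms
proof (induction arbitrary: \<sigma> rule: big.induct)
  case (big_Nil s)
  then show ?case by (intro exI[of _ \<sigma>]) (simp add: runs_refl)
next
  case (big_Cons as x s s')
  let ?\<sigma> = "exec_list b (atom_code x) \<sigma>"
  have at: "placed P (pc \<sigma>) (atom_code x)" "placed P (pc \<sigma> + length (atom_code x)) (code (pc \<sigma> + length (atom_code x)) (Do as))"
    using big_Cons.prems(4) at_append by auto
  note r = runs_straight[OF at(1) straight_atom_code, of b]
  have m: "fst (atom_step inp x s) \<le> fst s'" using big_mono[OF big_Cons.hyps] .
  have "sim (atom_step inp x s) ?\<sigma>"
    by (rule sim_atom) (use big_Cons.prems m in auto)
  from big_Cons.IH[OF this bounded_atom_step[OF big_Cons.prems(2)] big_Cons.prems(3)] at(2) r(2)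
  obtain \<sigma>' where \<sigma>': "runs b P (8 * (fst s' - fst (atom_step inp x s))) ?\<sigma> \<sigma>'" "sim s' \<sigma>'"
    "pc \<sigma>' = pc \<sigma> + length (code (pc \<sigma>) (Do (x # as)))" by auto
  have "runs b P (8 * (fst s' - fst s)) \<sigma> \<sigma>'"
    by (rule runs_trans[OF r(1) \<sigma>'(1)])
      (use fst_atom_step[of s inp x] length_atom_code[of x] m in simp)
  then show ?case using \<sigma>' by blast
next
  case (big_Seq c s s' d s'')
  have at: "placed P (pc \<sigma>) (code (pc \<sigma>) c)"
    "placed P (pc \<sigma> + length (code (pc \<sigma>) c)) (code (pc \<sigma> + length (code (pc \<sigma>) c)) d)"
    using big_Seq.prems(4) at_append by (auto simp: Let_def)
  have m: "fst s \<le> fst s'" "fst s' \<le> fst s''" using big_mono[OF big_Seq.hyps(1)] big_mono[OF big_Seq.hyps(2)] by auto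
  obtain \<sigma>' where \<sigma>': "runs b P (8 * (fst s' - fst s)) \<sigma> \<sigma>'" "sim s' \<sigma>'"
    "pc \<sigma>' = pc \<sigma> + length (code (pc \<sigma>) c)"
    using big_Seq.IH(1)[OF big_Seq.prems(1,2) _ at(1)] m big_Seq.prems(3) by auto
  obtain \<sigma>'' where \<sigma>'': "runs b P (8 * (fst s'' - fst s')) \<sigma>' \<sigma>''" "sim s'' \<sigma>''"
    "pc \<sigma>'' = pc \<sigma>' + length (code (pc \<sigma>') d)"
    using big_Seq.IH(2)[OF \<sigma>'(2) bounded_big[OF big_Seq.hyps(1) big_Seq.prems(2)] big_Seq.prems(3)] at(2) \<sigma>'(3) by auto
  have "runs b P (8 * (fst s'' - fst s)) \<sigma> \<sigma>''"
    by (rule runs_trans[OF \<sigma>'(1) \<sigma>''(1)]) (use m in simp)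
  then show ?case using \<sigma>' \<sigma>'' by (auto simp: Let_def)
next
  case (big_BranchT e v c t a s' d)
  let ?cc = "code (pc \<sigma> + 2) c"
  let ?l = "pc \<sigma> + 3 + length ?cc"
  let ?\<sigma> = "\<sigma>\<lparr>pc := pc \<sigma> + 2\<rparr>"
  have at: "placed P (pc \<sigma>) (branch_code (pc \<sigma>) e ?l)" "placed P (pc \<sigma> + 2) ?cc"
      "placed P (pc \<sigma> + 2 + length ?cc) (Jump (?l + length (code ?l d)) # code ?l d)"
    using at_branch[OF big_BranchT.prems(4)[unfolded code.simps Let_def]] by simp_all
  have m: "Suc t \<le> fst s'" using big_mono[OF big_BranchT.hyps(2)] by simp
  have r: "runs b P 2 \<sigma> ?\<sigma>" using branch[OF big_BranchT.prems(1) at(1)] big_BranchT.hyps(1) by simp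
  obtain \<sigma>' where \<sigma>': "runs b P (8 * (fst s' - Suc t)) ?\<sigma> \<sigma>'" "sim s' \<sigma>'"
    "pc \<sigma>' = pc \<sigma> + 2 + length ?cc"
    using big_BranchT.IH[of ?\<sigma>] sim_tick[OF big_BranchT.prems(1)] bounded_tick big_BranchT.prems(2,3) at(2) by auto
  have j: "runs b P 1 \<sigma>' (\<sigma>'\<lparr>pc := ?l + length (code ?l d)\<rparr>)" using jump at(3) \<sigma>'(3) by metis
  have "runs b P (8 * (fst s' - t)) \<sigma> (\<sigma>'\<lparr>pc := ?l + length (code ?l d)\<rparr>)"
    by (rule runs_trans[OF r runs_trans[OF \<sigma>'(1) j order_refl]]) (use m in simp)
  then show ?case using \<sigma>'(2) by (intro exI[of _ "\<sigma>'\<lparr>pc := ?l + length (code ?l d)\<rparr>"]) (auto simp: Let_def)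
next
  case (big_BranchF e v d t a s' c)
  let ?cc = "code (pc \<sigma> + 2) c"
  let ?l = "pc \<sigma> + 3 + length ?cc"
  let ?\<sigma> = "\<sigma>\<lparr>pc := ?l\<rparr>"
  have at: "placed P (pc \<sigma>) (branch_code (pc \<sigma>) e ?l)"
      "placed P (pc \<sigma> + 2 + length ?cc) (Jump (?l + length (code ?l d)) # code ?l d)"
    using at_branch[OF big_BranchF.prems(4)[unfolded code.simps Let_def]] by simp_all
  have at': "placed P ?l (code ?l d)" using at_Cons[OF at(2)] by (simp add: eval_nat_numeral)
  have m: "Suc t \<le> fst s'" using big_mono[OF big_BranchF.hyps(2)] by simp
  have r: "runs b P 2 \<sigma> ?\<sigma>" using branch[OF big_BranchF.prems(1) at(1)] big_BranchF.hyps(1) by simp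
  obtain \<sigma>' where \<sigma>': "runs b P (8 * (fst s' - Suc t)) ?\<sigma> \<sigma>'" "sim s' \<sigma>'"
    "pc \<sigma>' = ?l + length (code ?l d)"
    using big_BranchF.IH[of ?\<sigma>] sim_tick[OF big_BranchF.prems(1)] bounded_tick big_BranchF.prems(2,3) at' by auto
  have "runs b P (8 * (fst s' - t)) \<sigma> \<sigma>'"
    by (rule runs_trans[OF r \<sigma>'(1)]) (use m in simp)
  then show ?case using \<sigma>'(2,3) by (intro exI[of _ \<sigma>']) (auto simp: Let_def)
next
  case (big_WhileF e v c t a)
  let ?l = "pc \<sigma> + 3 + length (code (pc \<sigma> + 2) c)"
  have at: "placed P (pc \<sigma>) (branch_code (pc \<sigma>) e ?l)"
    using at_branch[OF big_WhileF.prems(4)[unfolded code.simps Let_def]] by simp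
  have r: "runs b P 2 \<sigma> (\<sigma>\<lparr>pc := ?l\<rparr>)" using branch[OF big_WhileF.prems(1) at] big_WhileF.hyps(1) by simp
  have "runs b P 8 \<sigma> (\<sigma>\<lparr>pc := ?l\<rparr>)" by (rule runs_trans[OF r runs_refl[of b P 0]]) simp
  then show ?case using sim_tick[OF big_WhileF.prems(1)]
    by (intro exI[of _ "\<sigma>\<lparr>pc := ?l\<rparr>"]) (auto simp: Let_def)
next
  case (big_WhileT e v c t a s' s'')
  let ?cc = "code (pc \<sigma> + 2) c"
  let ?l = "pc \<sigma> + 3 + length ?cc"
  let ?\<sigma> = "\<sigma>\<lparr>pc := pc \<sigma> + 2\<rparr>"
  have at: "placed P (pc \<sigma>) (branch_code (pc \<sigma>) e ?l)" "placed P (pc \<sigma> + 2) ?cc"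
      "placed P (pc \<sigma> + 2 + length ?cc) [Jump (pc \<sigma>)]"
    using at_branch[OF big_WhileT.prems(4)[unfolded code.simps Let_def]] by simp_all
  have m: "Suc t \<le> fst s'" "fst s' \<le> fst s''"
    using big_mono[OF big_WhileT.hyps(2)] big_mono[OF big_WhileT.hyps(3)] by auto
  have r: "runs b P 2 \<sigma> ?\<sigma>" using branch[OF big_WhileT.prems(1) at(1)] big_WhileT.hyps(1) by simp
  obtain \<sigma>' where \<sigma>': "runs b P (8 * (fst s' - Suc t)) ?\<sigma> \<sigma>'" "sim s' \<sigma>'"
    "pc \<sigma>' = pc \<sigma> + 2 + length ?cc"
    using big_WhileT.IH(1)[of ?\<sigma>] sim_tick[OF big_WhileT.prems(1)] bounded_tick big_WhileT.prems(2,3) at(2) m by auto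
  let ?\<sigma>' = "\<sigma>'\<lparr>pc := pc \<sigma>\<rparr>"
  have j: "runs b P 1 \<sigma>' ?\<sigma>'" using jump at(3) \<sigma>'(3) by metis
  have "bounded s'" using bounded_big[OF big_WhileT.hyps(2)] bounded_tick big_WhileT.prems(2) by blast
  then obtain \<sigma>'' where \<sigma>'': "runs b P (8 * (fst s'' - fst s')) ?\<sigma>' \<sigma>''" "sim s'' \<sigma>''"
    "pc \<sigma>'' = pc \<sigma> + length (code (pc \<sigma>) (While e c))"
    using big_WhileT.IH(2)[of ?\<sigma>'] \<sigma>'(2) big_WhileT.prems(3,4) by auto
  have "runs b P (8 * (fst s'' - t)) \<sigma> \<sigma>''"
    by (rule runs_trans[OF r runs_trans[OF \<sigma>'(1) runs_trans[OF j \<sigma>''(1) order_refl] order_refl]]) (use m in simp)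
  then show ?case using \<sigma>''(2,3) by auto
qed

end

text \<open>The prologue computes the input length \<open>6 + |w| + 3 m\<close> from words 0 and 3
  of the header. Registers start at 0, so the first \<open>Load\<close> reads address 0.\<close>

definition program :: "'v \<Rightarrow> ('v::countable, 'a::{finite, countable}) com \<Rightarrow> instr list" where
  "program ans c =
     [Load 2 2, Const 3 3, Load 4 3, Bin Mul 4 4 3, Bin Add 2 2 4, Const 4 6, Bin Add 1 2 4]
     @ code 7 c @ [Move 0 (vreg ans)]"

theorem program_decides:
  fixes c :: "('v::countable, 'a::{finite, countable}) com"
  defines "K \<equiv> width TYPE('a)"
  assumes wp: "wp (\<lambda>i. if i < length xs then xs ! i else 0) c
      (\<lambda>t v a. t \<le> T \<and> v ans = (if answer then 1 else 0)) 0 (\<lambda>_. 0) (\<lambda>_ _. 0)"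
    and len: "length xs = 6 + xs ! 0 + 3 * xs ! 3"
    and le: "\<And>x. x \<in> set xs \<Longrightarrow> x \<le> X"
    and room: "length xs + K * (X + T + 2) < 2 ^ b"
  shows "ram_decides b (program ans c) xs (8 * T + 8) answer"
proof -
  let ?inp = "\<lambda>i. if i < length xs then xs ! i else 0"
  let ?P = "program ans c"
  interpret simulation ?inp "length xs" X T b "TYPE('v \<times> 'a)"
    by unfold_locales (use len le room in \<open>auto simp: K_def\<close>)
  obtain t v a where big: "big ?inp c (0, \<lambda>_. 0, \<lambda>_ _. 0) (t, v, a)" "t \<le> T"
    "v ans = (if answer then 1 else 0)"
    using wp unfolding wp_def by blast
  let ?pre = "[Load 2 2, Const 3 3, Load 4 3, Bin Mul 4 4 3, Bin Add 2 2 4, Const 4 6, Bin Add 1 2 4]"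
  have at: "placed ?P 0 ?pre" "placed ?P 7 (code 7 c)" "placed ?P (7 + length (code 7 c)) [Move 0 (vreg ans)]"
    unfolding placed_def program_def
    by (rule exI[of _ "[]"], simp, rule exI[of _ ?pre], simp, rule exI[of _ "?pre @ code 7 c"], simp)
  let ?s = "start xs"
  let ?\<sigma> = "exec_list b ?pre ?s"
  have 7: "length ?pre = 7" and pc: "pc ?s = 0" and straight: "list_all straight ?pre"
    by (simp_all add: start_def)
  have pre: "runs b ?P 7 ?s ?\<sigma>" "pc ?\<sigma> = 7"
    using runs_straight[OF at(1)[folded pc] straight, of b] unfolding 7 pc add_0 .
  have "length xs < 2 ^ b" using room by simp
  then have "6 + (xs ! 0 + xs ! 3 * 3) < 2 ^ b" using len by (simp add: mult.commute)
  then have "(6::nat) < 2 ^ b" "(3::nat) < 2 ^ b" "xs ! 3 * 3 < 2 ^ b" "xs ! 0 + xs ! 3 * 3 < 2 ^ b"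
    "xs ! 0 + xs ! 3 * 3 + 6 < 2 ^ b" by linarith+
  moreover have "length xs > 3" using len by linarith
  ultimately have regs: "reg ?\<sigma> 1 = length xs" "\<And>x. reg ?\<sigma> (vreg (x :: 'v)) = 0" "mem ?\<sigma> = mem ?s"
    using len by (auto simp: start_def take_bit_nat_eq_self)
  obtain \<sigma>0 where \<sigma>0: "?\<sigma> = \<sigma>0" by blast
  have sim: "sim (0, \<lambda>_. 0, \<lambda>_ _. 0) \<sigma>0"
    using regs unfolding sim_def \<sigma>0 by (simp add: start_def address_def)
  have "bounded (0, \<lambda>_. 0, \<lambda>_ _. 0)" by (simp add: bounded_def)
  from sim_big[OF big(1) sim this, of ?P] big(2) pre(2)[unfolded \<sigma>0] at(2)
  obtain \<sigma>' where \<sigma>': "runs b ?P (8 * t) \<sigma>0 \<sigma>'" "sim (t, v, a) \<sigma>'" "pc \<sigma>' = 7 + length (code 7 c)"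
    by auto
  let ?\<sigma>' = "exec_list b [Move 0 (vreg ans)] \<sigma>'"
  have post: "runs b ?P 1 \<sigma>' ?\<sigma>'" "pc ?\<sigma>' = 8 + length (code 7 c)"
    using runs_straight[of ?P \<sigma>' "[Move 0 (vreg ans)]" b] at(3) \<sigma>'(3) by auto
  have "runs b ?P (8 * T + 8) ?s ?\<sigma>'"
    by (rule runs_trans[OF pre(1)[unfolded \<sigma>0] runs_trans[OF \<sigma>'(1) post(1) order_refl]]) (use big(2) in simp)
  then obtain k where k: "k \<le> 8 * T + 8" "(step b ?P ^^ k) ?s = ?\<sigma>'" unfolding runs_def by blast
  have "halted ?P ?\<sigma>'" using post(2) by (simp add: halted_def program_def)
  moreover have "reg ?\<sigma>' 0 = (if answer then 1 else 0)" using \<sigma>'(2) big(3) by (simp add: sim_def)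
  ultimately show ?thesis
    unfolding ram_decides_def Let_def by (intro exI[of _ k]) (simp only: k simp_thms)
qed

section \<open>Strongly connected components\<close>

abbreviation restrict_src :: "('q \<times> 'q) set \<Rightarrow> 'q set \<Rightarrow> ('q \<times> 'q) set" where
  "restrict_src E F \<equiv> E \<inter> F \<times> UNIV"

abbreviation mutual :: "('q \<times> 'q) set \<Rightarrow> 'q \<Rightarrow> 'q \<Rightarrow> bool" where
  "mutual E x y \<equiv> (x, y) \<in> E\<^sup>* \<and> (y, x) \<in> E\<^sup>*"

text \<open>The list holds the vertices in decreasing order of finishing times: every vertex with a path
  to \<open>r\<close> through vertices that finish before \<open>r\<close> is mutually reachable with \<open>r\<close>.\<close>

fun finish_order :: "('q \<times> 'q) set \<Rightarrow> 'q list \<Rightarrow> bool" where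
  "finish_order E [] \<longleftrightarrow> True"
| "finish_order E (r # zs) \<longleftrightarrow>
     (\<forall>x \<in> set zs. (x, r) \<in> (restrict_src E (set zs))\<^sup>* \<longrightarrow> (r, x) \<in> E\<^sup>*) \<and> finish_order E zs"

text \<open>\<open>F\<close> holds the finished vertices, the last one first, and \<open>S\<close>
  the search stack, its top first. The third conjunct demands of every vertex on the stack what
  \<open>finish_order\<close> will demand of it when it is put in front of \<open>F\<close>.\<close>

definition dfs_inv :: "('q \<times> 'q) set \<Rightarrow> 'q list \<Rightarrow> 'q list \<Rightarrow> bool" where
  "dfs_inv E F S \<longleftrightarrow> distinct (F @ S) \<and> sorted_wrt (\<lambda>x y. (y, x) \<in> E\<^sup>*) S \<and>
     (\<forall>x \<in> set F. \<forall>s \<in> set S. (x, s) \<in> (restrict_src E (set F))\<^sup>* \<longrightarrow> (s, x) \<in> E\<^sup>*) \<and>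
     finish_order E F \<and> E `` set F \<subseteq> set F \<union> set S"

lemma dfs_inv_init: "dfs_inv E [] [s]"
  by (simp add: dfs_inv_def)

lemma restrict_src_closed:
  assumes "(x, y) \<in> (restrict_src E F)\<^sup>*" "x \<in> G" "F \<subseteq> G" "E `` F \<subseteq> G"
  shows "y \<in> G"
  using assms by (induction rule: rtrancl_induct) auto

text \<open>Edges from finished vertices end in finished vertices or on the stack. So no path
  through finished vertices ends in an undiscovered vertex, and the new stack entry satisfies its
  condition vacuously.\<close>

lemma dfs_inv_push:
  assumes "dfs_inv E F (u # S)" "(u, y) \<in> E" "y \<notin> set F \<union> set (u # S)"
  shows "dfs_inv E F (y # u # S)"
proof -
  have "(x, y) \<notin> (restrict_src E (set F))\<^sup>*" if "x \<in> set F" for x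
    using restrict_src_closed[of x y E "set F" "set F \<union> set (u # S)"] that assms
    by (auto simp: dfs_inv_def)
  moreover have "(s, y) \<in> E\<^sup>*" if "s \<in> set (u # S)" for s
    using that assms by (auto simp: dfs_inv_def intro: rtrancl_into_rtrancl)
  ultimately show ?thesis using assms unfolding dfs_inv_def by auto
qed

text \<open>Cut the path at its first visit to \<open>u\<close>, if there is one.\<close>

lemma path_via:
  assumes "(x, s) \<in> (restrict_src E (insert u F))\<^sup>*"
  shows "(x, s) \<in> (restrict_src E F)\<^sup>* \<or> (x, u) \<in> (restrict_src E F)\<^sup>*"
  using assms
proof (induction rule: converse_rtrancl_induct)
  case (step y z)
  show ?case
  proof (cases "y = u")
    case False
    then have "(y, z) \<in> restrict_src E F" using step.hyps by auto
    then show ?thesis using step.IH by (meson converse_rtrancl_into_rtrancl)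
  qed simp
qed simp

text \<open>A path that becomes admissible only now passes through \<open>u\<close>. Its part up to
  \<open>u\<close> was admissible before, so \<open>u\<close> reaches \<open>x\<close>; and
  everything below \<open>u\<close> on the stack reaches \<open>u\<close>.\<close>

lemma dfs_inv_pop:
  assumes inv: "dfs_inv E F (u # S)" and out: "E `` {u} \<subseteq> set F \<union> set (u # S)"
  shows "dfs_inv E (u # F) S"
proof -
  have J: "(s, x) \<in> E\<^sup>*" if "x \<in> set F" "s \<in> set (u # S)" "(x, s) \<in> (restrict_src E (set F))\<^sup>*" for x s
    using inv that unfolding dfs_inv_def by blast
  have su: "(s, u) \<in> E\<^sup>*" if "s \<in> set S" for s using inv that unfolding dfs_inv_def by auto
  have "(s, x) \<in> E\<^sup>*"
    if "x \<in> set (u # F)" "s \<in> set S" "(x, s) \<in> (restrict_src E (set (u # F)))\<^sup>*" for x s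
  proof (cases "x = u")
    case False
    then have x: "x \<in> set F" using that(1) by simp
    have "(x, s) \<in> (restrict_src E (set F))\<^sup>* \<or> (x, u) \<in> (restrict_src E (set F))\<^sup>*"
      using path_via[of x s E u "set F"] that(3) by simp
    then show ?thesis
    proof
      assume "(x, u) \<in> (restrict_src E (set F))\<^sup>*"
      then have "(u, x) \<in> E\<^sup>*" using J[OF x] by simp
      then show ?thesis using su[OF that(2)] by (meson rtrancl_trans)
    qed (use J x that in simp)
  qed (use su that in simp)
  then show ?thesis using inv out unfolding dfs_inv_def by auto
qed

section \<open>The second, backward search\<close>

lemma finish_order_suffix: "finish_order E (ys @ zs) \<Longrightarrow> finish_order E zs"
  by (induction ys) auto

text \<open>Soundness of the backward search from \<open>r\<close>: \<open>A\<close> contains all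
  vertices listed before \<open>r\<close>, so outside \<open>A\<close> every edge starts in
  \<open>r # zs\<close>. Up to its first visit to \<open>r\<close> the path therefore uses vertices
  of \<open>zs\<close> only, and \<open>finish_order\<close> applies.\<close>

lemma finish_order_collect:
  assumes "finish_order E (ys @ r # zs)" "E \<subseteq> set (ys @ r # zs) \<times> UNIV"
    "set ys \<subseteq> A" "(x, r) \<in> (restrict_src E (- A))\<^sup>*"
  shows "(r, x) \<in> E\<^sup>*"
proof (cases "x = r")
  case False
  have "restrict_src E (- A) \<subseteq> restrict_src E (insert r (set zs))" using assms(2,3) by auto
  then have "(x, r) \<in> (restrict_src E (insert r (set zs)))\<^sup>*"
    using assms(4) rtrancl_mono by blast
  then have "(x, r) \<in> (restrict_src E (set zs))\<^sup>*" using path_via by fastforce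
  moreover from this have "x \<in> set zs" using False by (auto elim: converse_rtranclE)
  ultimately show ?thesis using finish_order_suffix[OF assms(1)] by simp
qed simp

text \<open>Completeness of the backward search: going backwards along a cycle through
  \<open>r\<close>, leaving \<open>C\<close> would mean entering \<open>A\<close>; but
  \<open>A\<close> is a union of components and would then contain \<open>r\<close>.\<close>

lemma mutual_in_closed:
  assumes "\<And>x y. (x, y) \<in> E \<Longrightarrow> y \<in> C \<Longrightarrow> x \<in> A \<union> C"
    and closed: "\<And>x y. x \<in> A \<Longrightarrow> mutual E x y \<Longrightarrow> y \<in> A"
    and "r \<in> C" "r \<notin> A" "mutual E x r"
  shows "x \<in> C"
proof -
  have "(r, x) \<in> E\<^sup>* \<longrightarrow> x \<in> C" if "(x, r) \<in> E\<^sup>*"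
    using that
  proof (induction rule: converse_rtrancl_induct)
    case (step x y)
    show ?case
    proof
      assume r: "(r, x) \<in> E\<^sup>*"
      then have "(r, y) \<in> E\<^sup>*" using step.hyps(1) by (rule rtrancl_into_rtrancl)
      then have "x \<in> A \<union> C" using step assms(1) by blast
      moreover have "(x, r) \<in> E\<^sup>*" using step.hyps by (rule converse_rtrancl_into_rtrancl)
      ultimately show "x \<in> C" using closed[of x r] r assms(4) by blast
    qed
  qed (use assms in simp)
  then show ?thesis using assms(5) by blast
qed

section \<open>Surviving states\<close>

text \<open>Label 0 is \<epsilon>. The word is padded with 0 outside the positions 1 to
  \<open>l\<close>, so the position behind it carries no proper letter.\<close>

locale automaton =
  fixes n m l :: nat and src lab dst w :: "nat \<Rightarrow> nat" and q0 qf :: nat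
  assumes src_in: "1 \<le> e \<Longrightarrow> e \<le> m \<Longrightarrow> src e \<in> {1..n}"
    and dst_in: "1 \<le> e \<Longrightarrow> e \<le> m \<Longrightarrow> dst e \<in> {1..n}"
    and q0_in: "q0 \<in> {1..n}" and qf_in: "qf \<in> {1..n}"
    and reach_q0: "q \<in> {1..n} \<Longrightarrow> (q0, q) \<in> {(src e, dst e) | e. 1 \<le> e \<and> e \<le> m}\<^sup>*"
    and w_pos: "1 \<le> i \<Longrightarrow> i \<le> l \<Longrightarrow> w i > 0" and w_out: "i < 1 \<or> l < i \<Longrightarrow> w i = 0"
begin

definition E :: "(nat \<times> nat) set" where
  "E = {(src e, dst e) | e. 1 \<le> e \<and> e \<le> m}"

lemma E_I: "1 \<le> e \<Longrightarrow> e \<le> m \<Longrightarrow> (src e, dst e) \<in> E"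
  by (auto simp: E_def)

lemma E_E: assumes "(x, y) \<in> E" obtains e where "1 \<le> e" "e \<le> m" "src e = x" "dst e = y"
  using assms by (auto simp: E_def)

lemma E_sub: "E \<subseteq> {1..n} \<times> {1..n}"
  using src_in dst_in by (auto simp: E_def)

lemma E_rtrancl_in: "(x, y) \<in> E\<^sup>* \<Longrightarrow> x \<in> {1..n} \<Longrightarrow> y \<in> {1..n}"
  by (induction rule: rtrancl_induct) (use E_sub in auto)

text \<open>Every state other than \<open>q0\<close> is the target of a transition. This turns costs
  linear in \<open>n\<close> into costs linear in \<open>m\<close>.\<close>

lemma n_le: "n \<le> Suc m"
proof -
  have "q \<in> insert q0 (dst ` {1..m})" if "q \<in> {1..n}" for q
    using reach_q0[OF that] by (cases rule: rtranclE) force+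
  then have "{1..n} \<subseteq> insert q0 (dst ` {1..m})" by blast
  then have "card {1..n} \<le> card (insert q0 (dst ` {1..m}))" by (intro card_mono) auto
  also have "\<dots> \<le> Suc (card (dst ` {1..m}))" by (simp add: card_insert_if)
  also have "\<dots> \<le> Suc m" using card_image_le[of "{1..m}" dst] by simp
  finally show ?thesis by simp
qed

text \<open>Labels are forgotten along \<open>E\<^sup>*\<close>, because a supersequence may contain
  anything between the chosen letters. Stage 0 is the full state set since every state is reachable
  from \<open>q0\<close>.\<close>

fun alive :: "nat \<Rightarrow> nat set" where
  "alive 0 = {1..n}"
| "alive (Suc j) = {q. \<exists>e. 1 \<le> e \<and> e \<le> m \<and> lab e = w (Suc j) \<and> src e \<in> alive j \<and> (dst e, q) \<in> E\<^sup>*}"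

lemma alive_closed: "x \<in> alive j \<Longrightarrow> (x, y) \<in> E\<^sup>* \<Longrightarrow> y \<in> alive j"
  by (cases j) (auto intro: E_rtrancl_in[simplified] rtrancl_trans dest: E_rtrancl_in)

lemma alive_Suc: "alive (Suc j) \<subseteq> alive j"
  using alive_closed[of _ j] E_I by (auto dest: converse_rtrancl_into_rtrancl)

lemma alive_antimono: "i \<le> j \<Longrightarrow> alive j \<subseteq> alive i"
  by (induction j rule: dec_induct) (use alive_Suc in blast)+

end

section \<open>Survival of components\<close>

locale components = automaton +
  fixes cmp :: "nat \<Rightarrow> nat"
  assumes cmp_eq: "x \<in> {1..n} \<Longrightarrow> y \<in> {1..n} \<Longrightarrow> cmp x = cmp y \<longleftrightarrow> mutual E x y"
    and cmp_mutual: "x \<in> {1..n} \<Longrightarrow> mutual E x (cmp x)"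
begin

definition reps :: "nat set" where
  "reps = cmp ` {1..n}"

lemma cmp_in: "x \<in> {1..n} \<Longrightarrow> cmp x \<in> {1..n}"
  using cmp_mutual E_rtrancl_in by blast

lemma cmp_cmp: "x \<in> {1..n} \<Longrightarrow> cmp (cmp x) = cmp x"
  using cmp_eq cmp_in cmp_mutual by blast

lemma reps_in: "c \<in> reps \<Longrightarrow> c \<in> {1..n} \<and> cmp c = c"
  using cmp_in cmp_cmp by (auto simp: reps_def simp del: atLeastAtMost_iff)

lemma cmp_reps: "x \<in> {1..n} \<Longrightarrow> cmp x \<in> reps"
  by (simp add: reps_def)

definition cross :: "nat set" where
  "cross = {e. 1 \<le> e \<and> e \<le> m \<and> cmp (src e) \<noteq> cmp (dst e)}"

text \<open>Excluding \<epsilon> ensures that no component owns the letter 0 of the position behind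
  the word, where every exit search must stop.\<close>

definition inner :: "nat \<Rightarrow> nat set" where
  "inner c = {e. 1 \<le> e \<and> e \<le> m \<and> cmp (src e) = c \<and> cmp (dst e) = c \<and> lab e \<noteq> 0}"

lemma alive_cmp: "x \<in> {1..n} \<Longrightarrow> cmp x \<in> alive j \<longleftrightarrow> x \<in> alive j"
  using cmp_mutual alive_closed by blast

lemma alive_Suc_inner:
  assumes "c \<in> reps" "c \<in> alive j" "w (Suc j) \<in> lab ` inner c"
  shows "c \<in> alive (Suc j)"
proof -
  obtain e where e: "1 \<le> e" "e \<le> m" "cmp (src e) = c" "cmp (dst e) = c" "lab e = w (Suc j)"
    using assms(3) by (auto simp: inner_def)
  have "src e \<in> alive j" using alive_cmp[OF src_in[OF e(1,2)], of j] e(3) assms(2) by simp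
  moreover have "(dst e, c) \<in> E\<^sup>*" using cmp_mutual[OF dst_in] e by metis
  ultimately show ?thesis using e by auto
qed

text \<open>Take the last edge of the path that changes the component.\<close>

lemma enter_component:
  assumes "(x, y) \<in> E\<^sup>*" "x \<in> {1..n}" "cmp x \<noteq> cmp y"
  obtains e where "e \<in> cross" "cmp (dst e) = cmp y" "(x, src e) \<in> E\<^sup>*"
  using assms
proof (induction arbitrary: thesis rule: rtrancl_induct)
  case (step y z)
  obtain e where e: "1 \<le> e" "e \<le> m" "src e = y" "dst e = z" using E_E step.hyps(2) by blast
  show ?case
  proof (cases "cmp y = cmp z")
    case True
    then show ?thesis using step.IH[OF _ step.prems(2)] step.prems by metis
  next
    case False
    then show ?thesis using step.prems(1)[of e] e step.hyps(1) by (simp add: cross_def)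
  qed
qed simp

text \<open>Compare the transition that reads the letter with the place where the run last enters
  the component of \<open>c\<close>: the letter is read inside, before the entering transition, or
  by it. The condition \<open>j < l\<close> makes the letter positive, so a transition reading it
  inside belongs to \<open>inner c\<close>.\<close>

lemma alive_Suc_cases:
  assumes c: "c \<in> reps" and alive: "c \<in> alive (Suc j)" and "j < l"
  obtains "w (Suc j) \<in> lab ` inner c" | e where "e \<in> cross" "cmp (dst e) = c" "src e \<in> alive (Suc j)"
  | e where "e \<in> cross" "cmp (dst e) = c" "lab e = w (Suc j)" "src e \<in> alive j"
proof -
  obtain e where e: "1 \<le> e" "e \<le> m" "lab e = w (Suc j)" "src e \<in> alive j" "(dst e, c) \<in> E\<^sup>*"
    using alive by auto
  have cc: "cmp c = c" using reps_in c by blast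
  show thesis
  proof (cases "cmp (dst e) = c")
    case False
    then obtain e' where e': "e' \<in> cross" "cmp (dst e') = c" "(dst e, src e') \<in> E\<^sup>*"
      using enter_component[OF e(5) dst_in[OF e(1,2)]] cc by metis
    then have "src e' \<in> alive (Suc j)" using e by auto
    then show ?thesis using that(2) e' by blast
  next
    case True
    show ?thesis
    proof (cases "e \<in> cross")
      case False
      then have "cmp (src e) = c" using True e by (simp add: cross_def)
      then have "e \<in> inner c" using True e w_pos[of "Suc j"] \<open>j < l\<close> by (simp add: inner_def)
      then show ?thesis using that(1) e(3) by (metis image_eqI)
    qed (use that(3) True e in blast)
  qed
qed

text \<open>A component in the bucket of position \<open>p\<close> is alive before letter \<open>p\<close>, and from then on only its
  inner transitions keep it alive.\<close>

definition on_its_own :: "nat \<Rightarrow> nat \<Rightarrow> bool" where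
  "on_its_own c p \<longleftrightarrow> c \<in> alive (p - 1) \<and>
     (\<forall>j. p \<le> j \<and> j \<le> l \<longrightarrow> (c \<in> alive j \<longleftrightarrow> (\<forall>i \<in> {p..j}. w i \<in> lab ` inner c)))"

text \<open>Predecessors that are dead after letter \<open>p\<close> cannot help at later letters.
  At letter \<open>p\<close> itself an entering transition with that label could still start from a
  state alive just before; the premise \<open>lab\<close> excludes this.\<close>

lemma on_its_own_intro:
  assumes c: "c \<in> reps" and p: "1 \<le> p" and alive: "c \<in> alive (p - 1)"
    and dead: "\<And>e. e \<in> cross \<Longrightarrow> cmp (dst e) = c \<Longrightarrow> src e \<notin> alive p"
    and lab: "\<And>e. e \<in> cross \<Longrightarrow> cmp (dst e) = c \<Longrightarrow> lab e = w p \<Longrightarrow> src e \<notin> alive (p - 1)"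
  shows "on_its_own c p"
proof -
  have alive_Suc_iff: "c \<in> alive (Suc j) \<longleftrightarrow> c \<in> alive j \<and> w (Suc j) \<in> lab ` inner c"
    if j: "p \<le> Suc j" "Suc j \<le> l" for j
  proof
    assume *: "c \<in> alive (Suc j)"
    have "src e \<notin> alive (Suc j)" if "e \<in> cross" "cmp (dst e) = c" for e
      using dead[OF that] alive_antimono[OF j(1)] by blast
    moreover have "src e \<notin> alive j" if "e \<in> cross" "cmp (dst e) = c" "lab e = w (Suc j)" for e
    proof (cases "p = Suc j")
      case False
      then have "p \<le> j" using j by simp
      then show ?thesis using dead[OF that(1,2)] alive_antimono by blast
    qed (use lab that in simp)
    moreover have "c \<in> alive j" using * alive_Suc by blast
    ultimately show "c \<in> alive j \<and> w (Suc j) \<in> lab ` inner c"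
      using alive_Suc_cases[OF c *] j(2) by (metis Suc_le_eq)
  qed (use alive_Suc_inner[OF c] in blast)
  \<comment> \<open>Starting already at \<open>j = p - 1\<close>, where the interval is empty, makes
    the premise \<open>alive\<close> the base of the induction.\<close>
  have "c \<in> alive j \<longleftrightarrow> (\<forall>i \<in> {p..j}. w i \<in> lab ` inner c)" if "p \<le> Suc j" "j \<le> l" for j
    using that
  proof (induction j)
    case 0
    then show ?case using alive p by (cases "p = 1") auto
  next
    case (Suc j)
    show ?case
    proof (cases "p = Suc (Suc j)")
      case False
      then have "p \<le> Suc j" using Suc.prems by simp
      then show ?thesis using Suc.IH Suc.prems alive_Suc_iff[of j]
        by (auto simp: atLeastAtMostSuc_conv)
    qed (use alive in simp)
  qed
  then show ?thesis using alive by (auto simp: on_its_own_def)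
qed

text \<open>A chain of predecessors outside \<open>X\<close> must end, because the graph of
  components is acyclic; it ends in a component known to be alive, and life spreads forward along
  the chain.\<close>

lemma all_alive:
  assumes "\<And>c. c \<in> reps - X \<Longrightarrow>
      c \<in> alive j \<or> (\<exists>e \<in> cross. cmp (dst e) = c \<and> cmp (src e) \<notin> X)"
    and "c \<in> reps - X"
  shows "c \<in> alive j"
  using assms(2)
proof (induction "card {x \<in> {1..n}. (x, c) \<in> E\<^sup>*}" arbitrary: c rule: less_induct)
  case less
  have cc: "c \<in> {1..n}" "cmp c = c" using reps_in less.prems by blast+
  show ?case
  proof (rule disjE[OF assms(1)[OF less.prems]])
    assume "\<exists>e \<in> cross. cmp (dst e) = c \<and> cmp (src e) \<notin> X"
    then obtain e where e: "1 \<le> e" "e \<le> m" "cmp (src e) \<noteq> c" "cmp (dst e) = c" "cmp (src e) \<notin> X"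
      by (auto simp: cross_def)
    let ?d = "cmp (src e)"
    have s: "src e \<in> {1..n}" "dst e \<in> {1..n}" using src_in dst_in e by auto
    have path: "(?d, c) \<in> E\<^sup>*"
      using cmp_mutual[OF s(1)] cmp_mutual[OF s(2)] E_I[OF e(1,2)] e(4)
      by (metis converse_rtrancl_into_rtrancl rtrancl_trans)
    \<comment> \<open>Otherwise the two distinct representatives would be mutually reachable. Hence
      \<open>c\<close> itself drops out of the counted set and the measure decreases.\<close>
    have "(c, ?d) \<notin> E\<^sup>*"
      using cmp_eq[OF cmp_in[OF s(1)] cc(1)] path e(3) cmp_cmp[OF s(1)] cc(2) by auto
    then have "{x \<in> {1..n}. (x, ?d) \<in> E\<^sup>*} \<subset> {x \<in> {1..n}. (x, c) \<in> E\<^sup>*}"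
      using path cc(1) by (auto intro: rtrancl_trans)
    then have "card {x \<in> {1..n}. (x, ?d) \<in> E\<^sup>*} < card {x \<in> {1..n}. (x, c) \<in> E\<^sup>*}"
      by (intro psubset_card_mono) auto
    then have "?d \<in> alive j" using less.hyps e(5) cmp_reps[OF s(1)] by blast
    then show ?thesis using alive_closed path by blast
  qed
qed

end

section \<open>The algorithm\<close>

datatype var = vZ | One | Len | NumT | Init | Fin | Sent | Ans
  | vA | vC | vD | vG | vH | vI | vJ | vP | vU | vX | vY

text \<open>The suffixes \<open>Hd\<close> and \<open>Nx\<close> mean list heads and successor
  links. \<open>FinNx\<close> chains the states by decreasing finishing time; \<open>Par\<close> and
  \<open>Stk\<close> are the stacks of the two searches. \<open>CmpNx\<close> serves
  \<open>InnHd\<close> and \<open>CrsHd\<close> together, as no transition is in both kinds of list.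
  \<open>Deg\<close> counts the unprocessed transitions entering a component, \<open>Last\<close>
  gives the nearest occurrence of a letter met so far in the scan from the right, and
  \<open>Mrk\<close> the component that marked a letter last.\<close>

datatype arr = Wd | Src | Lab | Dst
  | OutHd | OutNx | InHd | InNx | Vis | Par | FinNx | Cmp | Stk
  | InnHd | CrsHd | CmpNx | Deg | Last | Nxt | Lft | Rgt
  | BktHd | BktNx | Mrk | Flg | Gone

instance var :: countable by countable_datatype
instance arr :: countable by countable_datatype

instance arr :: finite
proof
  have "(UNIV :: arr set) \<subseteq> {Wd, Src, Lab, Dst, OutHd, OutNx, InHd, InNx, Vis, Par, FinNx, Cmp, Stk,
      InnHd, CrsHd, CmpNx, Deg, Last, Nxt, Lft, Rgt, BktHd, BktNx, Mrk, Flg, Gone}"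
  proof
    fix x :: arr
    show "x \<in> {Wd, Src, Lab, Dst, OutHd, OutNx, InHd, InNx, Vis, Par, FinNx, Cmp, Stk,
      InnHd, CrsHd, CmpNx, Deg, Last, Nxt, Lft, Rgt, BktHd, BktNx, Mrk, Flg, Gone}"
      by (cases x) simp_all
  qed
  then show "finite (UNIV :: arr set)" by (rule finite_subset) simp
qed

text \<open>The register \<open>vZ\<close> is never written and thus holds 0. States, transitions and positions are numbered
  from 1, so that 0 serves as the null pointer.\<close>

type_synonym prog = "(var, arr) com"

definition read_word :: prog where
  "read_word = While (Differ vJ Len) (Do [Inc vJ, Input vA vI, Put Wd vJ vA, Inc vI])"

definition read_transitions :: prog where
  "read_transitions = While (Differ vJ NumT) (Do [Inc vJ,
     Input vA vI, Put Src vJ vA, Get vH OutHd vA, Put OutNx vJ vH, Put OutHd vA vJ, Inc vI,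
     Input vA vI, Put Lab vJ vA, Inc vI,
     Input vA vI, Put Dst vJ vA, Get vH InHd vA, Put InNx vJ vH, Put InHd vA vJ, Inc vI])"

definition read_input :: prog where
  "read_input = Do [Input Len vZ, Lit vI 3, Input NumT vI, Lit vI 4, Input Init vI, Lit vI 5, Input Fin vI,
     Lit One 1, Copy Sent Len, Inc Sent, Lit vI 6, Lit vJ 0] ;;
     read_word ;; Do [Lit vJ 0] ;; read_transitions"

text \<open>\<open>OutHd\<close> is consumed and thus doubles as the edge iterator of each state,
  while \<open>Par\<close> doubles as the recursion stack.\<close>

definition visit :: prog where
  "visit = While (Differ vU vZ)
     (Do [Get vI OutHd vU] ;;
      Branch (Same vI vZ)
        (Do [Put FinNx vU vX, Copy vX vU, Get vU Par vU])
        (Do [Get vH OutNx vI, Put OutHd vU vH, Get vY Dst vI, Get vH Vis vY] ;;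
         Branch (Same vH vZ) (Do [Put Vis vY One, Put Par vY vU, Copy vU vY]) (Do [])))"

definition depth_first :: prog where
  "depth_first = Do [Copy vU Init, Put Vis vU One, Copy vX vZ] ;; visit"

definition collect :: prog where
  "collect = While (Differ vY vZ)
     (Do [Get vI InHd vY] ;;
      Branch (Same vI vZ)
        (Do [Get vY Stk vY])
        (Do [Get vH InNx vI, Put InHd vY vH, Get vU Src vI, Get vH Cmp vU] ;;
         Branch (Same vH vZ) (Do [Put Cmp vU vX, Put Stk vU vY, Copy vY vU]) (Do [])))"

definition find_components :: prog where
  "find_components = While (Differ vX vZ)
     (Do [Get vH Cmp vX] ;;
      Branch (Same vH vZ) (Do [Put Cmp vX vX, Put Stk vX vZ, Copy vY vX] ;; collect) (Do []) ;;
      Do [Get vX FinNx vX])"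

definition sort_transitions :: prog where
  "sort_transitions = Do [Lit vJ 0] ;; While (Differ vJ NumT)
     (Do [Inc vJ, Get vA Src vJ, Get vC Cmp vA, Get vA Dst vJ, Get vD Cmp vA] ;;
      Branch (Same vC vD)
        (Do [Get vA Lab vJ] ;;
         Branch (Same vA vZ) (Do []) (Do [Get vH InnHd vC, Put CmpNx vJ vH, Put InnHd vC vJ]))
        (Do [Get vH CrsHd vC, Put CmpNx vJ vH, Put CrsHd vC vJ, Get vH Deg vD, Inc vH, Put Deg vD vH]))"

definition link_positions :: prog where
  "link_positions = Do [Put Rgt vZ Sent, Copy vJ Len] ;; While (Differ vJ vZ)
     (Do [Get vA Wd vJ, Get vY Last vA, Put Nxt vJ vY] ;;
      Branch (Same vY vZ) (Do [])
        (Do [Get vP Lft vY, Get vH Rgt vY, Put Rgt vP vH, Put Lft vH vP]) ;;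
      Do [Get vH Rgt vZ, Put Rgt vJ vH, Put Lft vH vJ, Put Rgt vZ vJ, Put Lft vJ vZ, Put Last vA vJ, Dec vJ])"

definition unlink_position :: prog where
  "unlink_position = Do [Get vH Rgt vJ, Put Rgt vZ vH, Put Lft vH vZ, Get vY Nxt vJ] ;;
     Branch (Same vY vZ) (Do [])
       (Do [Get vP Lft vY, Get vH Rgt vY, Put Rgt vP vY, Put Lft vH vY])"

definition mark_letters :: prog where
  "mark_letters = Do [Get vI InnHd vC] ;;
     While (Differ vI vZ) (Do [Get vA Lab vI, Put Mrk vA vC, Get vI CmpNx vI])"

text \<open>The loop has no end test: the sentinel position carries the letter 0, which no component
  marks.\<close>

definition find_exit :: prog where
  "find_exit = Do [Get vP Rgt vZ, Get vA Wd vP, Get vD Mrk vA] ;;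
     While (Same vD vC) (Do [Get vP Rgt vP, Get vA Wd vP, Get vD Mrk vA])"

definition push_bucket :: "var \<Rightarrow> prog" where
  "push_bucket x = Do [Get vH BktHd vP, Put BktNx x vH, Put BktHd vP x]"

text \<open>The dying component was alive just before letter \<open>vJ\<close>, so a leaving
  transition with that label carries its target over the letter; the target then depends on itself
  only from \<open>vG\<close>, the next position, on. A freed target without the flag must read the
  current letter itself and goes into the bucket that is still being emptied.\<close>

definition release :: prog where
  "release = Do [Put Gone vC One, Get vA Wd vJ, Copy vG vJ, Inc vG, Get vI CrsHd vC] ;; While (Differ vI vZ)
     (Do [Get vD Dst vI, Get vD Cmp vD, Get vH Lab vI] ;;
      Branch (Same vH vA) (Do [Put Flg vD vJ]) (Do []) ;;
      Do [Get vH Deg vD, Dec vH, Put Deg vD vH] ;;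
      Branch (Same vH vZ)
        (Do [Get vH Flg vD, Copy vP vJ] ;; Branch (Same vH vJ) (Do [Copy vP vG]) (Do []) ;; push_bucket vD)
        (Do []) ;;
      Do [Get vI CmpNx vI])"

text \<open>A component is filed where it becomes free and, unless it dies there, once more at its
  exit. On this second visit the search stops immediately at the current position, which triggers
  the release.\<close>

definition empty_bucket :: prog where
  "empty_bucket = While (Differ vC vZ)
     (Do [Get vH BktNx vC, Put BktHd vJ vH] ;; mark_letters ;; find_exit ;;
      Branch (Same vP vJ) release (push_bucket vC) ;; Do [Get vC BktHd vJ])"

definition read_letters :: prog where
  "read_letters = Do [Lit vJ 1, Get vC Cmp Init, Put BktHd vJ vC] ;; While (Differ vJ Sent)
     (Do [Get vC BktHd vJ] ;; empty_bucket ;; unlink_position ;; Do [Inc vJ])"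

definition answer :: prog where
  "answer = Do [Get vC Cmp Fin, Get vH Gone vC] ;; Branch (Same vH vZ) (Do [Inc Ans]) (Do [])"

definition supersequence_prog :: prog where
  "supersequence_prog = read_input ;; depth_first ;; find_components ;; sort_transitions ;;
     link_positions ;; read_letters ;; answer"

section \<open>Linked lists\<close>

fun chain :: "(nat \<Rightarrow> nat) \<Rightarrow> nat \<Rightarrow> nat list \<Rightarrow> bool" where
  "chain f h [] \<longleftrightarrow> h = 0"
| "chain f h (x # xs) \<longleftrightarrow> h = x \<and> x \<noteq> 0 \<and> chain f (f x) xs"

lemma chain_0 [simp]: "chain f 0 xs \<longleftrightarrow> xs = []"
  by (cases xs) auto

lemma chain_pos: "h \<noteq> 0 \<Longrightarrow> chain f h xs \<longleftrightarrow> (\<exists>ys. xs = h # ys \<and> chain f (f h) ys)"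
  by (cases xs) auto

lemma chain_upd [simp]: "x \<notin> set xs \<Longrightarrow> chain (f(x := y)) h xs \<longleftrightarrow> chain f h xs"
  by (induction xs arbitrary: h) auto

text \<open>Transitions are pushed in increasing order.\<close>

definition selected :: "(nat \<Rightarrow> bool) \<Rightarrow> nat \<Rightarrow> nat list" where
  "selected R j = filter R (rev [1..<Suc j])"

lemma selected_0 [simp]: "selected R 0 = []"
  by (simp add: selected_def)

lemma selected_Suc [simp]:
  "selected R (Suc j) = (if R (Suc j) then Suc j # selected R j else selected R j)"
  by (simp add: selected_def)

lemma set_selected [simp]: "set (selected R j) = {e. 1 \<le> e \<and> e \<le> j \<and> R e}"
  by (auto simp: selected_def)

lemma distinct_selected [simp]: "distinct (selected R j)"
  by (simp add: selected_def)

lemma sum_selected: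
  fixes f :: "nat \<Rightarrow> nat"
  assumes "\<And>e. 1 \<le> e \<Longrightarrow> e \<le> j \<Longrightarrow> f e \<in> {1..n}"
  shows "(\<Sum>u\<in>{1..n}. length (selected (\<lambda>e. f e = u) j)) = j"
  using assms
proof (induction j)
  case (Suc j)
  have "(\<Sum>u\<in>{1..n}. length (selected (\<lambda>e. f e = u) (Suc j))) =
      (\<Sum>u\<in>{1..n}. length (selected (\<lambda>e. f e = u) j) + (if u = f (Suc j) then 1 else 0))"
    by (rule sum.cong) auto
  also have "\<dots> = j + (\<Sum>u\<in>{1..n}. if u = f (Suc j) then 1 else 0)"
    using Suc by (simp add: sum.distrib)
  also have "(\<Sum>u\<in>{1..n}. if u = f (Suc j) then 1 else 0) = (1 :: nat)"
    using Suc.prems[of "Suc j"] by (subst sum.delta) auto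
  finally show ?case by simp
qed simp

text \<open>The additive form avoids subtraction on \<open>nat\<close>. The summand may depend on
  the index, which the weighted potential requires.\<close>

lemma sum_upd:
  fixes f :: "'b \<Rightarrow> nat \<Rightarrow> nat"
  assumes "u \<in> {1..n}"
  shows "(\<Sum>x\<in>{1..n}. f ((g(u := y)) x) x) + f (g u) u = (\<Sum>x\<in>{1..n}. f (g x) x) + f y u"
proof -
  have "(\<Sum>x\<in>{1..n}. f ((g(u := y)) x) x) = f y u + (\<Sum>x\<in>{1..n} - {u}. f ((g(u := y)) x) x)"
    using assms sum.remove[of "{1..n}" u "\<lambda>x. f ((g(u := y)) x) x"] by simp
  also have "(\<Sum>x\<in>{1..n} - {u}. f ((g(u := y)) x) x) = (\<Sum>x\<in>{1..n} - {u}. f (g x) x)"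
    by (rule sum.cong) auto
  finally show ?thesis using assms sum.remove[of "{1..n}" u "\<lambda>x. f (g x) x"] by simp
qed

text \<open>The header fills addresses 0 to 5, while letters and transitions count from 1; hence the
  offsets \<open>5 + i\<close> and \<open>3 + l + 3 * e\<close>.\<close>

locale encoded = automaton +
  fixes inp :: "nat \<Rightarrow> nat"
  assumes inp_header: "inp 0 = l" "inp 3 = m" "inp 4 = q0" "inp 5 = qf"
    and inp_word: "1 \<le> i \<Longrightarrow> i \<le> l \<Longrightarrow> inp (5 + i) = w i"
    and inp_trans: "1 \<le> e \<Longrightarrow> e \<le> m \<Longrightarrow>
      inp (3 + l + 3 * e) = src e \<and> inp (4 + l + 3 * e) = lab e \<and> inp (5 + l + 3 * e) = dst e"
begin

abbreviation out_list :: "nat \<Rightarrow> nat list" where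
  "out_list u \<equiv> selected (\<lambda>e. src e = u) m"

abbreviation in_list :: "nat \<Rightarrow> nat list" where
  "in_list u \<equiv> selected (\<lambda>e. dst e = u) m"

abbreviation remaining :: "(nat \<Rightarrow> nat list) \<Rightarrow> nat" where
  "remaining rest \<equiv> \<Sum>u\<in>{1..n}. length (rest u)"

section \<open>Reading the input\<close>

definition loaded :: "(var \<Rightarrow> nat) \<Rightarrow> (arr \<Rightarrow> nat \<Rightarrow> nat) \<Rightarrow> bool" where
  "loaded v a \<longleftrightarrow> v vZ = 0 \<and> v One = 1 \<and> v Len = l \<and> v NumT = m \<and> v Init = q0 \<and> v Fin = qf \<and>
     v Sent = Suc l \<and> a Wd = w \<and>
     (\<forall>e. 1 \<le> e \<and> e \<le> m \<longrightarrow> a Src e = src e \<and> a Lab e = lab e \<and> a Dst e = dst e)"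

lemma wp_read_word:
  assumes "v vZ = 0" "v Len = l" "v vI = 6" "v vJ = 0" "a Wd = (\<lambda>_. 0)"
  shows "wp inp read_word (\<lambda>t' v' a'. t' \<le> t + 5 * l + 1 \<and> a' Wd = w \<and> v' vI = 6 + l) t v a"
  unfolding read_word_def
proof (rule wp_While_frame[where T = "t + 5 * l" and I = "\<lambda>t' v' a'. v' vJ \<le> l \<and> t' \<le> t + 5 * v' vJ \<and>
    v' vI = 6 + v' vJ \<and> (\<forall>i. a' Wd i = (if i \<le> v' vJ then w i else 0))"], goal_cases)
  case 1
  then show ?case using assms w_out by simp
next
  case (2 t' v' a')
  have "v' Len = l" using 2(4) assms by simp
  moreover have "inp (v' vI) = w (Suc (v' vJ))" using 2 \<open>v' Len = l\<close> inp_word[of "Suc (v' vJ)"] by simp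
  ultimately show ?case using 2(1,2) by (auto simp: le_Suc_eq)
next
  case (3 t' v' a')
  have "v' Len = l" using 3(4) assms by simp
  then have "v' vJ = l" using 3(2) by simp
  then have "a' Wd = w" using 3(1) w_out by (intro ext) (simp add: not_le)
  then show ?case using 3(1) \<open>v' vJ = l\<close> by simp
qed auto

lemma wp_read_transitions:
  assumes "v NumT = m" "v vI = 6 + l" "v vJ = 0" "a OutHd = (\<lambda>_. 0)" "a InHd = (\<lambda>_. 0)"
  shows "wp inp read_transitions (\<lambda>t' v' a'. t' \<le> t + 17 * m + 1 \<and>
    (\<forall>e. 1 \<le> e \<and> e \<le> m \<longrightarrow> a' Src e = src e \<and> a' Lab e = lab e \<and> a' Dst e = dst e) \<and>
    (\<forall>u. chain (a' OutNx) (a' OutHd u) (out_list u)) \<and>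
    (\<forall>u. chain (a' InNx) (a' InHd u) (in_list u))) t v a"
  unfolding read_transitions_def
proof (rule wp_While_frame[where T = "t + 17 * m" and I = "\<lambda>t' v' a'. v' vJ \<le> m \<and> t' \<le> t + 17 * v' vJ \<and>
    v' vI = 6 + l + 3 * v' vJ \<and>
    (\<forall>e. 1 \<le> e \<and> e \<le> v' vJ \<longrightarrow> a' Src e = src e \<and> a' Lab e = lab e \<and> a' Dst e = dst e) \<and>
    (\<forall>u. chain (a' OutNx) (a' OutHd u) (selected (\<lambda>e. src e = u) (v' vJ))) \<and>
    (\<forall>u. chain (a' InNx) (a' InHd u) (selected (\<lambda>e. dst e = u) (v' vJ)))"], goal_cases)
  case 1
  then show ?case using assms by simp
next
  case (2 t' v' a')
  have "v' NumT = m" using 2(4) assms by simp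
  then have j: "Suc (v' vJ) \<le> m" using 2(1,2) by simp
  then have "inp (6 + l + 3 * v' vJ) = src (Suc (v' vJ))" "inp (Suc (6 + l + 3 * v' vJ)) = lab (Suc (v' vJ))"
    "inp (Suc (Suc (6 + l + 3 * v' vJ))) = dst (Suc (v' vJ))"
    using inp_trans[of "Suc (v' vJ)"] by (simp_all add: algebra_simps)
  then show ?case using 2(1) j by (auto simp: le_Suc_eq)
next
  case (3 t' v' a')
  have "v' NumT = m" using 3(4) assms by simp
  then have "v' vJ = m" using 3(2) by simp
  then show ?case using 3(1) by auto
qed auto

lemma wp_read_input:
  "wp inp read_input (\<lambda>t' v' a'. t' \<le> 5 * l + 17 * m + 50 \<and> loaded v' a' \<and>
    (\<forall>u. chain (a' OutNx) (a' OutHd u) (out_list u)) \<and>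
    (\<forall>u. chain (a' InNx) (a' InHd u) (in_list u)) \<and>
    (\<forall>b. b \<notin> warrs read_input \<longrightarrow> a' b = (\<lambda>_. 0))) 0 (\<lambda>_. 0) (\<lambda>_ _. 0)"
  unfolding read_input_def
  apply simp
  apply (rule wp_conseq[OF wp_read_word])
       apply (simp_all add: inp_header)
  apply (rule wp_conseq[OF wp_read_transitions])
       apply (simp_all add: inp_header read_word_def read_transitions_def loaded_def)
  done

section \<open>Depth-first search\<close>

text \<open>The time bound is amortized: an edge not yet scanned holds 20 units, 12 for its own scan
  and 8 that pass to the state it may push, to pay for the later pop.\<close>

definition visit_inv ::
  "nat \<Rightarrow> nat \<Rightarrow> (var \<Rightarrow> nat) \<Rightarrow> (arr \<Rightarrow> nat \<Rightarrow> nat) \<Rightarrow> nat list \<Rightarrow> nat list \<Rightarrow> (nat \<Rightarrow> nat list) \<Rightarrow> bool" where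
  "visit_inv T t v a F S rest \<longleftrightarrow>
     chain (a FinNx) (v vX) F \<and> chain (a Par) (v vU) S \<and> (\<forall>u. chain (a OutNx) (a OutHd u) (rest u)) \<and>
     (\<forall>y. a Vis y = (if y \<in> set F \<union> set S then 1 else 0)) \<and> dfs_inv E F S \<and>
     set F \<union> set S \<subseteq> {1..n} \<and> q0 \<in> set F \<union> set S \<and>
     (\<forall>u. set (rest u) \<subseteq> {e. 1 \<le> e \<and> e \<le> m \<and> src e = u}) \<and>
     (\<forall>e. 1 \<le> e \<longrightarrow> e \<le> m \<longrightarrow> e \<notin> set (rest (src e)) \<longrightarrow> dst e \<in> set F \<union> set S) \<and>
     t + 20 * remaining rest + 8 * length S \<le> T"

lemma visit_inv_finish:
  assumes inv: "visit_inv T t v a F S rest" and u: "v vU = u" "u \<noteq> 0" and "a OutHd u = 0"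
    and v': "v' vX = u" "v' vU = a Par u" and a': "a' = a(FinNx := (a FinNx)(u := v vX))" and t': "t' \<le> t + 8"
  shows "\<exists>F S rest. visit_inv T t' v' a' F S rest"
proof -
  note i = inv[unfolded visit_inv_def]
  have "chain (a Par) u S" using i u(1) by blast
  then obtain S' where S: "S = u # S'" "chain (a Par) (a Par u) S'"
    using u(2) by (auto simp: chain_pos)
  have "chain (a OutNx) 0 (rest u)" using i assms(4) by metis
  then have rest: "rest u = []" by simp
  have edges: "\<And>e. 1 \<le> e \<Longrightarrow> e \<le> m \<Longrightarrow> e \<notin> set (rest (src e)) \<Longrightarrow> dst e \<in> set F \<union> set S" using i by blast
  have "E `` {u} \<subseteq> set F \<union> set (u # S')"
  proof
    fix y assume "y \<in> E `` {u}"
    then obtain e where "1 \<le> e" "e \<le> m" "src e = u" "dst e = y" by (blast elim: E_E)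
    then show "y \<in> set F \<union> set (u # S')" using edges[of e] rest S(1) by simp
  qed
  moreover have dfs: "dfs_inv E F (u # S')" using i S(1) by blast
  ultimately have "dfs_inv E (u # F) S'" by (rule dfs_inv_pop[rotated])
  moreover have "u \<notin> set F" using dfs by (auto simp: dfs_inv_def)
  then have "chain (a' FinNx) (v' vX) (u # F)" using i v' u(2) by (simp add: a')
  moreover have "set (u # F) \<union> set S' = set F \<union> set S" using S(1) by simp
  moreover have "chain (a' Par) (v' vU) S'" using S(2) v'(2) by (simp add: a')
  moreover have "t' + 20 * remaining rest + 8 * length S' \<le> T" using i t' S(1) by simp
  moreover have "a' OutNx = a OutNx" "a' OutHd = a OutHd" "a' Vis = a Vis" by (simp_all add: a')
  ultimately have "visit_inv T t' v' a' (u # F) S' rest"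
    using i unfolding visit_inv_def by metis
  then show ?thesis by blast
qed

lemma visit_inv_edge:
  assumes inv: "visit_inv T t v a F S rest" and u: "v vU = u" "u \<noteq> 0" and e: "a OutHd u = e" "e \<noteq> 0"
    and y: "y = dst e" and t': "t' \<le> t + 12" and v': "v' vX = v vX"
    and push: "a Vis y = 0 \<Longrightarrow> v' vU = y \<and>
      a' = a(OutHd := (a OutHd)(u := a OutNx e), Vis := (a Vis)(y := 1), Par := (a Par)(y := u))"
    and skip: "a Vis y \<noteq> 0 \<Longrightarrow> v' vU = u \<and> a' = a(OutHd := (a OutHd)(u := a OutNx e))"
  shows "\<exists>F S rest. visit_inv T t' v' a' F S rest"
proof -
  note i = inv[unfolded visit_inv_def]
  have "chain (a OutNx) e (rest u)" using i e(1) by metis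
  then obtain es where es: "rest u = e # es" "chain (a OutNx) (a OutNx e) es"
    using e(2) by (auto simp: chain_pos)
  have "chain (a Par) u S" using i u(1) by blast
  then obtain S' where S: "S = u # S'" using u(2) by (auto simp: chain_pos)
  have "set (rest u) \<subseteq> {e. 1 \<le> e \<and> e \<le> m \<and> src e = u}" using i by blast
  then have e_in: "1 \<le> e \<and> e \<le> m \<and> src e = u" using es(1) by simp
  then have un: "u \<in> {1..n}" and yn: "y \<in> {1..n}" and uy: "(u, y) \<in> E" using src_in dst_in E_I y by auto
  let ?rest = "rest(u := es)"
  have sum: "remaining ?rest + 1 = remaining rest"
    using sum_upd[OF un, of "\<lambda>xs x. length xs" rest es] es(1) by simp
  have rest_sub: "set (?rest x) \<subseteq> {e. 1 \<le> e \<and> e \<le> m \<and> src e = x}" for x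
  proof -
    have "set (?rest x) \<subseteq> set (rest x)" using es(1) by auto
    then show ?thesis using i by blast
  qed
  have edges: "\<And>e. 1 \<le> e \<Longrightarrow> e \<le> m \<Longrightarrow> e \<notin> set (rest (src e)) \<Longrightarrow> dst e \<in> set F \<union> set S" using i by blast
  have edges': "dst f \<in> insert y (set F \<union> set S)" if "1 \<le> f" "f \<le> m" "f \<notin> set (?rest (src f))" for f
    using edges[OF that(1,2)] that(3) es(1) y by (auto split: if_splits)
  have chains: "chain (a OutNx) (((a OutHd)(u := a OutNx e)) x) (?rest x)" for x using i es(2) by simp
  have vis: "a Vis x = (if x \<in> set F \<union> set S then 1 else 0)" for x using i by blast
  show ?thesis
  proof (cases "a Vis y = 0")
    case True
    then have new: "y \<notin> set F \<union> set S" using vis by (metis zero_neq_one)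
    have p: "v' vU = y" "a' = a(OutHd := (a OutHd)(u := a OutNx e), Vis := (a Vis)(y := 1), Par := (a Par)(y := u))"
      using push[OF True] by auto
    have "dfs_inv E F S" using i by blast
    then have "dfs_inv E F (y # S)" unfolding S
      by (rule dfs_inv_push[OF _ uy]) (use new S in simp)
    moreover have "chain (a' FinNx) (v' vX) F" using i v' by (simp add: p)
    moreover have "chain (a' Par) (v' vU) (y # S)" using i new yn u(1) by (simp add: p)
    moreover have "\<forall>u. chain (a' OutNx) (a' OutHd u) (?rest u)" using chains by (simp add: p del: fun_upd_apply) (simp add: p)
    moreover have "\<forall>x. a' Vis x = (if x \<in> set F \<union> set (y # S) then 1 else 0)" using vis by (simp add: p)
    moreover have "set F \<union> set (y # S) \<subseteq> {1..n}" "q0 \<in> set F \<union> set (y # S)" using i yn by auto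
    moreover have "t' + 20 * remaining ?rest + 8 * length (y # S) \<le> T"
    proof -
      have "t + 20 * remaining rest + 8 * length S \<le> T" using i by blast
      then show ?thesis using sum t' by simp
    qed
    moreover have "\<forall>e. 1 \<le> e \<longrightarrow> e \<le> m \<longrightarrow> e \<notin> set (?rest (src e)) \<longrightarrow> dst e \<in> set F \<union> set (y # S)"
      using edges' by simp
    ultimately have "visit_inv T t' v' a' F (y # S) ?rest" using rest_sub unfolding visit_inv_def by blast
    then show ?thesis by blast
  next
    case False
    then have old: "y \<in> set F \<union> set S" using vis by metis
    have p: "v' vU = u" "a' = a(OutHd := (a OutHd)(u := a OutNx e))" using skip[OF False] by auto
    have "chain (a' FinNx) (v' vX) F" using i v' by (simp add: p)
    moreover have "chain (a' Par) (v' vU) S" using i u(1) by (simp add: p)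
    moreover have "\<forall>u. chain (a' OutNx) (a' OutHd u) (?rest u)" using chains by (simp add: p del: fun_upd_apply) (simp add: p)
    moreover have "\<forall>x. a' Vis x = (if x \<in> set F \<union> set S then 1 else 0)" using vis by (simp add: p)
    moreover have "t' + 20 * remaining ?rest + 8 * length S \<le> T"
    proof -
      have "t + 20 * remaining rest + 8 * length S \<le> T" using i by blast
      then show ?thesis using sum t' by simp
    qed
    moreover have "\<forall>e. 1 \<le> e \<longrightarrow> e \<le> m \<longrightarrow> e \<notin> set (?rest (src e)) \<longrightarrow> dst e \<in> set F \<union> set S"
      using edges' old by (metis insert_absorb)
    ultimately have "visit_inv T t' v' a' F S ?rest" using rest_sub i unfolding visit_inv_def by blast
    then show ?thesis by blast
  qed
qed

lemma wp_depth_first: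
  assumes loaded: "loaded v a"
    and out: "\<forall>u. chain (a OutNx) (a OutHd u) (out_list u)"
    and zero: "a Vis = (\<lambda>_. 0)" "a Par = (\<lambda>_. 0)" "a FinNx = (\<lambda>_. 0)"
  shows "wp inp depth_first (\<lambda>t' v' a'. t' \<le> t + 20 * m + 20 \<and>
    (\<exists>F. chain (a' FinNx) (v' vX) F \<and> finish_order E F \<and> set F = {1..n} \<and> distinct F)) t v a"
  unfolding depth_first_def visit_def wp_Seq wp_Cons wp_Nil
proof (rule wp_While_frame[where T = "t + 20 * m + 11" and
    I = "\<lambda>t' v' a'. \<exists>F S rest. visit_inv (t + 20 * m + 11) t' v' a' F S rest"], goal_cases)
  case 1
  have "(\<Sum>u\<in>{1..n}. length (out_list u)) = m"
    by (rule sum_selected) (use src_in in simp)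
  then have "visit_inv (t + 20 * m + 11) (t + 3) (v(vU := q0, vX := 0)) (a(Vis := (a Vis)(q0 := 1))) [] [q0]
      (\<lambda>u. out_list u)"
    using q0_in out zero by (auto simp: visit_inv_def dfs_inv_init)
  then show ?case using loaded by (auto simp: loaded_def eval_nat_numeral fun_upd_twist)
next
  case (2 t' v' a')
  then obtain F S rest where inv: "visit_inv (t + 20 * m + 11) t' v' a' F S rest" by blast
  have fr: "v' vZ = 0" "v' One = 1" "a' Dst = a Dst" using 2(4,5) loaded by (auto simp: loaded_def)
  have u: "v' vU \<noteq> 0" using 2(2) fr by simp
  show ?case
  proof (cases "a' OutHd (v' vU) = 0")
    case True
    then show ?thesis using fr u by (simp, intro visit_inv_finish[OF inv refl u True]) auto
  next
    case False
    let ?e = "a' OutHd (v' vU)"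
    have "chain (a' OutNx) ?e (rest (v' vU))" "set (rest (v' vU)) \<subseteq> {e. 1 \<le> e \<and> e \<le> m \<and> src e = v' vU}"
      using inv unfolding visit_inv_def by blast+
    then have "a' Dst ?e = dst ?e" using False loaded fr(3) by (auto simp: chain_pos loaded_def)
    then show ?thesis using fr u False
      by (cases "a' Vis (dst ?e) = 0"; simp; intro visit_inv_edge[OF inv refl u refl False refl])
        (auto simp: fun_upd_twist)
  qed
next
  case (3 t' v' a')
  then obtain F S rest where inv: "visit_inv (t + 20 * m + 11) t' v' a' F S rest" by blast
  have "v' vU = 0" using 3(2,4) loaded by (auto simp: loaded_def)
  moreover have "chain (a' Par) (v' vU) S" using inv unfolding visit_inv_def by blast
  ultimately have S: "S = []" by simp
  have i: "dfs_inv E F []" "set F \<subseteq> {1..n}" "q0 \<in> set F" "chain (a' FinNx) (v' vX) F" "t' \<le> t + 20 * m + 11"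
    using inv unfolding visit_inv_def S by auto
  have "E `` set F \<subseteq> set F" using i(1) by (simp add: dfs_inv_def)
  have "q \<in> set F" if "q \<in> {1..n}" for q
    using reach_q0[OF that, folded E_def] i(3) \<open>E `` set F \<subseteq> set F\<close> by (induction rule: rtrancl_induct) auto
  then have "set F = {1..n}" using i(2) by blast
  then show ?case using i by (auto simp: dfs_inv_def)
qed (auto simp: visit_inv_def)

section \<open>Collecting the components\<close>

text \<open>\<open>B\<close> and \<open>cm\<close> freeze what was assigned before, \<open>K\<close>
  is what has been collected for \<open>r\<close>, and \<open>S\<close> is the stack. The path
  clause is the premise of \<open>finish_order_collect\<close>. Once \<open>S\<close> is empty, the
  lists of all states in \<open>K\<close> are exhausted, so predecessors of \<open>K\<close> lie in
  \<open>B\<close> or \<open>K\<close>, as \<open>mutual_in_closed\<close> requires.\<close>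

definition collect_inv :: "nat \<Rightarrow> nat \<Rightarrow> nat set \<Rightarrow> (nat \<Rightarrow> nat) \<Rightarrow>
    nat \<Rightarrow> (var \<Rightarrow> nat) \<Rightarrow> (arr \<Rightarrow> nat \<Rightarrow> nat) \<Rightarrow> nat list \<Rightarrow> nat set \<Rightarrow> (nat \<Rightarrow> nat list) \<Rightarrow> bool" where
  "collect_inv T r B cm t v a S K rest \<longleftrightarrow>
     chain (a Stk) (v vY) S \<and> distinct S \<and> set S \<subseteq> K \<and> r \<in> K \<and> K \<subseteq> {1..n} - B \<and>
     (\<forall>x. a Cmp x = (if x \<in> K then r else cm x)) \<and>
     (\<forall>x \<in> K. (x, r) \<in> (restrict_src E (- B))\<^sup>*) \<and>
     (\<forall>u. chain (a InNx) (a InHd u) (rest u)) \<and>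
     (\<forall>u. set (rest u) \<subseteq> {e. 1 \<le> e \<and> e \<le> m \<and> dst e = u}) \<and>
     (\<forall>u. u \<notin> B \<union> K \<longrightarrow> rest u = in_list u) \<and>
     (\<forall>e. 1 \<le> e \<longrightarrow> e \<le> m \<longrightarrow> dst e \<in> K \<longrightarrow> e \<notin> set (rest (dst e)) \<longrightarrow> src e \<in> B \<union> K) \<and>
     (\<forall>u \<in> K - set S. rest u = []) \<and>
     t + 20 * remaining rest + 8 * length S \<le> T"

lemma collect_inv_pop:
  assumes inv: "collect_inv T r B cm t v a S K rest" and u: "v vY = u" "u \<noteq> 0" and "a InHd u = 0"
    and v': "v' vY = a Stk u" and t': "t' \<le> t + 8"
  shows "\<exists>S K rest. collect_inv T r B cm t' v' a S K rest"
proof -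
  note i = inv[unfolded collect_inv_def]
  have "chain (a Stk) u S" using i u(1) by blast
  then obtain S' where S: "S = u # S'" "chain (a Stk) (a Stk u) S'"
    using u(2) by (auto simp: chain_pos)
  have "chain (a InNx) 0 (rest u)" using i assms(4) by metis
  then have rest: "rest u = []" by simp
  have emp: "\<forall>x \<in> K - set S. rest x = []" using i by blast
  have "t + 20 * remaining rest + 8 * length S \<le> T" using i by blast
  then have "t' + 20 * remaining rest + 8 * length S' \<le> T" using t' S(1) by simp
  moreover have "\<forall>x \<in> K - set S'. rest x = []" using emp rest S(1) by auto
  moreover have "distinct S" "set S \<subseteq> K" using i by blast+
  then have "distinct S'" "set S' \<subseteq> K" using S(1) by auto
  moreover have "chain (a Stk) (v' vY) S'" using S(2) v' by simp
  ultimately have "collect_inv T r B cm t' v' a S' K rest" using i unfolding collect_inv_def by blast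
  then show ?thesis by blast
qed

lemma collect_inv_edge:
  assumes inv: "collect_inv T r B cm t v a S K rest" and u: "v vY = u" "u \<noteq> 0"
    and cm: "\<And>x. x \<in> B \<longleftrightarrow> cm x \<noteq> 0"
    and e: "a InHd u = e" "e \<noteq> 0" and y: "y = src e" and t': "t' \<le> t + 12"
    and push: "a Cmp y = 0 \<Longrightarrow> v' vY = y \<and>
      a' = a(InHd := (a InHd)(u := a InNx e), Cmp := (a Cmp)(y := r), Stk := (a Stk)(y := u))"
    and skip: "a Cmp y \<noteq> 0 \<Longrightarrow> v' vY = u \<and> a' = a(InHd := (a InHd)(u := a InNx e))"
  shows "\<exists>S K rest. collect_inv T r B cm t' v' a' S K rest"
proof -
  note i = inv[unfolded collect_inv_def]
  have "chain (a InNx) e (rest u)" using i e(1) by metis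
  then obtain es where es: "rest u = e # es" "chain (a InNx) (a InNx e) es"
    using e(2) by (auto simp: chain_pos)
  have chS: "chain (a Stk) u S" using i u(1) by blast
  then obtain S' where S: "S = u # S'" using u(2) by (auto simp: chain_pos)
  have dS: "distinct S" and SK: "set S \<subseteq> K" and rK: "r \<in> K" and KB: "K \<subseteq> {1..n} - B" using i by blast+
  have uK: "u \<in> K" using SK S by simp
  have "set (rest u) \<subseteq> {e. 1 \<le> e \<and> e \<le> m \<and> dst e = u}" using i by blast
  then have e_in: "1 \<le> e \<and> e \<le> m \<and> dst e = u" using es(1) by simp
  then have un: "u \<in> {1..n}" and yn: "y \<in> {1..n}" and yu: "(y, u) \<in> E" using src_in dst_in E_I y by auto
  have r0: "r \<noteq> 0" using rK KB by auto
  let ?rest = "rest(u := es)"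
  have sum: "remaining ?rest + 1 = remaining rest"
    using sum_upd[OF un, of "\<lambda>xs x. length xs" rest es] es(1) by simp
  have time: "t + 20 * remaining rest + 8 * length S \<le> T" using i by blast
  have rest_sub: "set (?rest x) \<subseteq> {e. 1 \<le> e \<and> e \<le> m \<and> dst e = x}" for x
  proof -
    have "set (?rest x) \<subseteq> set (rest x)" using es(1) by auto
    then show ?thesis using i by blast
  qed
  have edges: "\<And>e. 1 \<le> e \<Longrightarrow> e \<le> m \<Longrightarrow> dst e \<in> K \<Longrightarrow> e \<notin> set (rest (dst e)) \<Longrightarrow> src e \<in> B \<union> K" using i by blast
  have edges': "src f \<in> insert y (B \<union> K)"
    if "1 \<le> f" "f \<le> m" "dst f \<in> K" "f \<notin> set (?rest (dst f))" for f
    using edges[OF that(1-3)] that(4) es(1) y by (auto split: if_splits)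
  have full: "rest x = in_list x" if "x \<notin> B \<union> K" for x using i that by blast
  have full': "?rest x = in_list x" if "x \<notin> B \<union> K" for x
    using full[OF that] that uK by auto
  have empty: "rest x = []" if "x \<in> K - set S" for x using i that by blast
  have empty': "?rest x = []" if "x \<in> K - set S" for x
    using empty[OF that] that S by auto
  have chains: "chain (a InNx) (((a InHd)(u := a InNx e)) x) (?rest x)" for x using i es(2) by simp
  have cmp: "a Cmp x = (if x \<in> K then r else cm x)" for x using i by blast
  have path: "(x, r) \<in> (restrict_src E (- B))\<^sup>*" if "x \<in> K" for x using i that by blast
  show ?thesis
  proof (cases "a Cmp y = 0")
    case True
    then have new: "y \<notin> K" "y \<notin> B" using cmp cm r0 by (auto split: if_splits)
    have p: "v' vY = y" "a' = a(InHd := (a InHd)(u := a InNx e), Cmp := (a Cmp)(y := r), Stk := (a Stk)(y := u))"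
      using push[OF True] by auto
    have yS: "y \<notin> set S" using new(1) SK by blast
    have "(y, u) \<in> restrict_src E (- B)" using yu new(2) by simp
    then have "(y, r) \<in> (restrict_src E (- B))\<^sup>*" using path[OF uK] by (rule converse_rtrancl_into_rtrancl)
    then have "\<forall>x \<in> insert y K. (x, r) \<in> (restrict_src E (- B))\<^sup>*" using path by blast
    moreover have "chain (a' Stk) (v' vY) (y # S)" using chS yS yn by (simp add: p)
    moreover have "distinct (y # S)" "set (y # S) \<subseteq> insert y K" using dS SK yS by auto
    moreover have "r \<in> insert y K" "insert y K \<subseteq> {1..n} - B" using rK KB yn new by auto
    moreover have "\<forall>x. a' Cmp x = (if x \<in> insert y K then r else cm x)" using cmp by (simp add: p)
    moreover have "\<forall>u. chain (a' InNx) (a' InHd u) (?rest u)" using chains by (simp add: p del: fun_upd_apply) (simp add: p)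
    moreover have "\<forall>x. x \<notin> B \<union> insert y K \<longrightarrow> ?rest x = in_list x" using full' by blast
    moreover have "\<forall>e. 1 \<le> e \<longrightarrow> e \<le> m \<longrightarrow> dst e \<in> insert y K \<longrightarrow> e \<notin> set (?rest (dst e)) \<longrightarrow>
        src e \<in> B \<union> insert y K"
    proof (intro allI impI)
      fix f assume f: "1 \<le> f" "f \<le> m" "dst f \<in> insert y K" "f \<notin> set (?rest (dst f))"
      \<comment> \<open>The list of the newly found state is still complete, so none of its incoming
        transitions has been scanned.\<close>
      have "dst f \<noteq> y" using f full'[of y] new by auto
      then show "src f \<in> B \<union> insert y K" using edges'[OF f(1,2) _ f(4)] f(3) by auto
    qed
    moreover have "\<forall>x \<in> insert y K - set (y # S). ?rest x = []" using empty' by auto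
    moreover have "t' + 20 * remaining ?rest + 8 * length (y # S) \<le> T"
      using sum t' time by simp
    ultimately have "collect_inv T r B cm t' v' a' (y # S) (insert y K) ?rest"
      using rest_sub unfolding collect_inv_def by blast
    then show ?thesis by blast
  next
    case False
    then have old: "y \<in> B \<union> K" using cmp cm by (metis UnI1 UnI2)
    have p: "v' vY = u" "a' = a(InHd := (a InHd)(u := a InNx e))" using skip[OF False] by auto
    have "chain (a' Stk) (v' vY) S" using chS by (simp add: p)
    moreover have "\<forall>x. a' Cmp x = (if x \<in> K then r else cm x)" using cmp by (simp add: p)
    moreover have "\<forall>u. chain (a' InNx) (a' InHd u) (?rest u)" using chains by (simp add: p del: fun_upd_apply) (simp add: p)
    moreover have "t' + 20 * remaining ?rest + 8 * length S \<le> T"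
      using sum t' time by simp
    moreover have "\<forall>e. 1 \<le> e \<longrightarrow> e \<le> m \<longrightarrow> dst e \<in> K \<longrightarrow> e \<notin> set (?rest (dst e)) \<longrightarrow> src e \<in> B \<union> K"
      using edges' old by (metis insert_absorb)
    ultimately have "collect_inv T r B cm t' v' a' S K ?rest"
      using rest_sub dS SK rK KB path full' empty' unfolding collect_inv_def by blast
    then show ?thesis by blast
  qed
qed

lemma wp_collect:
  assumes loaded: "loaded v a" and r: "v vX = r"
    and cm: "\<And>x. x \<in> B \<longleftrightarrow> cm x \<noteq> 0"
    and inv: "collect_inv T r B cm t v a S K rest"
  shows "wp inp collect (\<lambda>t' v' a'. \<exists>t K rest. t' = Suc t \<and> collect_inv T r B cm t v' a' [] K rest) t v a"
  unfolding collect_def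
proof (rule wp_While_frame[where T = T and
    I = "\<lambda>t' v' a'. \<exists>S K rest. collect_inv T r B cm t' v' a' S K rest"], goal_cases)
  case 1
  then show ?case using inv by blast
next
  case (2 t' v' a')
  then obtain S K rest where inv: "collect_inv T r B cm t' v' a' S K rest" by blast
  have fr: "v' vZ = 0" "v' vX = r" "a' Src = a Src" using 2(4,5) loaded r by (auto simp: loaded_def)
  have u: "v' vY \<noteq> 0" using 2(2) fr by simp
  show ?case
  proof (cases "a' InHd (v' vY) = 0")
    case True
    then show ?thesis using fr u by (simp, intro collect_inv_pop[OF inv refl u True]) auto
  next
    case False
    let ?e = "a' InHd (v' vY)"
    have "chain (a' InNx) ?e (rest (v' vY))" "set (rest (v' vY)) \<subseteq> {e. 1 \<le> e \<and> e \<le> m \<and> dst e = v' vY}"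
      using inv unfolding collect_inv_def by blast+
    then have "a' Src ?e = src ?e" using False loaded fr(3) by (auto simp: chain_pos loaded_def)
    then show ?thesis using fr u False
      by (cases "a' Cmp (src ?e) = 0"; simp; intro collect_inv_edge[OF inv refl u cm refl False refl])
        (auto simp: fun_upd_twist)
  qed
next
  case (3 t' v' a')
  then obtain S K rest where inv: "collect_inv T r B cm t' v' a' S K rest" by blast
  have "v' vY = 0" using 3(2,4) loaded by (auto simp: loaded_def)
  moreover have "chain (a' Stk) (v' vY) S" using inv unfolding collect_inv_def by blast
  ultimately have S: "S = []" by simp
  show ?case using inv S by blast
qed (auto simp: collect_inv_def)

definition scc_inv :: "nat \<Rightarrow> nat list \<Rightarrow> nat \<Rightarrow> (var \<Rightarrow> nat) \<Rightarrow> (arr \<Rightarrow> nat \<Rightarrow> nat) \<Rightarrow> nat set \<Rightarrow>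
    nat list \<Rightarrow> nat list \<Rightarrow> (nat \<Rightarrow> nat list) \<Rightarrow> bool" where
  "scc_inv T F t v a B ys zs rest \<longleftrightarrow> F = ys @ zs \<and> chain (a FinNx) (v vX) zs \<and> set ys \<subseteq> B \<and> B \<subseteq> {1..n} \<and>
     (\<forall>x. x \<in> B \<longleftrightarrow> a Cmp x \<noteq> 0) \<and>
     (\<forall>x y. x \<in> B \<longrightarrow> mutual E x y \<longrightarrow> y \<in> B \<and> a Cmp x = a Cmp y) \<and> (\<forall>x \<in> B. mutual E x (a Cmp x)) \<and>
     (\<forall>u. chain (a InNx) (a InHd u) (rest u)) \<and>
     (\<forall>u. set (rest u) \<subseteq> {e. 1 \<le> e \<and> e \<le> m \<and> dst e = u}) \<and>
     (\<forall>u. u \<notin> B \<longrightarrow> rest u = in_list u) \<and>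
     t + 20 * remaining rest + 20 * length zs \<le> T"

lemma collect_inv_init:
  assumes inv: "scc_inv T F t v a B ys (r # zs) rest" and r: "r \<notin> B" "set F = {1..n}"
    and v': "v' vY = r" and a': "a' = a(Cmp := (a Cmp)(r := r), Stk := (a Stk)(r := 0))"
  shows "collect_inv (t' + 20 * remaining rest + 8) r B (a Cmp) t' v' a' [r] {r} rest"
proof -
  note i = inv[unfolded scc_inv_def]
  have "F = ys @ r # zs" using i by blast
  then have rn: "r \<in> {1..n}" using r(2) by auto
  have full: "rest u = in_list u" if "u \<notin> B" for u using i that by blast
  have "\<forall>u. chain (a InNx) (a InHd u) (rest u)" using i by blast
  then have "\<forall>u. chain (a' InNx) (a' InHd u) (rest u)" by (simp add: a')
  moreover have "\<forall>e. 1 \<le> e \<longrightarrow> e \<le> m \<longrightarrow> dst e \<in> {r} \<longrightarrow> e \<notin> set (rest (dst e)) \<longrightarrow> src e \<in> B \<union> {r}"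
    using full r(1) by auto
  moreover have "chain (a' Stk) (v' vY) [r]" using rn by (simp add: a' v')
  moreover have "\<forall>x. a' Cmp x = (if x \<in> {r} then r else a Cmp x)" by (simp add: a')
  moreover have "\<forall>u. set (rest u) \<subseteq> {e. 1 \<le> e \<and> e \<le> m \<and> dst e = u}" using i by blast
  moreover have "distinct [r]" "set [r] \<subseteq> {r}" "r \<in> {r}" "{r} \<subseteq> {1..n} - B" using rn r(1) by auto
  moreover have "\<forall>x \<in> {r}. (x, r) \<in> (restrict_src E (- B))\<^sup>*" by simp
  moreover have "\<forall>u \<in> {r} - set [r]. rest u = []" by simp
  moreover have "t' + 20 * remaining rest + 8 * length [r]
      \<le> t' + 20 * remaining rest + 8" by simp
  moreover have "\<forall>u. u \<notin> B \<union> {r} \<longrightarrow> rest u = in_list u" using full by blast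
  ultimately show ?thesis unfolding collect_inv_def by blast
qed

text \<open>\<open>K\<close> is exactly the component of \<open>r\<close>: the finishing order gives
  one inclusion (\<open>K1\<close>), closure under predecessors outside \<open>B\<close> the other
  (\<open>K2\<close>).\<close>

lemma scc_inv_component:
  assumes inv: "scc_inv T F t v a B ys (r # zs) rest" and r: "r \<notin> B" and F: "set F = {1..n}"
    "finish_order E F"
    and t1: "t1 \<le> t + 6" and col: "collect_inv (t1 + 20 * remaining rest + 8) r B (a Cmp) t'' v'' a' [] K rest'"
    and t': "t' \<le> t'' + 2" and v': "v' vX = a' FinNx r" and a': "a' FinNx = a FinNx"
  shows "\<exists>B ys zs rest. scc_inv T F t' v' a' B ys zs rest"
proof -
  note i = inv[unfolded scc_inv_def]
  note c = col[unfolded collect_inv_def]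
  have Feq: "F = ys @ r # zs" and ysB: "set ys \<subseteq> B" and Bn: "B \<subseteq> {1..n}" using i by blast+
  have rK: "r \<in> K" and KB: "K \<subseteq> {1..n} - B" using c by blast+
  have closed: "y \<in> B" "a Cmp x = a Cmp y" if "x \<in> B" "mutual E x y" for x y using i that by blast+
  have cmpB: "mutual E x (a Cmp x)" if "x \<in> B" for x using i that by blast
  have cmp: "a' Cmp x = (if x \<in> K then r else a Cmp x)" for x using c by blast
  have B: "x \<in> B \<longleftrightarrow> a Cmp x \<noteq> 0" for x using i by blast
  have path: "(x, r) \<in> (restrict_src E (- B))\<^sup>*" if "x \<in> K" for x using c that by blast
  have Esub: "E \<subseteq> set (ys @ r # zs) \<times> UNIV" using E_sub F(1) Feq by auto
  have K1: "mutual E x r" if "x \<in> K" for x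
  proof
    show "(r, x) \<in> E\<^sup>*" by (rule finish_order_collect[OF F(2)[unfolded Feq] Esub ysB path[OF that]])
    have "(restrict_src E (- B))\<^sup>* \<subseteq> E\<^sup>*" by (rule rtrancl_mono) blast
    then show "(x, r) \<in> E\<^sup>*" using path[OF that] by blast
  qed
  have edges: "src e \<in> B \<union> K" if "1 \<le> e" "e \<le> m" "dst e \<in> K" "e \<notin> set (rest' (dst e))" for e
    using c that by blast
  have empty: "rest' u = []" if "u \<in> K" for u using c that by auto
  have "x \<in> B \<union> K" if "(x, y) \<in> E" "y \<in> K" for x y
    using that edges empty by (metis E_E empty_iff list.set(1))
  then have K2: "x \<in> K" if "mutual E x r" for x
    by (rule mutual_in_closed[OF _ _ rK r that]) (use closed in blast)+
  let ?B = "B \<union> K"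
  have "\<forall>x. x \<in> ?B \<longleftrightarrow> a' Cmp x \<noteq> 0" using cmp B rK KB by auto
  moreover have "\<forall>x y. x \<in> ?B \<longrightarrow> mutual E x y \<longrightarrow> y \<in> ?B \<and> a' Cmp x = a' Cmp y"
  proof (intro allI impI)
    fix x y assume x: "x \<in> ?B" and xy: "mutual E x y"
    show "y \<in> ?B \<and> a' Cmp x = a' Cmp y"
    proof (cases "x \<in> B")
      case True
      then show ?thesis using closed[OF True xy] KB cmp[of x] cmp[of y] by auto
    next
      case False
      then have "x \<in> K" using x by simp
      then have "y \<in> K" using K1[of x] K2[of y] xy by (meson rtrancl_trans)
      then show ?thesis using \<open>x \<in> K\<close> cmp by simp
    qed
  qed
  moreover have "\<forall>x \<in> ?B. mutual E x (a' Cmp x)"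
  proof
    fix x assume "x \<in> ?B"
    then show "mutual E x (a' Cmp x)" using K1[of x] cmpB[of x] cmp[of x] by auto
  qed
  \<comment> \<open>The 20 units of the list entry \<open>r\<close> pay for 6 before the collection,
    8 for popping the root and 2 afterwards.\<close>
  moreover have "t' + 20 * remaining rest' + 20 * length zs \<le> T"
  proof -
    have "t + 20 * remaining rest + 20 * length (r # zs) \<le> T" using i by blast
    moreover have "t'' + 20 * remaining rest' + 8 * length ([] :: nat list)
       \<le> t1 + 20 * remaining rest + 8" using c by blast
    ultimately show ?thesis using t' t1 by simp
  qed
  moreover have "chain (a FinNx) (v vX) (r # zs)" using i by blast
  then have "chain (a' FinNx) (v' vX) zs" using v' a' by simp
  moreover have "F = (ys @ [r]) @ zs" using Feq by simp
  moreover have "set (ys @ [r]) \<subseteq> ?B" "?B \<subseteq> {1..n}" using ysB rK Bn KB by auto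
  ultimately have "scc_inv T F t' v' a' ?B (ys @ [r]) zs rest'"
    using c unfolding scc_inv_def by blast
  then show ?thesis by blast
qed

lemma scc_inv_skip:
  assumes inv: "scc_inv T F t v a B ys (r # zs) rest" and r: "r \<in> B"
    and t': "t' \<le> t + 20" and v': "v' vX = a FinNx r"
  shows "\<exists>B ys zs rest. scc_inv T F t' v' a B ys zs rest"
proof -
  note i = inv[unfolded scc_inv_def]
  have "chain (a FinNx) (v vX) (r # zs)" using i by blast
  then have "chain (a FinNx) (v' vX) zs" using v' by simp
  moreover have "F = ys @ r # zs" using i by blast
  then have "F = (ys @ [r]) @ zs" by simp
  moreover have "set ys \<subseteq> B" using i by blast
  then have "set (ys @ [r]) \<subseteq> B" using r by simp
  moreover have "t + 20 * remaining rest + 20 * length (r # zs) \<le> T" using i by blast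
  then have "t' + 20 * remaining rest + 20 * length zs \<le> T" using t' by simp
  ultimately have "scc_inv T F t' v' a B (ys @ [r]) zs rest" using i unfolding scc_inv_def by blast
  then show ?thesis by blast
qed

lemma wp_find_components:
  assumes loaded: "loaded v a"
    and inc: "\<forall>u. chain (a InNx) (a InHd u) (in_list u)"
    and zero: "a Cmp = (\<lambda>_. 0)"
    and F: "chain (a FinNx) (v vX) F" "finish_order E F" "set F = {1..n}" "distinct F"
  shows "wp inp find_components (\<lambda>t' v' a'. t' \<le> t + 20 * m + 20 * n + 1 \<and>
    components n m l src dst w q0 qf (a' Cmp)) t v a"
  unfolding find_components_def
proof (rule wp_While_frame[where T = "t + 20 * m + 20 * n" and
    I = "\<lambda>t' v' a'. \<exists>B ys zs rest. scc_inv (t + 20 * m + 20 * n) F t' v' a' B ys zs rest"], goal_cases)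
  case 1
  have "(\<Sum>u\<in>{1..n}. length (in_list u)) = m"
    by (rule sum_selected) (use dst_in in simp)
  moreover have "length F = n" using distinct_card[OF F(4)] F(3) by simp
  ultimately have "scc_inv (t + 20 * m + 20 * n) F t v a {} [] F (\<lambda>u. in_list u)"
    using F inc zero by (auto simp: scc_inv_def)
  then show ?case by blast
next
  case (2 t' v' a')
  then obtain B ys zs rest where inv: "scc_inv (t + 20 * m + 20 * n) F t' v' a' B ys zs rest" by blast
  have loaded': "loaded v' a'" using 2(4,5) loaded by (auto simp: loaded_def collect_def)
  then have vZ: "v' vZ = 0" by (simp add: loaded_def)
  have vX: "v' vX \<noteq> 0" using 2(2) vZ by simp
  have "chain (a' FinNx) (v' vX) zs" using inv unfolding scc_inv_def by blast
  then obtain zs' where zs: "zs = v' vX # zs'" using vX by (auto simp: chain_pos)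
  have B: "x \<in> B \<longleftrightarrow> a' Cmp x \<noteq> 0" for x using inv unfolding scc_inv_def by blast
  show ?case
  proof (cases "a' Cmp (v' vX) = 0")
    case False
    then have "v' vX \<in> B" using B by blast
    then show ?thesis using False vZ
      by simp (intro scc_inv_skip[OF inv[unfolded zs]]; simp)
  next
    case True
    then have r: "v' vX \<notin> B" using B by blast
    let ?r = "v' vX" and ?t = "Suc (Suc (Suc (Suc (Suc (Suc t')))))"
    let ?v = "v'(vH := 0, vY := ?r)" and ?a = "a'(Cmp := (a' Cmp)(?r := ?r), Stk := (a' Stk)(?r := 0))"
    have col: "collect_inv (?t + 20 * remaining rest + 8) ?r B (a' Cmp) ?t ?v ?a [?r] {?r} rest"
      by (rule collect_inv_init[OF inv[unfolded zs] r F(3)]) auto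
    have "loaded ?v ?a" using loaded' by (simp add: loaded_def)
    note wp = wp_collect[OF this _ B col]
    have "wp inp collect (wp inp (Do [Get vX FinNx vX]) (\<lambda>t' v' a'. \<exists>B ys zs rest.
        scc_inv (t + 20 * m + 20 * n) F t' v' a' B ys zs rest)) ?t ?v ?a"
    proof (rule wp_conseq[OF wp], goal_cases)
      case 1
      then show ?case by simp
    next
      case (2 t2 v2 a2)
      then obtain t3 K rest' where *: "t2 = Suc t3"
        "collect_inv (?t + 20 * remaining rest + 8) ?r B (a' Cmp) t3 v2 a2 [] K rest'"
        by blast
      have "v2 vX = ?r" "a2 FinNx = a' FinNx" using 2(3,4) by (simp_all add: collect_def)
      then show ?case unfolding wp_Cons wp_Nil
        by (intro scc_inv_component[OF inv[unfolded zs] r F(3,2) _ *(2)]) (simp_all add: *(1))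
    qed
    then show ?thesis using True vZ by simp
  qed
next
  case (3 t' v' a')
  then obtain B ys zs rest where inv: "scc_inv (t + 20 * m + 20 * n) F t' v' a' B ys zs rest" by blast
  note i = inv[unfolded scc_inv_def]
  have "v' vX = 0" using 3(2,4) loaded by (auto simp: loaded_def collect_def)
  moreover have "chain (a' FinNx) (v' vX) zs" using i by blast
  ultimately have "zs = []" by simp
  moreover have "F = ys @ zs" "set ys \<subseteq> B" "B \<subseteq> {1..n}" using i by blast+
  ultimately have B: "B = {1..n}" using F(3) by auto
  have t: "t' \<le> t + 20 * m + 20 * n" using i by (meson le_trans le_add1)
  have c: "mutual E x (a' Cmp x)" if "x \<in> {1..n}" for x using i that B by blast
  have "components n m l src dst w q0 qf (a' Cmp)"
  proof
    fix x y assume x: "x \<in> {1..n}" and y: "y \<in> {1..n}"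
    show "a' Cmp x = a' Cmp y \<longleftrightarrow> mutual E x y"
    proof
      assume "mutual E x y"
      then show "a' Cmp x = a' Cmp y" using i x B by blast
    qed (use c[OF x] c[OF y] in \<open>auto intro: rtrancl_trans\<close>)
  qed (rule c)
  then show ?case using t by simp
next
  case (4 t' v' a')
  then obtain B ys zs rest where "scc_inv (t + 20 * m + 20 * n) F t' v' a' B ys zs rest" by blast
  then have "t' + 20 * remaining rest + 20 * length zs \<le> t + 20 * m + 20 * n"
    unfolding scc_inv_def by blast
  then show ?case by simp
qed

end

section \<open>Transitions sorted by component\<close>

locale solved = encoded + components
begin

definition inner_edge :: "nat \<Rightarrow> nat \<Rightarrow> bool" where
  "inner_edge c e \<longleftrightarrow> cmp (src e) = c \<and> cmp (dst e) = c \<and> lab e \<noteq> 0"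

definition leaving :: "nat \<Rightarrow> nat \<Rightarrow> bool" where
  "leaving c e \<longleftrightarrow> cmp (src e) = c \<and> cmp (dst e) \<noteq> c"

abbreviation inner_list :: "nat \<Rightarrow> nat list" where
  "inner_list c \<equiv> selected (inner_edge c) m"

abbreviation leaving_list :: "nat \<Rightarrow> nat list" where
  "leaving_list c \<equiv> selected (leaving c) m"

abbreviation unprocessed :: "nat set \<Rightarrow> nat set" where
  "unprocessed Rm \<equiv> {e \<in> cross. cmp (src e) \<notin> Rm}"

definition entering :: "nat \<Rightarrow> nat \<Rightarrow> bool" where
  "entering c e \<longleftrightarrow> cmp (src e) \<noteq> c \<and> cmp (dst e) = c"

lemma wp_sort_transitions:
  assumes loaded: "loaded v a" and cmp: "a Cmp = cmp"
    and zero: "a InnHd = (\<lambda>_. 0)" "a CrsHd = (\<lambda>_. 0)" "a Deg = (\<lambda>_. 0)"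
  shows "wp inp sort_transitions (\<lambda>t' v' a'. t' \<le> t + 14 * m + 2 \<and>
    (\<forall>c. chain (a' CmpNx) (a' InnHd c) (inner_list c)) \<and>
    (\<forall>c. chain (a' CmpNx) (a' CrsHd c) (leaving_list c)) \<and>
    (\<forall>c. a' Deg c = length (selected (entering c) m))) t v a"
  unfolding sort_transitions_def wp_Seq wp_Cons wp_Nil
proof (rule wp_While_frame[where T = "t + 1 + 14 * m" and I = "\<lambda>t' v' a'. v' vJ \<le> m \<and> t' \<le> t + 1 + 14 * v' vJ \<and>
    (\<forall>c. chain (a' CmpNx) (a' InnHd c) (selected (inner_edge c) (v' vJ))) \<and>
    (\<forall>c. chain (a' CmpNx) (a' CrsHd c) (selected (leaving c) (v' vJ))) \<and>
    (\<forall>c. a' Deg c = length (selected (entering c) (v' vJ)))"], goal_cases)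
  case 1
  then show ?case using zero by simp
next
  case (2 t' v' a')
  let ?e = "Suc (v' vJ)"
  have fr: "v' NumT = m" "v' vZ = 0" "a' Cmp = cmp" "a' Src = a Src" "a' Dst = a Dst" "a' Lab = a Lab"
    using 2(4,5) loaded cmp by (auto simp: loaded_def)
  then have e: "?e \<le> m" using 2(1,2) by simp
  then have fr2: "a Src ?e = src ?e" "a Dst ?e = dst ?e" "a Lab ?e = lab ?e"
    using loaded by (auto simp: loaded_def)
  show ?case
  proof (cases "cmp (src ?e) = cmp (dst ?e)")
    case True
    then show ?thesis
      using 2(1) e by (auto simp: fr fr2 inner_edge_def leaving_def entering_def)
  next
    case False
    then show ?thesis
      using 2(1) e by (auto simp: fr fr2 inner_edge_def leaving_def entering_def)
  qed
next
  case (3 t' v' a')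
  have "v' NumT = m" using 3(4) loaded by (auto simp: loaded_def)
  then have "v' vJ = m" using 3(2) by simp
  then show ?case using 3(1) by auto
qed auto

end

section \<open>The list of next occurrences\<close>

definition linked :: "(nat \<Rightarrow> nat) \<Rightarrow> (nat \<Rightarrow> nat) \<Rightarrow> nat list \<Rightarrow> bool" where
  "linked f g xs \<longleftrightarrow> successively (\<lambda>x y. f x = y \<and> g y = x) xs"

lemma linked_simps [simp]:
  "linked f g []" "linked f g [x]" "linked f g (x # y # xs) \<longleftrightarrow> f x = y \<and> g y = x \<and> linked f g (y # xs)"
  by (auto simp: linked_def)

lemma linked_append:
  "linked f g (xs @ x # y # ys) \<longleftrightarrow> linked f g (xs @ [x]) \<and> f x = y \<and> g y = x \<and> linked f g (y # ys)"
  by (auto simp: linked_def successively_append_iff)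

lemma linked_cong:
  assumes "linked f g xs" "\<And>x. x \<in> set (butlast xs) \<Longrightarrow> f' x = f x" "\<And>x. x \<in> set (tl xs) \<Longrightarrow> g' x = g x"
  shows "linked f' g' xs"
  using assms
proof (induction xs)
  case (Cons x xs)
  show ?case
  proof (cases xs)
    case (Cons y ys)
    have "linked f' g' xs"
    proof (rule Cons.IH)
      show "g' z = g z" if "z \<in> set (tl xs)" for z using that Cons.prems(3)[of z] Cons by auto
      show "f' z = f z" if "z \<in> set (butlast xs)" for z using that Cons.prems(2)[of z] Cons by auto
    qed (use Cons.prems(1) Cons in simp)
    then show ?thesis using Cons.prems Cons by auto
  qed simp
qed simp

lemma in_set_tlD: "x \<in> set (tl xs) \<Longrightarrow> x \<in> set xs"
  by (cases xs) auto

lemma filter_neq_split: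
  assumes "distinct (us @ y # vs)"
  shows "filter (\<lambda>p. p \<noteq> y) (us @ y # vs) = us @ vs"
proof -
  have "filter (\<lambda>p. p \<noteq> y) us = us" "filter (\<lambda>p. p \<noteq> y) vs = vs"
    using assms by (auto intro!: filter_True)
  then show ?thesis by simp
qed

section \<open>Deleting and reinserting list nodes\<close>

lemma linked_remove:
  assumes "linked f g (xs @ p # y # h # ys)" "distinct (xs @ p # y # h # ys)"
  shows "linked (f(p := h)) (g(h := p)) (xs @ p # h # ys)"
proof -
  have *: "linked f g (xs @ [p])" "linked f g (h # ys)" using assms(1) by (simp_all add: linked_append)
  have "linked (f(p := h)) (g(h := p)) (xs @ [p])"
    by (rule linked_cong[OF *(1)]) (use assms(2) in \<open>auto dest: in_set_tlD\<close>)
  moreover have "linked (f(p := h)) (g(h := p)) (h # ys)"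
    by (rule linked_cong[OF *(2)]) (use assms(2) in \<open>auto dest: in_set_butlastD split: if_splits\<close>)
  ultimately show ?thesis by (simp add: linked_append)
qed

lemma linked_insert:
  assumes "linked f g (xs @ p # h # ys)" "distinct (xs @ p # y # h # ys)" "f y = h" "g y = p"
  shows "linked (f(p := y)) (g(h := y)) (xs @ p # y # h # ys)"
proof -
  have *: "linked f g (xs @ [p])" "linked f g (h # ys)" using assms(1) by (simp_all add: linked_append)
  have "linked (f(p := y)) (g(h := y)) (xs @ [p])"
    by (rule linked_cong[OF *(1)]) (use assms(2) in \<open>auto dest: in_set_tlD\<close>)
  moreover have "linked (f(p := y)) (g(h := y)) (h # ys)"
    by (rule linked_cong[OF *(2)]) (use assms(2) in \<open>auto dest: in_set_butlastD split: if_splits\<close>)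
  ultimately show ?thesis using assms by (auto simp: linked_append)
qed

context encoded
begin

definition next_occ :: "nat \<Rightarrow> nat \<Rightarrow> nat" where
  "next_occ j x = (if \<exists>p. j < p \<and> p \<le> l \<and> w p = x then LEAST p. j < p \<and> p \<le> l \<and> w p = x else 0)"

abbreviation next_same :: "nat \<Rightarrow> nat" where
  "next_same j \<equiv> next_occ j (w j)"

text \<open>Position \<open>l + 1\<close> is a sentinel.\<close>

definition firsts :: "nat \<Rightarrow> nat list" where
  "firsts j = filter (\<lambda>p. p = Suc l \<or> (\<forall>i \<in> {j..<p}. w i \<noteq> w p)) [j..<Suc (Suc l)]"

lemma next_occD:
  assumes "next_occ j x \<noteq> 0"
  shows "j < next_occ j x" "next_occ j x \<le> l" "w (next_occ j x) = x"
    "\<And>i. j < i \<Longrightarrow> i < next_occ j x \<Longrightarrow> w i \<noteq> x"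
proof -
  have ex: "\<exists>p. j < p \<and> p \<le> l \<and> w p = x" using assms by (auto simp: next_occ_def split: if_splits)
  then have eq: "next_occ j x = (LEAST p. j < p \<and> p \<le> l \<and> w p = x)" by (simp add: next_occ_def)
  show *: "j < next_occ j x" "next_occ j x \<le> l" "w (next_occ j x) = x"
    unfolding eq using LeastI_ex[OF ex] by auto
  show "w i \<noteq> x" if "j < i" "i < next_occ j x" for i
    using not_less_Least[OF that(2)[unfolded eq]] that(1) *(2) that(2) by auto
qed

lemma next_occ_eq:
  assumes "j < p" "p \<le> l" "w p = x" "\<And>i. j < i \<Longrightarrow> i < p \<Longrightarrow> w i \<noteq> x"
  shows "next_occ j x = p"
proof -
  have "(LEAST p. j < p \<and> p \<le> l \<and> w p = x) = p"
    by (rule Least_equality) (use assms in \<open>auto simp: not_less[symmetric]\<close>)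
  then show ?thesis using assms by (auto simp: next_occ_def)
qed

lemma next_occ_Suc: "next_occ j x = (if j < l \<and> w (Suc j) = x then Suc j else next_occ (Suc j) x)"
proof (cases "j < l \<and> w (Suc j) = x")
  case True
  then show ?thesis by (simp add: next_occ_eq)
next
  case False
  then have eq: "(\<lambda>p. j < p \<and> p \<le> l \<and> w p = x) = (\<lambda>p. Suc j < p \<and> p \<le> l \<and> w p = x)"
    by (intro ext) (metis Suc_le_eq Suc_lessD le_neq_implies_less)
  show ?thesis unfolding next_occ_def eq using False by (simp only: if_False)
qed

lemma firsts_sentinel: "j \<le> Suc l \<Longrightarrow> \<exists>xs. firsts j = xs @ [Suc l] \<and> Suc l \<notin> set xs"
  by (auto simp: firsts_def)

lemma set_firsts: "set (firsts j) = {p. j \<le> p \<and> p \<le> Suc l \<and> (p = Suc l \<or> (\<forall>i \<in> {j..<p}. w i \<noteq> w p))}"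
  by (auto simp: firsts_def)

lemma distinct_firsts: "distinct (firsts j)"
  by (simp add: firsts_def)

lemma sorted_firsts: "sorted (firsts j)"
  unfolding firsts_def by (intro sorted_wrt_filter) (simp del: upt_Suc)

text \<open>Position \<open>j\<close> becomes the first occurrence of its letter and displaces the
  previous one. If the letter does not occur again, \<open>next_same j\<close> is 0 and the filter
  removes nothing, as listed positions are positive. The sentinel is never displaced.\<close>

lemma firsts_Suc:
  assumes "j \<le> l"
  shows "firsts j = j # filter (\<lambda>p. p \<noteq> next_same j) (firsts (Suc j))"
proof -
  have "[j..<Suc (Suc l)] = j # [Suc j..<Suc (Suc l)]" using assms by (simp add: upt_conv_Cons)
  then have "firsts j = j # filter (\<lambda>p. p = Suc l \<or> (\<forall>i \<in> {j..<p}. w i \<noteq> w p)) [Suc j..<Suc (Suc l)]"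
    by (simp add: firsts_def)
  also have "filter (\<lambda>p. p = Suc l \<or> (\<forall>i \<in> {j..<p}. w i \<noteq> w p)) [Suc j..<Suc (Suc l)] =
      filter (\<lambda>p. p \<noteq> next_same j \<and> (p = Suc l \<or> (\<forall>i \<in> {Suc j..<p}. w i \<noteq> w p))) [Suc j..<Suc (Suc l)]"
  proof (rule filter_cong)
    fix p assume "p \<in> set [Suc j..<Suc (Suc l)]"
    then have p: "j < p" "p \<le> Suc l" by auto
    show "(p = Suc l \<or> (\<forall>i \<in> {j..<p}. w i \<noteq> w p)) =
        (p \<noteq> next_same j \<and> (p = Suc l \<or> (\<forall>i \<in> {Suc j..<p}. w i \<noteq> w p)))"
    proof (cases "p = Suc l")
      case True
      then show ?thesis using next_occD(2)[of j "w j"] by force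
    next
      case False
      then have pl: "p \<le> l" using p by simp
      have "next_same j = p" if "w j = w p" "\<forall>i \<in> {Suc j..<p}. w i \<noteq> w p"
        by (rule next_occ_eq) (use that p pl in auto)
      moreover have "w j = w p" if "p = next_same j" using next_occD(3)[of j "w j"] that p by auto
      moreover have "{j..<p} = insert j {Suc j..<p}" using p by auto
      ultimately show ?thesis using False by auto
    qed
  qed simp
  finally show ?thesis by (simp add: firsts_def conj_commute)
qed

text \<open>The reason why undoing works: a node deleted at stage \<open>i\<close> is absent from
  all lists for earlier positions, so the edits made in between, which touch only listed nodes and
  the head, leave its own links intact.\<close>

lemma next_same_notin_firsts:
  assumes "j \<le> i" "next_same i \<noteq> 0"
  shows "next_same i \<notin> set (firsts j)"
proof -
  note next_occD(1-3)[OF assms(2)]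
  then show ?thesis using assms(1) by (force simp: set_firsts)
qed

lemma next_same_in_firsts:
  assumes "next_same j \<noteq> 0"
  shows "next_same j \<in> set (firsts (Suc j))"
  using next_occD[OF assms] by (auto simp: set_firsts)

text \<open>A removed position keeps its two links, so that the removal can be undone.\<close>

definition stored :: "(nat \<Rightarrow> nat) \<Rightarrow> (nat \<Rightarrow> nat) \<Rightarrow> nat \<Rightarrow> bool" where
  "stored f g i \<longleftrightarrow> (next_same i \<noteq> 0 \<longrightarrow> (\<exists>xs ys.
     0 # firsts (Suc i) = xs @ g (next_same i) # next_same i # f (next_same i) # ys))"

lemma stored_cong:
  assumes "stored f g i" "next_same i \<noteq> 0 \<Longrightarrow> f' (next_same i) = f (next_same i) \<and> g' (next_same i) = g (next_same i)"
  shows "stored f' g' i"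
  using assms by (simp add: stored_def)

definition links :: "nat \<Rightarrow> (nat \<Rightarrow> nat) \<Rightarrow> (nat \<Rightarrow> nat) \<Rightarrow> bool" where
  "links j f g \<longleftrightarrow> linked f g (0 # firsts j) \<and> (\<forall>i. j \<le> i \<and> i \<le> l \<longrightarrow> stored f g i)"

lemma distinct_0_firsts: "1 \<le> j \<Longrightarrow> distinct (0 # firsts j)"
  using distinct_firsts by (auto simp: set_firsts)

lemma links_remove:
  assumes links: "links (Suc j) f g" and j: "1 \<le> j" "j \<le> l"
  defines "y \<equiv> next_same j"
  defines "rest \<equiv> filter (\<lambda>p. p \<noteq> y) (firsts (Suc j))"
  obtains f1 g1 where "(f1, g1) = (if y = 0 then (f, g) else (f(g y := f y), g(f y := g y)))"
    "linked f1 g1 (0 # rest)" "stored f1 g1 j"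
    "\<And>x. x \<notin> set (0 # firsts (Suc j)) \<Longrightarrow> f1 x = f x \<and> g1 x = g x"
proof (cases "y = 0")
  case True
  have "\<forall>x \<in> set (firsts (Suc j)). x \<noteq> 0" by (auto simp: set_firsts)
  then have "rest = firsts (Suc j)" unfolding rest_def True by (auto simp: filter_id_conv)
  then show ?thesis using that[of f g] True links by (auto simp: links_def stored_def y_def)
next
  case False
  have link: "linked f g (0 # firsts (Suc j))" using links by (simp add: links_def)
  have dist: "distinct (0 # firsts (Suc j))" by (rule distinct_0_firsts) simp
  have "y \<in> set (0 # firsts (Suc j))" using next_same_in_firsts False by (simp add: y_def)
  then obtain us vs where uv: "0 # firsts (Suc j) = us @ y # vs" by (meson split_list)
  have "us \<noteq> []" using uv False by auto
  then obtain xs p where us: "us = xs @ [p]" by (metis rev_exhaust)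
  \<comment> \<open>The deleted position is at most \<open>l\<close>, hence not the sentinel that
    ends the list, and it has a right neighbour.\<close>
  have "vs \<noteq> []"
  proof
    assume "vs = []"
    then have "y = Suc l" using uv us firsts_sentinel[of "Suc j"] j by (metis append_is_Nil_conv last.simps last_appendR list.distinct(1) last_snoc Suc_le_mono)
    then show False using next_occD(2)[of j "w j"] False by (simp add: y_def)
  qed
  then obtain h ys where vs: "vs = h # ys" by (cases vs) auto
  have split: "0 # firsts (Suc j) = xs @ p # y # h # ys" using uv us vs by simp
  then have "linked f g (xs @ p # y # h # ys)" using link by simp
  then have fy: "f y = h" "g y = p" by (auto simp: linked_append[of f g xs p y])
  have d: "distinct (xs @ p # y # h # ys)" using dist split by simp
  have "0 # rest = filter (\<lambda>p. p \<noteq> y) (0 # firsts (Suc j))" using False by (simp add: rest_def)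
  also have "\<dots> = xs @ p # h # ys"
    unfolding split using filter_neq_split[of "xs @ [p]" y "h # ys"] d by simp
  finally have "linked (f(g y := f y)) (g(f y := g y)) (0 # rest)"
    using linked_remove[OF \<open>linked f g (xs @ p # y # h # ys)\<close> d] by (simp add: fy)
  moreover have "stored (f(g y := f y)) (g(f y := g y)) j"
    unfolding stored_def using split d fy by (auto simp: y_def[symmetric])
  moreover have "p \<in> set (0 # firsts (Suc j))" "h \<in> set (0 # firsts (Suc j))" unfolding split by auto
  then have "(f(g y := f y)) x = f x \<and> (g(f y := g y)) x = g x" if "x \<notin> set (0 # firsts (Suc j))" for x
    using that fy by auto
  ultimately show ?thesis using that[of "f(g y := f y)" "g(f y := g y)"] False by simp
qed

text \<open>One round of the construction, with the updates in the order in which the program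
  performs them: the old occurrence is bridged, then \<open>j\<close> is put behind the head
  0.\<close>

lemma links_prepend:
  assumes links: "links (Suc j) f g" and j: "1 \<le> j" "j \<le> l"
    and fg: "(f1, g1) = (if next_same j = 0 then (f, g) else
      (f(g (next_same j) := f (next_same j)), g(f (next_same j) := g (next_same j))))"
  shows "links j (f1(j := f1 0, 0 := j)) (g1(f1 0 := j, j := 0))"
proof -
  let ?rest = "filter (\<lambda>p. p \<noteq> next_same j) (firsts (Suc j))"
  let ?f = "f1(j := f1 0, 0 := j)" and ?g = "g1(f1 0 := j, j := 0)"
  have l1: "linked f1 g1 (0 # ?rest)" and s1: "stored f1 g1 j"
    and same: "\<And>x. x \<notin> set (0 # firsts (Suc j)) \<Longrightarrow> f1 x = f x \<and> g1 x = g x"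
    using links_remove[OF links j] fg by (metis (no_types, lifting) prod.inject)+
  \<comment> \<open>The sentinel survives every deletion, so there is always a node \<open>h\<close>
    whose left link the insertion redirects.\<close>
  have "Suc l \<in> set ?rest"
    using next_occD(2)[of j "w j"] j by (force simp: set_firsts)
  then obtain h zs where rest: "?rest = h # zs" by (cases ?rest) auto
  have h: "f1 0 = h" "linked f1 g1 (h # zs)" using l1 rest by auto
  have sub: "set (h # zs) \<subseteq> set (firsts (Suc j))" "distinct (h # zs)" "next_same j \<notin> set (h # zs)"
    using distinct_firsts unfolding rest[symmetric] by auto
  have nin: "0 \<notin> set (firsts (Suc j))" "j \<notin> set (firsts (Suc j))" by (auto simp: set_firsts)
  have pos: "x > j" if "x \<in> set (firsts (Suc j))" for x using that by (auto simp: set_firsts)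
  have "linked ?f ?g (h # zs)"
    by (rule linked_cong[OF h(2)])
      (use sub nin h(1) j in \<open>auto dest!: in_set_butlastD split: if_splits\<close>)
  then have "linked ?f ?g (0 # firsts j)"
    using j h sub(1) pos[of h] by (simp add: firsts_Suc rest)
  moreover have "stored ?f ?g i" if i: "j \<le> i" "i \<le> l" for i
  proof (cases "i = j")
    case True
    show ?thesis unfolding True
      by (rule stored_cong[OF s1]) (use next_occD(1)[of j "w j"] sub(3) h(1) in auto)
  next
    case False
    then have ij: "Suc j \<le> i" using i by simp
    have "stored f g i" using links ij i by (simp add: links_def)
    then show ?thesis
    proof (rule stored_cong)
      assume y: "next_same i \<noteq> 0"
      note n = next_same_notin_firsts[OF ij y] next_occD(1)[OF y]
      have "next_same i \<noteq> h" using n sub(1) by auto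
      then show "?f (next_same i) = f (next_same i) \<and> ?g (next_same i) = g (next_same i)"
        using same[of "next_same i"] n y h(1) i(1) by auto
    qed
  qed
  ultimately show ?thesis by (simp add: links_def)
qed

text \<open>The inverse of \<open>links_prepend\<close>, in reverse order: \<open>j\<close>, linked
  last, is unlinked first. Thereby exactly the list is restored in which the links kept by
  \<open>next_same j\<close> name its neighbours.\<close>

lemma links_undo:
  assumes links: "links j f g" and j: "1 \<le> j" "j \<le> l"
  defines "f1 \<equiv> f(0 := f j)" and "g1 \<equiv> g(f j := 0)" and "y \<equiv> next_same j"
  shows "links (Suc j) (if y = 0 then f1 else f1(g1 y := y)) (if y = 0 then g1 else g1(f1 y := y))"
proof -
  let ?rest = "filter (\<lambda>p. p \<noteq> next_same j) (firsts (Suc j))"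
  have "Suc l \<in> set ?rest"
    using next_occD(2)[of j "w j"] j by (force simp: set_firsts)
  then obtain h zs where rest: "?rest = h # zs" by (cases ?rest) auto
  have sub: "set (h # zs) \<subseteq> set (firsts (Suc j))" "distinct (h # zs)" "next_same j \<notin> set (h # zs)"
    using distinct_firsts unfolding rest[symmetric] by auto
  have nin: "0 \<notin> set (firsts (Suc j))" "j \<notin> set (firsts (Suc j))" by (auto simp: set_firsts)
  have pos: "x > j" if "x \<in> set (firsts (Suc j))" for x using that by (auto simp: set_firsts)
  have "linked f g (0 # j # h # zs)" using links j by (simp add: links_def firsts_Suc rest)
  then have h: "f j = h" "linked f g (h # zs)" by auto
  have "linked f1 g1 (h # zs)"
    by (rule linked_cong[OF h(2)])
      (use sub nin h(1) j in \<open>auto simp: f1_def g1_def dest!: in_set_butlastD split: if_splits\<close>)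
  then have l1: "linked f1 g1 (0 # ?rest)" using h(1) by (simp add: rest f1_def g1_def)
  have hin: "h \<in> set (firsts (Suc j))" using sub(1) by simp
  have keep: "f1 (next_same i) = f (next_same i)" "g1 (next_same i) = g (next_same i)"
    if "j \<le> i" "next_same i \<noteq> 0" for i
  proof -
    have "next_same i \<noteq> h"
    proof (cases "i = j")
      case False
      then show ?thesis using next_same_notin_firsts[of "Suc j" i] that hin by auto
    qed (use sub(3) in auto)
    then show "f1 (next_same i) = f (next_same i)" "g1 (next_same i) = g (next_same i)"
      unfolding f1_def g1_def h(1) using that by simp_all
  qed
  have st: "stored f1 g1 i" if "j \<le> i" "i \<le> l" for i
  proof (rule stored_cong)
    show "stored f g i" using links that unfolding links_def by blast
  qed (use keep[OF that(1)] in blast)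
  show ?thesis
  proof (cases "y = 0")
    case True
    have "\<forall>x \<in> set (firsts (Suc j)). x \<noteq> 0" by (auto simp: set_firsts)
    then have "?rest = firsts (Suc j)" using True by (auto simp: filter_id_conv y_def)
    then show ?thesis using True l1 st by (simp add: links_def)
  next
    case False
    obtain xs ys where split: "0 # firsts (Suc j) = xs @ g1 y # y # f1 y # ys"
      using st[of j] j False by (auto simp: stored_def y_def)
    have d: "distinct (xs @ g1 y # y # f1 y # ys)" using distinct_0_firsts[of "Suc j"] split by simp
    have "0 # ?rest = filter (\<lambda>p. p \<noteq> y) (0 # firsts (Suc j))" using False by (simp add: y_def)
    also have "\<dots> = xs @ g1 y # f1 y # ys"
      unfolding split using filter_neq_split[of "xs @ [g1 y]" y "f1 y # ys"] d by simp
    finally have "linked f1 g1 (xs @ g1 y # f1 y # ys)" using l1 by (simp only:)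
    then have "linked (f1(g1 y := y)) (g1(f1 y := y)) (0 # firsts (Suc j))"
      unfolding split by (rule linked_insert[where y = y]) (use d in auto)
    moreover have in_set: "g1 y \<in> set (0 # firsts (Suc j))" "f1 y \<in> set (0 # firsts (Suc j))"
      unfolding split by auto
    have "stored (f1(g1 y := y)) (g1(f1 y := y)) i" if i: "Suc j \<le> i" "i \<le> l" for i
    proof (rule stored_cong)
      show "stored f1 g1 i" using st i by simp
      assume "next_same i \<noteq> 0"
      then have "next_same i \<noteq> g1 y" "next_same i \<noteq> f1 y"
        using next_same_notin_firsts[OF i(1)] in_set by force+
      then show "(f1(g1 y := y)) (next_same i) = f1 (next_same i) \<and> (g1(f1 y := y)) (next_same i) = g1 (next_same i)"
        by simp
    qed
    ultimately show ?thesis using False by (simp add: links_def)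
  qed
qed

lemma wp_link_positions:
  assumes loaded: "loaded v a" and zero: "a Rgt = (\<lambda>_. 0)" "a Lft = (\<lambda>_. 0)" "a Last = (\<lambda>_. 0)"
  shows "wp inp link_positions (\<lambda>t' v' a'. t' \<le> t + 17 * l + 3 \<and> links 1 (a' Rgt) (a' Lft) \<and>
    (\<forall>i. 1 \<le> i \<and> i \<le> l \<longrightarrow> a' Nxt i = next_same i)) t v a"
  unfolding link_positions_def wp_Seq wp_Cons wp_Nil
proof (rule wp_While_frame[where T = "t + 2 + 17 * l" and
    I = "\<lambda>t' v' a'. v' vJ \<le> l \<and> t' + 17 * v' vJ \<le> t + 2 + 17 * l \<and> links (Suc (v' vJ)) (a' Rgt) (a' Lft) \<and>
    (\<forall>i. v' vJ < i \<and> i \<le> l \<longrightarrow> a' Nxt i = next_same i) \<and> (\<forall>x. x \<noteq> 0 \<longrightarrow> a' Last x = next_occ (v' vJ) x)"], goal_cases)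
  case 1
  have "firsts (Suc l) = [Suc l]" by (simp add: firsts_def)
  moreover have "next_occ l x = 0" for x by (auto simp: next_occ_def)
  ultimately show ?case using loaded zero by (auto simp: loaded_def links_def)
next
  case (2 t' v' a')
  let ?j = "v' vJ"
  have fr: "v' vZ = 0" "a' Wd = w" using 2(4,5) loaded by (auto simp: loaded_def)
  have j: "1 \<le> ?j" "?j \<le> l" using 2(1,2) fr by auto
  then have wj: "w ?j \<noteq> 0" using w_pos by (metis less_numeral_extra(3))
  have last: "a' Last (w ?j) = next_same ?j" using 2(1) wj by blast
  have links: "links (Suc ?j) (a' Rgt) (a' Lft)" using 2(1) by blast
  note step = links_prepend[OF links j]
  obtain k where k: "?j = Suc k" using j by (cases ?j) auto
  have occ: "next_occ k x = (if w (Suc k) = x then Suc k else next_occ (Suc k) x)" for x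
    using next_occ_Suc[of k x] j k by simp
  have nxt: "a' Nxt i = next_same i" if "Suc k < i" "i \<le> l" for i using 2(1) that k by simp
  have occs: "a' Last x = next_occ (Suc k) x" if "x \<noteq> 0" for x using 2(1) that k by simp
  have nxt': "\<forall>i. k < i \<and> i \<le> l \<longrightarrow> ((a' Nxt)(Suc k := next_same (Suc k))) i = next_same i"
    using nxt by (auto dest: Suc_lessI)
  have last': "\<forall>x. x \<noteq> 0 \<longrightarrow> ((a' Last)(w (Suc k) := Suc k)) x = next_occ k x"
    using occ occs by simp
  have time: "t' + 17 * Suc k \<le> t + 2 + 17 * l" using 2(1) k by simp
  note fr = fr k last[unfolded k]
  show ?case
  proof (cases "next_same (Suc k) = 0")
    case True
    then have "links (Suc k) ((a' Rgt)(Suc k := a' Rgt 0, 0 := Suc k)) ((a' Lft)(a' Rgt 0 := Suc k, Suc k := 0))"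
      using step[of "a' Rgt" "a' Lft"] k by simp
    then show ?thesis using True time j nxt' last' by (simp add: fr)
  next
    case False
    let ?f = "(a' Rgt)(a' Lft (next_same (Suc k)) := a' Rgt (next_same (Suc k)))"
    let ?g = "(a' Lft)(a' Rgt (next_same (Suc k)) := a' Lft (next_same (Suc k)))"
    have "links (Suc k) (?f(Suc k := ?f 0, 0 := Suc k)) (?g(?f 0 := Suc k, Suc k := 0))"
      using step[of ?f ?g] False k by simp
    then show ?thesis using False time j nxt' last' by (simp add: fr)
  qed
next
  case (3 t' v' a')
  have "v' vJ = 0" using 3(2,4) loaded by (auto simp: loaded_def)
  then show ?case using 3(1) by auto
qed auto

lemma wp_unlink_position:
  assumes loaded: "loaded v a" and j: "1 \<le> v vJ" "v vJ \<le> l" and nxt: "a Nxt (v vJ) = next_same (v vJ)"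
    and links: "links (v vJ) (a Rgt) (a Lft)"
  shows "wp inp unlink_position (\<lambda>t' v' a'. t' \<le> t + 9 \<and> links (Suc (v vJ)) (a' Rgt) (a' Lft)) t v a"
  using links_undo[OF links j] assms by (auto simp: unlink_position_def loaded_def split: if_splits)

end

section \<open>Removing dead components\<close>

context solved
begin

abbreviation letters :: "nat \<Rightarrow> nat set" where
  "letters c \<equiv> lab ` inner c"

definition into :: "nat set \<Rightarrow> nat \<Rightarrow> nat set" where
  "into Act d = {e \<in> Act. cmp (dst e) = d}"

text \<open>Removed components \<open>Rm\<close>, unprocessed transitions \<open>Act\<close> between components, buckets \<open>B\<close>, and, for
  each component, the last letter that entered it from a component removed at that letter.\<close>

definition peel_inv :: "nat \<Rightarrow> nat set \<Rightarrow> nat set \<Rightarrow> nat set \<Rightarrow> (nat \<Rightarrow> nat list) \<Rightarrow> (nat \<Rightarrow> nat) \<Rightarrow> bool" where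
  "peel_inv j cur Rm Act B flg \<longleftrightarrow>
     Rm \<subseteq> reps \<and> (\<forall>c \<in> Rm. c \<notin> alive j) \<and> (\<forall>c \<in> Rm. into Act c = {}) \<and> reps - Rm \<subseteq> alive (j - 1) \<and>
     Act \<subseteq> cross \<and> (\<forall>e \<in> cross. cmp (src e) \<notin> Rm \<longrightarrow> e \<in> Act) \<and>
     (\<forall>p. \<forall>c \<in> set (B p). j \<le> p \<and> p \<le> Suc l \<and> c \<in> reps \<and> c \<notin> Rm \<and> c \<notin> cur \<and> into Act c = {} \<and> on_its_own c p) \<and>
     (\<forall>p. distinct (B p)) \<and> (\<forall>p q c. c \<in> set (B p) \<longrightarrow> c \<in> set (B q) \<longrightarrow> p = q) \<and>
     (\<forall>c. c \<in> reps \<longrightarrow> c \<notin> Rm \<longrightarrow> c \<notin> cur \<longrightarrow> into Act c = {} \<longrightarrow> (\<exists>p. c \<in> set (B p))) \<and>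
     (\<forall>d. flg d \<le> j) \<and>
     (\<forall>d \<in> reps. flg d = j \<longleftrightarrow> (\<exists>e \<in> cross - Act. cmp (dst e) = d \<and> lab e = w j \<and> src e \<in> alive (j - 1)))"

lemma peel_invD:
  assumes "peel_inv j cur Rm Act B flg"
  shows "Rm \<subseteq> reps" "\<And>c. c \<in> Rm \<Longrightarrow> c \<notin> alive j" "\<And>c. c \<in> Rm \<Longrightarrow> into Act c = {}"
    "reps - Rm \<subseteq> alive (j - 1)" "Act \<subseteq> cross" "\<And>e. e \<in> cross \<Longrightarrow> cmp (src e) \<notin> Rm \<Longrightarrow> e \<in> Act"
    "\<And>p c. c \<in> set (B p) \<Longrightarrow> j \<le> p \<and> p \<le> Suc l \<and> c \<in> reps \<and> c \<notin> Rm \<and> c \<notin> cur \<and> into Act c = {} \<and> on_its_own c p"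
    "\<And>p. distinct (B p)" "\<And>p q c. c \<in> set (B p) \<Longrightarrow> c \<in> set (B q) \<Longrightarrow> p = q"
    "\<And>c. c \<in> reps \<Longrightarrow> c \<notin> Rm \<Longrightarrow> c \<notin> cur \<Longrightarrow> into Act c = {} \<Longrightarrow> \<exists>p. c \<in> set (B p)"
    "\<And>d. flg d \<le> j"
    "\<And>d. d \<in> reps \<Longrightarrow>
       flg d = j \<longleftrightarrow> (\<exists>e \<in> cross - Act. cmp (dst e) = d \<and> lab e = w j \<and> src e \<in> alive (j - 1))"
  using assms unfolding peel_inv_def by blast+

lemma peel_invI:
  assumes "Rm \<subseteq> reps" "\<And>c. c \<in> Rm \<Longrightarrow> c \<notin> alive j" "\<And>c. c \<in> Rm \<Longrightarrow> into Act c = {}"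
    "reps - Rm \<subseteq> alive (j - 1)" "Act \<subseteq> cross" "\<And>e. e \<in> cross \<Longrightarrow> cmp (src e) \<notin> Rm \<Longrightarrow> e \<in> Act"
    "\<And>p c. c \<in> set (B p) \<Longrightarrow> j \<le> p \<and> p \<le> Suc l \<and> c \<in> reps \<and> c \<notin> Rm \<and> c \<notin> cur \<and> into Act c = {} \<and> on_its_own c p"
    "\<And>p. distinct (B p)" "\<And>p q c. c \<in> set (B p) \<Longrightarrow> c \<in> set (B q) \<Longrightarrow> p = q"
    "\<And>c. c \<in> reps \<Longrightarrow> c \<notin> Rm \<Longrightarrow> c \<notin> cur \<Longrightarrow> into Act c = {} \<Longrightarrow> \<exists>p. c \<in> set (B p)"
    "\<And>d. flg d \<le> j"
    "\<And>d. d \<in> reps \<Longrightarrow>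
       flg d = j \<longleftrightarrow> (\<exists>e \<in> cross - Act. cmp (dst e) = d \<and> lab e = w j \<and> src e \<in> alive (j - 1))"
  shows "peel_inv j cur Rm Act B flg"
  using assms unfolding peel_inv_def by auto

section \<open>The invariant under single removals\<close>

lemma cross_reps: "e \<in> cross \<Longrightarrow> cmp (src e) \<in> reps \<and> cmp (dst e) \<in> reps"
  using cmp_reps src_in dst_in by (auto simp: cross_def)

lemma alive_src: "e \<in> cross \<Longrightarrow> src e \<in> alive i \<longleftrightarrow> cmp (src e) \<in> alive i"
  using alive_cmp src_in by (auto simp: cross_def)

lemma alive_dst: "e \<in> cross \<Longrightarrow> dst e \<in> alive i \<longleftrightarrow> cmp (dst e) \<in> alive i"
  using alive_cmp dst_in by (auto simp: cross_def)

lemma peel_inv_pop: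
  assumes "peel_inv j {} Rm Act B flg" "B j = c # cs"
  shows "peel_inv j {c} Rm Act (B(j := cs)) flg"
proof -
  note i = peel_invD[OF assms(1)]
  have B: "set ((B(j := cs)) p) \<subseteq> set (B p) - {c}" for p
  proof (cases "p = j")
    case True
    then show ?thesis using i(8)[of j] assms(2) by auto
  next
    case False
    have "c \<in> set (B j)" using assms(2) by simp
    then have "c \<notin> set (B p)" using i(9) False by blast
    then show ?thesis using False by simp
  qed
  have B': "set (B p) \<subseteq> set ((B(j := cs)) p) \<union> {c}" for p using assms(2) by auto
  show ?thesis
  proof (rule peel_invI[OF i(1-6) _ _ _ _ i(11,12)])
    show "j \<le> p \<and> p \<le> Suc l \<and> d \<in> reps \<and> d \<notin> Rm \<and> d \<notin> {c} \<and> into Act d = {} \<and> on_its_own d p"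
      if "d \<in> set ((B(j := cs)) p)" for p d using i(7)[of d p] B[of p] that by blast
    show "distinct ((B(j := cs)) p)" for p using i(8)[of p] assms(2) by (cases "p = j") auto
    show "p = q" if "d \<in> set ((B(j := cs)) p)" "d \<in> set ((B(j := cs)) q)" for p q d
      using i(9) B that by blast
    show "\<exists>p. d \<in> set ((B(j := cs)) p)" if "d \<in> reps" "d \<notin> Rm" "d \<notin> {c}" "into Act d = {}" for d
      using i(10)[of d] B' that by blast
  qed
qed

lemma peel_inv_push:
  assumes "peel_inv j cur Rm Act B flg" "c \<in> reps" "c \<notin> Rm" "into Act c = {}"
    "\<And>p. c \<notin> set (B p)" "on_its_own c p" "j \<le> p" "p \<le> Suc l"
  shows "peel_inv j (cur - {c}) Rm Act (B(p := c # B p)) flg"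
proof -
  note i = peel_invD[OF assms(1)]
  have B: "d \<in> set ((B(p := c # B p)) q) \<longleftrightarrow> d \<in> set (B q) \<or> (d = c \<and> q = p)" for d q by auto
  show ?thesis
  proof (rule peel_invI[OF i(1-6) _ _ _ _ i(11,12)])
    show "j \<le> q \<and> q \<le> Suc l \<and> d \<in> reps \<and> d \<notin> Rm \<and> d \<notin> cur - {c} \<and> into Act d = {} \<and> on_its_own d q"
      if "d \<in> set ((B(p := c # B p)) q)" for q d using i(7)[of d q] assms(2-8) that unfolding B by blast
    show "distinct ((B(p := c # B p)) q)" for q using i(8) assms(5) by auto
    show "q = q'" if "d \<in> set ((B(p := c # B p)) q)" "d \<in> set ((B(p := c # B p)) q')" for q q' d
      using i(9) assms(5) that unfolding B by blast
    show "\<exists>q. d \<in> set ((B(p := c # B p)) q)" if "d \<in> reps" "d \<notin> Rm" "d \<notin> cur - {c}" "into Act d = {}" for d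
      using i(10)[of d] that unfolding B by blast
  qed
qed

lemma peel_inv_remove:
  assumes "peel_inv j {c} Rm Act B flg" "c \<in> reps" "into Act c = {}" "on_its_own c j" "j \<le> l" "w j \<notin> letters c"
  shows "peel_inv j {} (insert c Rm) Act B flg"
proof -
  note i = peel_invD[OF assms(1)]
  have "c \<notin> alive j" using assms(4-6) by (auto simp: on_its_own_def)
  show ?thesis
  proof (rule peel_invI[OF _ _ _ _ i(5) _ _ i(8,9) _ i(11,12)])
    show "j \<le> q \<and> q \<le> Suc l \<and> d \<in> reps \<and> d \<notin> insert c Rm \<and> d \<notin> {} \<and> into Act d = {} \<and> on_its_own d q"
      if "d \<in> set (B q)" for q d using i(7)[OF that] by blast
    show "\<exists>q. d \<in> set (B q)" if "d \<in> reps" "d \<notin> insert c Rm" "d \<notin> {}" "into Act d = {}" for d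
      using i(10)[of d] that by blast
  qed (use i(1-6) assms(2,3) \<open>c \<notin> alive j\<close> in auto)
qed

text \<open>If \<open>e\<close> was the last active transition into \<open>d\<close>, all
  predecessors of \<open>d\<close> are removed and therefore dead after letter \<open>j\<close>. A
  flag equal to \<open>j\<close> exhibits an entering transition that read letter \<open>j\<close>
  from a state alive before it, so \<open>d\<close> is alive after letter \<open>j\<close> and on
  its own from \<open>j + 1\<close>. Otherwise no entering transition could read this letter, and
  \<open>d\<close> is on its own from \<open>j\<close>.\<close>

lemma peel_inv_edge:
  assumes "peel_inv j {} Rm Act B flg" "e \<in> Act" "cmp (src e) = c" "c \<in> Rm" "c \<in> alive (j - 1)"
    and j: "1 \<le> j" "j \<le> l"
    and d: "d = cmp (dst e)" and flg': "flg' = (if lab e = w j then flg(d := j) else flg)"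
    and p: "p = (if flg' d = j then Suc j else j)"
  shows "into (Act - {e}) d \<noteq> {} \<Longrightarrow> peel_inv j {} Rm (Act - {e}) B flg'"
    "into (Act - {e}) d = {} \<Longrightarrow> peel_inv j {} Rm (Act - {e}) (B(p := d # B p)) flg'"
    "d \<in> reps" "d \<notin> Rm" "\<And>q. d \<notin> set (B q)"
proof -
  note i = peel_invD[OF assms(1)]
  let ?Act = "Act - {e}"
  have e: "e \<in> cross" using assms(2) i(5) by blast
  show dr: "d \<in> reps" using cross_reps[OF e] d by simp
  have ed: "e \<in> into Act d" using assms(2) d by (simp add: into_def)
  then show dR: "d \<notin> Rm" using i(3) by blast
  show dB: "d \<notin> set (B q)" for q using i(7)[of d q] ed by blast
  have into: "into ?Act x = (if x = d then into Act d - {e} else into Act x)" for x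
    using d by (auto simp: into_def)
  have flags: "flg' x = j \<longleftrightarrow> (\<exists>e \<in> cross - ?Act. cmp (dst e) = x \<and> lab e = w j \<and> src e \<in> alive (j - 1))"
    if "x \<in> reps" for x
  proof -
    have "src e \<in> alive (j - 1)" using alive_src[OF e] assms(3,5) by simp
    moreover have "cross - ?Act = insert e (cross - Act)" using e assms(2) by auto
    ultimately show ?thesis using i(12)[OF that] flg' d by auto
  qed
  \<comment> \<open>Between losing the transition and being filed, \<open>d\<close> may have no
    active predecessor and yet lie in no bucket; treating it as the current component permits
    this.\<close>
  have *: "peel_inv j {d} Rm ?Act B flg'"
  proof (rule peel_invI[OF i(1,2) _ i(4) _ _ _ i(8,9) _ _ flags])
    show "into ?Act x = {}" if "x \<in> Rm" for x using i(3)[OF that] unfolding into_def by blast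
    show "?Act \<subseteq> cross" using i(5) by blast
    show "f \<in> ?Act" if "f \<in> cross" "cmp (src f) \<notin> Rm" for f
      using i(6)[OF that] that(2) assms(3,4) by blast
    show "j \<le> q \<and> q \<le> Suc l \<and> x \<in> reps \<and> x \<notin> Rm \<and> x \<notin> {d} \<and> into ?Act x = {} \<and> on_its_own x q"
      if "x \<in> set (B q)" for q x
    proof -
      have "x \<noteq> d" using dB that by blast
      then show ?thesis using i(7)[OF that] into[of x] by simp
    qed
    show "\<exists>q. x \<in> set (B q)" if "x \<in> reps" "x \<notin> Rm" "x \<notin> {d}" "into ?Act x = {}" for x
    proof (rule i(10))
      show "into Act x = {}" using that(3,4) into[of x] by simp
    qed (use that in auto)
    show "flg' x \<le> j" for x using i(11)[of x] flg' by simp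
  qed
  show "peel_inv j {} Rm ?Act B flg'" if "into ?Act d \<noteq> {}"
  proof -
    note k = peel_invD[OF *]
    show ?thesis
    proof (rule peel_invI[OF k(1-6) _ k(8,9) _ k(11,12)])
      show "j \<le> q \<and> q \<le> Suc l \<and> x \<in> reps \<and> x \<notin> Rm \<and> x \<notin> {} \<and> into ?Act x = {} \<and> on_its_own x q"
        if "x \<in> set (B q)" for q x using k(7)[OF that] by blast
      show "\<exists>q. x \<in> set (B q)" if "x \<in> reps" "x \<notin> Rm" "x \<notin> {}" "into ?Act x = {}" for x
        using k(10)[of x] that \<open>into ?Act d \<noteq> {}\<close> by blast
    qed
  qed
  show "peel_inv j {} Rm ?Act (B(p := d # B p)) flg'" if empty: "into ?Act d = {}"
  proof -
    have srcs: "f \<in> cross - ?Act \<and> cmp (src f) \<in> Rm" if "f \<in> cross" "cmp (dst f) = d" for f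
    proof -
      have "f \<notin> ?Act" using empty that by (auto simp: into_def)
      then show ?thesis using that i(6)[of f] assms(3,4) by auto
    qed
    then have dead: "src f \<notin> alive j" if "f \<in> cross" "cmp (dst f) = d" for f
      using alive_src that i(2) by blast
    have "on_its_own d p"
    proof (cases "flg' d = j")
      case True
      then obtain f where f: "f \<in> cross" "cmp (dst f) = d" "lab f = w j" "src f \<in> alive (j - 1)"
        using flags[OF dr] by blast
      moreover have "1 \<le> f \<and> f \<le> m" using f(1) by (simp add: cross_def)
      moreover obtain k where "j = Suc k" using j(1) by (cases j) auto
      ultimately have "dst f \<in> alive j" by auto
      then have "d \<in> alive j" using alive_dst[OF f(1)] f(2) j(1) by simp
      moreover have "src g \<notin> alive (Suc j)" if "g \<in> cross" "cmp (dst g) = d" for g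
        using dead[OF that] alive_Suc by blast
      ultimately have "on_its_own d (Suc j)" using dead by (intro on_its_own_intro[OF dr]) auto
      then show ?thesis using True p by simp
    next
      case False
      have "d \<in> alive (j - 1)" using i(4) dr dR by blast
      moreover have "src g \<notin> alive (j - 1)" if "g \<in> cross" "cmp (dst g) = d" "lab g = w j" for g
        using False flags[OF dr] srcs[OF that(1,2)] that by blast
      ultimately have "on_its_own d j" using dead j by (intro on_its_own_intro[OF dr]) auto
      then show ?thesis using False p by simp
    qed
    then show ?thesis using peel_inv_push[OF * dr dR empty dB, of p] p j by auto
  qed
qed

text \<open>With bucket \<open>j\<close> empty, every unremoved component without active
  predecessors is filed at a later position, hence alive after letter \<open>j\<close>; any other
  has an unremoved predecessor, and \<open>all_alive\<close> applies. The flags need no reset: none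
  equals \<open>j + 1\<close>, and all processed transitions start in states that are dead by
  now.\<close>

lemma peel_inv_next:
  assumes inv: "peel_inv j {} Rm Act B flg" and B: "B j = []"
    and Act: "\<And>e. e \<in> Act \<Longrightarrow> cmp (src e) \<notin> Rm"
  shows "peel_inv (Suc j) {} Rm Act B flg"
proof -
  note i = peel_invD[OF inv]
  have alive: "c \<in> alive j" if c: "c \<in> reps - Rm" for c
  proof (rule all_alive[OF _ c])
    fix c assume c: "c \<in> reps - Rm"
    show "c \<in> alive j \<or> (\<exists>e \<in> cross. cmp (dst e) = c \<and> cmp (src e) \<notin> Rm)"
    proof (cases "into Act c = {}")
      case True
      then obtain p where p: "c \<in> set (B p)" using i(10) c by blast
      then have "j \<le> p - 1" using i(7)[OF p] B by (cases "p = j") auto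
      moreover have "c \<in> alive (p - 1)" using i(7)[OF p] by (simp add: on_its_own_def)
      ultimately show ?thesis using alive_antimono by blast
    next
      case False
      then show ?thesis using i(5) Act by (auto simp: into_def)
    qed
  qed
  show ?thesis
  proof (rule peel_invI[OF i(1) _ i(3) _ i(5,6) _ i(8,9,10)])
    show "c \<notin> alive (Suc j)" if "c \<in> Rm" for c using i(2)[OF that] alive_Suc by blast
    show "reps - Rm \<subseteq> alive (Suc j - 1)" using alive by auto
    show "Suc j \<le> p \<and> p \<le> Suc l \<and> c \<in> reps \<and> c \<notin> Rm \<and> c \<notin> {} \<and> into Act c = {} \<and> on_its_own c p"
      if "c \<in> set (B p)" for p c using i(7)[OF that] that B by (cases "p = j") auto
    show "flg d \<le> Suc j" for d using i(11)[of d] by simp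
    fix d assume "d \<in> reps"
    have "flg d \<noteq> Suc j" using i(11)[of d] by simp
    moreover have "src e \<notin> alive (Suc j - 1)" if "e \<in> cross - Act" for e
      using i(6)[of e] i(2)[of "cmp (src e)"] alive_src[of e] that by auto
    ultimately show "flg d = Suc j \<longleftrightarrow>
        (\<exists>e \<in> cross - Act. cmp (dst e) = d \<and> lab e = w (Suc j) \<and> src e \<in> alive (Suc j - 1))"
      by blast
  qed
qed

text \<open>Component \<open>c\<close> will be taken from a bucket at most \<open>fu c\<close> more times: once to find its exit
  position and once to be removed.\<close>

definition fuel_ok :: "nat set \<Rightarrow> nat set \<Rightarrow> (nat \<Rightarrow> nat list) \<Rightarrow> (nat \<Rightarrow> nat) \<Rightarrow> bool" where
  "fuel_ok cur Rm B fu \<longleftrightarrow>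
     (\<forall>c. c \<in> reps \<longrightarrow> c \<notin> Rm \<longrightarrow> c \<notin> cur \<longrightarrow> (\<forall>p. c \<notin> set (B p)) \<longrightarrow> 2 \<le> fu c) \<and>
     (\<forall>p. \<forall>c \<in> set (B p). 1 \<le> fu c \<and> (w p \<in> letters c \<longrightarrow> 2 \<le> fu c))"

definition peel_state :: "nat \<Rightarrow> nat set \<Rightarrow> nat set \<Rightarrow> nat set \<Rightarrow> (nat \<Rightarrow> nat list) \<Rightarrow> (nat \<Rightarrow> nat) \<Rightarrow>
    (arr \<Rightarrow> nat \<Rightarrow> nat) \<Rightarrow> bool" where
  "peel_state j cur Rm Act B fu a \<longleftrightarrow> peel_inv j cur Rm Act B (a Flg) \<and> fuel_ok cur Rm B fu \<and>
     (\<forall>p. chain (a BktNx) (a BktHd p) (B p)) \<and> (\<forall>d \<in> reps. a Deg d = card (into Act d)) \<and>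
     (\<forall>c \<in> reps. a Gone c = 0 \<longleftrightarrow> c \<notin> Rm)"

lemma finite_into: "peel_inv j cur Rm Act B flg \<Longrightarrow> finite (into Act d)"
  using peel_invD(5)[of j cur Rm Act B flg]
  by (intro finite_subset[of "into Act d" "{1..m}"]) (auto simp: into_def cross_def)

lemma peel_state_edge:
  assumes st: "peel_state j {} Rm Act B fu a" and e: "e \<in> Act" "cmp (src e) \<in> Rm" "cmp (src e) \<in> alive (j - 1)"
    and j: "1 \<le> j" "j \<le> l" and d: "d = cmp (dst e)"
    and flg: "flg = (if lab e = w j then (a Flg)(d := j) else a Flg)"
    and p: "p = (if flg d = j then Suc j else j)"
    and a1: "a1 = a(Flg := flg, Deg := (a Deg)(d := a Deg d - 1))"
    and a2: "a2 = (if a Deg d - 1 = 0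
      then a1(BktNx := (a BktNx)(d := a BktHd p), BktHd := (a BktHd)(p := d)) else a1)"
  shows "\<exists>B. peel_state j {} Rm (Act - {e}) B fu a2"
proof -
  have inv: "peel_inv j {} Rm Act B (a Flg)" and fuel: "fuel_ok {} Rm B fu"
    and bkt: "\<And>p. chain (a BktNx) (a BktHd p) (B p)" and deg: "\<And>d. d \<in> reps \<Longrightarrow> a Deg d = card (into Act d)"
    and gone: "\<forall>c \<in> reps. a Gone c = 0 \<longleftrightarrow> c \<notin> Rm"
    using st unfolding peel_state_def by blast+
  note edge = peel_inv_edge[OF inv e(1) refl e(2,3) j d flg p]
  have into: "into (Act - {e}) x = into Act x - (if x = d then {e} else {})" for x
    using d by (auto simp: into_def)
  have ed: "e \<in> into Act d" using e(1) d by (simp add: into_def)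
  have fin: "finite (into Act x)" for x using finite_into inv .
  have card: "card (into (Act - {e}) d) = a Deg d - 1" using into[of d] ed deg[OF edge(3)] fin by simp
  have deg': "\<forall>x \<in> reps. a1 Deg x = card (into (Act - {e}) x)"
    using card deg into by (simp add: a1)
  have a1': "a1 Flg = flg" "a1 Gone = a Gone" "a1 BktNx = a BktNx" "a1 BktHd = a BktHd" by (simp_all add: a1)
  have "finite (into (Act - {e}) d)" unfolding into using fin by simp
  then have empty: "into (Act - {e}) d = {} \<longleftrightarrow> a Deg d - 1 = 0"
    unfolding card[symmetric] by (simp only: card_0_eq)
  show ?thesis
  proof (cases "a Deg d - 1 = 0")
    case False
    then have "into (Act - {e}) d \<noteq> {}" unfolding empty .
    then have "peel_inv j {} Rm (Act - {e}) B flg" by (rule edge(1))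
    then have "peel_state j {} Rm (Act - {e}) B fu a1"
      unfolding peel_state_def a1' using fuel bkt deg' gone by blast
    moreover have "a2 = a1" using False by (simp add: a2)
    ultimately show ?thesis by blast
  next
    case True
    then have "into (Act - {e}) d = {}" unfolding empty .
    then have inv': "peel_inv j {} Rm (Act - {e}) (B(p := d # B p)) flg" by (rule edge(2))
    \<comment> \<open>So far \<open>d\<close> lies in no bucket, so both of its visits are still
      unspent.\<close>
    have "2 \<le> fu d" using fuel edge(3-5) unfolding fuel_ok_def by blast
    then have "fuel_ok {} Rm (B(p := d # B p)) fu" using fuel unfolding fuel_ok_def by auto
    moreover have "d \<noteq> 0" using reps_in[OF edge(3)] by auto
    then have "\<forall>q. chain (a2 BktNx) (a2 BktHd q) ((B(p := d # B p)) q)"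
      using bkt edge(5) True by (auto simp: a2 a1')
    moreover have "a2 Flg = flg" "a2 Deg = a1 Deg" "a2 Gone = a Gone" using True by (simp_all add: a2 a1')
    ultimately have "peel_state j {} Rm (Act - {e}) (B(p := d # B p)) fu a2"
      unfolding peel_state_def using inv' deg' gone by metis
    then show ?thesis by blast
  qed
qed

definition prepared :: "(var \<Rightarrow> nat) \<Rightarrow> (arr \<Rightarrow> nat \<Rightarrow> nat) \<Rightarrow> bool" where
  "prepared v a \<longleftrightarrow> loaded v a \<and> a Cmp = cmp \<and>
     (\<forall>c. chain (a CmpNx) (a InnHd c) (inner_list c)) \<and>
     (\<forall>c. chain (a CmpNx) (a CrsHd c) (leaving_list c)) \<and>
     (\<forall>i. 1 \<le> i \<and> i \<le> l \<longrightarrow> a Nxt i = next_same i)"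

lemma prepared_cong:
  assumes "prepared v a" "\<And>x. x \<in> {vZ, One, Len, NumT, Init, Fin, Sent} \<Longrightarrow> v' x = v x"
    "\<And>d. d \<in> {Wd, Src, Lab, Dst, Cmp, CmpNx, InnHd, CrsHd, Nxt} \<Longrightarrow> a' d = a d"
  shows "prepared v' a'"
  using assms(1) by (simp add: prepared_def loaded_def assms(2,3))

lemma leaving_cross: "{e. 1 \<le> e \<and> e \<le> m \<and> leaving c e} = {e \<in> cross. cmp (src e) = c}"
  by (auto simp: cross_def leaving_def)

lemma inner_eq: "inner c = set (inner_list c)"
  by (auto simp: inner_def inner_edge_def)

text \<open>During the release of \<open>c\<close>, the set \<open>Act\<close> exceeds the
  transitions with unremoved source by exactly the rest \<open>es\<close> of the list of
  \<open>c\<close>.\<close>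

abbreviation release_inv :: "nat \<Rightarrow> nat \<Rightarrow> nat \<Rightarrow> nat set \<Rightarrow> (nat \<Rightarrow> nat) \<Rightarrow>
    nat \<Rightarrow> nat \<Rightarrow> (arr \<Rightarrow> nat \<Rightarrow> nat) \<Rightarrow> bool" where
  "release_inv T j c Rm fu t i a \<equiv> \<exists>es Act B. peel_state j {} (insert c Rm) Act B fu a \<and>
     chain (a CmpNx) i es \<and> {e \<in> Act. cmp (src e) \<in> insert c Rm} = set es \<and> distinct es \<and>
     (\<forall>e \<in> set es. e \<in> cross \<and> cmp (src e) = c) \<and> unprocessed (insert c Rm) \<subseteq> Act \<and>
     t + 22 * length es \<le> T"

lemma wp_release:
  assumes prep: "prepared v a" and j: "v vJ = j" "1 \<le> j" "j \<le> l" and c: "v vC = c" "c \<in> reps" "c \<in> alive (j - 1)"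
    and a': "a' = a(Gone := (a Gone)(c := 1))"
    and st: "peel_state j {} (insert c Rm) Act B fu a'"
    and Act: "Act = {e \<in> cross. cmp (src e) \<notin> Rm}" and cR: "c \<notin> Rm"
  shows "wp inp release (\<lambda>t' v' a'. t' \<le> t + 22 * length (leaving_list c) + 6 \<and>
    (\<exists>B. peel_state j {} (insert c Rm) (unprocessed (insert c Rm)) B fu a')) t v a"
  unfolding release_def push_bucket_def wp_Seq wp_Cons wp_Nil
proof (rule wp_While_frame[where T = "t + 22 * length (leaving_list c) + 5" and
    I = "\<lambda>t' v' a'. release_inv (t + 22 * length (leaving_list c) + 5) j c Rm fu t' (v' vI) a'"], goal_cases)
  case 1
  let ?es = "leaving_list c"
  have "chain (a CmpNx) (a CrsHd c) ?es" "v One = 1" using prep by (simp_all add: prepared_def loaded_def)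
  moreover have "{e \<in> Act. cmp (src e) \<in> insert c Rm} = set ?es"
    unfolding set_selected leaving_cross using cR by (auto simp: Act)
  moreover have "\<forall>e \<in> set ?es. e \<in> cross \<and> cmp (src e) = c"
    unfolding set_selected leaving_cross by simp
  moreover have "(unprocessed (insert c Rm)) \<subseteq> Act" by (auto simp: Act)
  ultimately show ?case using st[unfolded a'] c(1)
    by (intro exI[of _ ?es] exI[of _ Act] exI[of _ B]) simp
next
  case (2 t' v' a')
  then obtain es Act B where st: "peel_state j {} (insert c Rm) Act B fu a'"
    and ch: "chain (a' CmpNx) (v' vI) es" and es: "{e \<in> Act. cmp (src e) \<in> insert c Rm} = set es" "distinct es"
      "\<forall>e \<in> set es. e \<in> cross \<and> cmp (src e) = c" and sub: "(unprocessed (insert c Rm)) \<subseteq> Act"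
    and time: "t' + 22 * length es \<le> t + 22 * length (leaving_list c) + 5"
    by blast
  have fr: "v' vZ = 0" "v' vJ = j" "v' vG = Suc j" "v' vA = w j" "a' Cmp = cmp" "a' Dst = a Dst" "a' Lab = a Lab" "a' CmpNx = a CmpNx"
    using 2(4,5) prep j(1) by (auto simp: prepared_def loaded_def)
  define e where "e = v' vI"
  have vI: "v' vI = e" by (simp add: e_def)
  have "e \<noteq> 0" using 2(2) fr by (simp add: e_def)
  then obtain es' where es': "es = e # es'" "chain (a' CmpNx) (a' CmpNx e) es'"
    using ch by (auto simp: e_def chain_pos)
  have e: "e \<in> Act" "e \<in> cross" "cmp (src e) = c" using es es' by auto
  then have e_in: "1 \<le> e" "e \<le> m" by (auto simp: cross_def)
  have fr2: "a Dst e = dst e" "a Lab e = lab e" using prep e_in by (auto simp: prepared_def loaded_def)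
  define d where "d = cmp (dst e)"
  note fr3 = fr fr2 vI d_def[symmetric]
  note edge = peel_state_edge[OF st e(1) _ _ j(2,3) d_def refl refl refl refl, unfolded e(3), OF insertI1 c(3), simplified]
  have *: "{f \<in> Act - {e}. cmp (src f) \<in> insert c Rm} = set es'" "distinct es'"
    "\<forall>e \<in> set es'. e \<in> cross \<and> cmp (src e) = c" "(unprocessed (insert c Rm)) \<subseteq> Act - {e}"
    "\<And>t''. t'' \<le> t' + 22 \<Longrightarrow> t'' + 22 * length es' \<le> t + 22 * length (leaving_list c) + 5"
    using es es' sub e(3) time by auto
  have fin: "release_inv (t + 22 * length (leaving_list c) + 5) j c Rm fu t'' i a''"
    if ex: "\<exists>B. peel_state j {} (insert c Rm) (Act - {e}) B fu a''"
      and nx: "a'' CmpNx = a' CmpNx" "i = a' CmpNx e" and t'': "t'' \<le> t' + 22"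
    for a'' i t''
  proof -
    obtain B where "peel_state j {} (insert c Rm) (Act - {e}) B fu a''" using ex by blast
    moreover have "chain (a'' CmpNx) i es'" using es'(2) nx by simp
    ultimately show ?thesis
      using *(1-4) *(5)[OF t''] by (intro exI[of _ es'] exI[of _ "Act - {e}"] exI[of _ B] conjI)
  qed
  show ?case
  proof (rule wp_conseq[where Q = "\<lambda>t'' v'' a''. (\<exists>B. peel_state j {} (insert c Rm) (Act - {e}) B fu a'') \<and>
      a'' CmpNx = a' CmpNx \<and> v'' vI = a' CmpNx e \<and> t'' \<le> t' + 22"], goal_cases)
    case 1
    show ?case
      using edge by (cases "lab e = w j"; cases "a' Deg d - 1 = 0"; cases "a' Flg d = j") (simp_all add: fr3)
  qed (rule fin; simp)
next
  case (3 t' v' a')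
  then obtain es Act B where st: "peel_state j {} (insert c Rm) Act B fu a'"
    and ch: "chain (a' CmpNx) (v' vI) es" and es: "{e \<in> Act. cmp (src e) \<in> insert c Rm} = set es"
    and sub: "(unprocessed (insert c Rm)) \<subseteq> Act"
    and time: "t' + 22 * length es \<le> t + 22 * length (leaving_list c) + 5"
    by blast
  have "v' vI = 0" using 3(2,4) prep by (auto simp: prepared_def loaded_def)
  then have "es = []" using ch by simp
  moreover have "peel_inv j {} (insert c Rm) Act B (a' Flg)" using st unfolding peel_state_def by blast
  then have "Act \<subseteq> cross" by (rule peel_invD(5))
  ultimately have "Act = (unprocessed (insert c Rm))" using es sub by auto
  then have "\<exists>B. peel_state j {} (insert c Rm) (unprocessed (insert c Rm)) B fu a'"
    using st by blast
  then show ?case using time by simp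
qed auto

section \<open>The exit position of a component\<close>

lemma wp_mark_letters:
  assumes prep: "prepared v a" and c: "v vC = c"
  shows "wp inp mark_letters (\<lambda>t' v' a'. t' \<le> t + 4 * length (inner_list c) + 2 \<and>
    (\<forall>x. a' Mrk x = (if x \<in> letters c then c else a Mrk x))) t v a"
  unfolding mark_letters_def wp_Seq wp_Cons wp_Nil
proof (rule wp_While_frame[where T = "t + 4 * length (inner_list c) + 1" and
    I = "\<lambda>t' v' a'. \<exists>ys zs. inner_list c = ys @ zs \<and> chain (a' CmpNx) (v' vI) zs \<and>
      (\<forall>x. a' Mrk x = (if x \<in> lab ` set ys then c else a Mrk x)) \<and>
      t' + 4 * length zs \<le> t + 4 * length (inner_list c) + 1"], goal_cases)
  case 1
  have "chain (a CmpNx) (a InnHd c) (inner_list c)" using prep by (simp add: prepared_def)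
  then show ?case using c by (intro exI[of _ "[]"] exI[of _ "inner_list c"]) simp
next
  case (2 t' v' a')
  then obtain ys zs where eq: "inner_list c = ys @ zs" and ch: "chain (a' CmpNx) (v' vI) zs"
    and mrk: "\<forall>x. a' Mrk x = (if x \<in> lab ` set ys then c else a Mrk x)"
    and time: "t' + 4 * length zs \<le> t + 4 * length (inner_list c) + 1" by blast
  have fr: "v' vZ = 0" "v' vC = c" "a' Lab = a Lab"
    using 2(4,5) prep c by (auto simp: prepared_def loaded_def)
  obtain zs' where zs: "zs = v' vI # zs'" "chain (a' CmpNx) (a' CmpNx (v' vI)) zs'"
    using ch 2(2) fr by (auto simp: chain_pos)
  have "v' vI \<in> set (inner_list c)" using eq zs(1) by simp
  then have "1 \<le> v' vI" "v' vI \<le> m" by (simp_all del: One_nat_def)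
  then have lab: "a Lab (v' vI) = lab (v' vI)" using prep by (simp add: prepared_def loaded_def)
  show ?case using eq zs mrk time fr lab
    by (simp, intro exI[of _ "ys @ [v' vI]"] exI[of _ zs']) auto
next
  case (3 t' v' a')
  then obtain ys zs where eq: "inner_list c = ys @ zs" and ch: "chain (a' CmpNx) (v' vI) zs"
    and mrk: "\<forall>x. a' Mrk x = (if x \<in> lab ` set ys then c else a Mrk x)"
    and time: "t' + 4 * length zs \<le> t + 4 * length (inner_list c) + 1" by blast
  have "v' vI = 0" using 3(2,4) prep by (auto simp: prepared_def loaded_def)
  then have "zs = []" using ch by simp
  then have "inner c = set ys" using eq inner_eq[of c] by (simp del: set_selected)
  then show ?case using mrk time by simp
qed auto

lemma sentinel_notin_letters: "w (Suc l) \<notin> letters c"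
  using w_out[of "Suc l"] by (auto simp: inner_def)

text \<open>Listed positions other than the sentinel carry distinct letters, so \<open>w\<close>
  maps the passed positions injectively into the labels of the inner transitions.\<close>

lemma firsts_walk:
  assumes eq: "firsts j = xs @ ys" and xs: "\<And>q. q \<in> set xs \<Longrightarrow> w q \<in> letters c"
  shows "length xs \<le> length (inner_list c)"
proof -
  have "inj_on w (set xs)"
  proof (rule linorder_inj_onI')
    fix p q assume pq: "p \<in> set xs" "q \<in> set xs" "p < q"
    have "q \<noteq> Suc l" using xs[OF pq(2)] sentinel_notin_letters by blast
    moreover have "p \<in> set (firsts j)" "q \<in> set (firsts j)" using eq pq by auto
    ultimately show "w p \<noteq> w q" using pq(3) by (auto simp: set_firsts)
  qed
  then have "card (set xs) = card (w ` set xs)" by (simp add: card_image)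
  also have "\<dots> \<le> card (letters c)" using xs by (intro card_mono) (auto simp: inner_eq simp del: set_selected)
  also have "\<dots> \<le> card (set (inner_list c))" unfolding inner_eq by (rule card_image_le) simp
  also have "\<dots> \<le> length (inner_list c)" by (rule card_length)
  finally show ?thesis using distinct_firsts[of j] eq by (simp add: distinct_card)
qed

text \<open>A position missing from the list repeats a letter. The first occurrence of
  \<open>w i\<close> from \<open>j\<close> on is listed and lies before \<open>p\<close>, so its
  letter has been checked. Hence walking the short list inspects the whole stretch of the
  word.\<close>

lemma firsts_prefix:
  assumes eq: "firsts j = xs @ p # ys" and xs: "\<And>q. q \<in> set xs \<Longrightarrow> w q \<in> letters c"
    and i: "j \<le> i" "i < p"
  shows "w i \<in> letters c"
proof -
  have pl: "p \<le> Suc l" using eq by (metis (mono_tags, lifting) in_set_conv_decomp mem_Collect_eq set_firsts)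
  define f where "f = (LEAST k. j \<le> k \<and> w k = w i)"
  have f: "j \<le> f" "w f = w i" "f \<le> i" unfolding f_def
    using LeastI[of "\<lambda>k. j \<le> k \<and> w k = w i" i] Least_le[of "\<lambda>k. j \<le> k \<and> w k = w i" i] i by auto
  have "w k \<noteq> w f" if "j \<le> k" "k < f" for k
    using not_less_Least[of k "\<lambda>k. j \<le> k \<and> w k = w i"] that f(2) unfolding f_def by auto
  then have "f \<in> set (firsts j)" using f i pl by (auto simp: set_firsts)
  moreover have "f \<notin> set (p # ys)" using sorted_firsts[of j] f(3) i(2) unfolding eq by (auto simp: sorted_append)
  ultimately have "f \<in> set xs" using eq by auto
  then show ?thesis using xs f(2) by metis
qed

lemma wp_find_exit:
  assumes prep: "prepared v a" and c: "v vC = c" "c \<noteq> 0" and j: "1 \<le> j" "j \<le> l"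
    and links: "links j (a Rgt) (a Lft)" and mrk: "\<And>x. a Mrk x = c \<longleftrightarrow> x \<in> letters c"
  shows "wp inp find_exit (\<lambda>t' v' a'. t' \<le> t + 4 * length (inner_list c) + 4 \<and>
    j \<le> v' vP \<and> v' vP \<le> Suc l \<and> (\<forall>i. j \<le> i \<and> i < v' vP \<longrightarrow> w i \<in> letters c) \<and> w (v' vP) \<notin> letters c) t v a"
  unfolding find_exit_def wp_Seq wp_Cons wp_Nil
proof (rule wp_While_frame[where T = "t + 4 * length (inner_list c) + 3" and
    I = "\<lambda>t' v' a'. \<exists>xs ys. firsts j = xs @ v' vP # ys \<and> v' vD = a Mrk (w (v' vP)) \<and>
      (\<forall>q \<in> set xs. w q \<in> letters c) \<and> t' \<le> t + 4 * length xs + 3"], goal_cases)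
  case 1
  have "firsts j \<noteq> []" using firsts_sentinel[of j] j by auto
  then obtain p ys where p: "firsts j = p # ys" by (cases "firsts j") auto
  then have "a Rgt 0 = p" using links by (simp add: links_def)
  moreover have "a Wd = w" "v vZ = 0" using prep by (simp_all add: prepared_def loaded_def)
  ultimately show ?case using p by (intro exI[of _ "[]"] exI[of _ ys]) simp
next
  case (2 t' v' a')
  then obtain xs ys where eq: "firsts j = xs @ v' vP # ys" and d: "v' vD = a Mrk (w (v' vP))"
    and xs: "\<forall>q \<in> set xs. w q \<in> letters c" and time: "t' \<le> t + 4 * length xs + 3" by blast
  have fr: "v' vC = c" "a' = a" using 2(4,5) c by (auto intro: ext)
  have wd: "a Wd = w" using prep by (simp add: prepared_def loaded_def)
  have w: "w (v' vP) \<in> letters c" using 2(2) fr d mrk by simp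
  then have "v' vP \<noteq> Suc l" using sentinel_notin_letters by metis
  moreover obtain zs where "firsts j = zs @ [Suc l]" using firsts_sentinel[of j] j by auto
  ultimately have "ys \<noteq> []" using eq by auto
  then obtain q ys' where ys: "ys = q # ys'" by (cases ys) auto
  have "linked (a Rgt) (a Lft) ((0 # xs) @ v' vP # q # ys')" using links eq ys by (simp add: links_def)
  then have "a Rgt (v' vP) = q" unfolding linked_append by blast
  then show ?case using eq ys xs w time fr wd
    by (simp, intro exI[of _ "xs @ [v' vP]"] exI[of _ ys']) auto
next
  case (3 t' v' a')
  then obtain xs ys where eq: "firsts j = xs @ v' vP # ys" and d: "v' vD = a Mrk (w (v' vP))"
    and xs: "\<forall>q \<in> set xs. w q \<in> letters c" and time: "t' \<le> t + 4 * length xs + 3" by blast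
  have "v' vC = c" using 3(4) c by simp
  then have "w (v' vP) \<notin> letters c" using 3(2) d mrk by simp
  moreover have "length xs \<le> length (inner_list c)" using firsts_walk[OF eq] xs by blast
  moreover have "v' vP \<in> set (firsts j)" using eq by simp
  then have "j \<le> v' vP" "v' vP \<le> Suc l" by (auto simp: set_firsts)
  ultimately show ?case using firsts_prefix[OF eq] xs time by auto
next
  case (4 t' v' a')
  then obtain xs ys where eq: "firsts j = xs @ v' vP # ys" 
    and xs: "\<forall>q \<in> set xs. w q \<in> letters c" and time: "t' \<le> t + 4 * length xs + 3" by blast
  have "length xs \<le> length (inner_list c)" using firsts_walk[OF eq] xs by blast
  then show ?case using time by simp
qed

section \<open>Visits to a component and their amortized cost\<close>

lemma peel_state_cong:
  assumes "peel_state j cur Rm Act B fu a" "\<And>d. d \<in> {Flg, BktNx, BktHd, Deg, Gone} \<Longrightarrow> a' d = a d"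
  shows "peel_state j cur Rm Act B fu a'"
  using assms(1) unfolding peel_state_def by (simp add: assms(2))

lemma peel_state_pop:
  assumes st: "peel_state j {} Rm Act B fu a" and c: "a BktHd j = c" "c \<noteq> 0"
  obtains B' where "peel_state j {c} Rm Act B' fu (a(BktHd := (a BktHd)(j := a BktNx c)))"
    "c \<in> reps" "c \<notin> Rm" "into Act c = {}" "on_its_own c j" "1 \<le> fu c" "w j \<in> letters c \<Longrightarrow> 2 \<le> fu c"
    "\<And>p. c \<notin> set (B' p)"
proof -
  have inv: "peel_inv j {} Rm Act B (a Flg)" and fuel: "fuel_ok {} Rm B fu"
    and bkt: "\<And>p. chain (a BktNx) (a BktHd p) (B p)" and deg: "\<forall>d \<in> reps. a Deg d = card (into Act d)"
    and gone: "\<forall>c \<in> reps. a Gone c = 0 \<longleftrightarrow> c \<notin> Rm"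
    using st unfolding peel_state_def by blast+
  have "chain (a BktNx) c (B j)" using bkt[of j] c(1) by simp
  then obtain cs where cs: "B j = c # cs" "chain (a BktNx) (a BktNx c) cs" using c(2) by (auto simp: chain_pos)
  let ?B = "B(j := cs)"
  have inv': "peel_inv j {c} Rm Act ?B (a Flg)" by (rule peel_inv_pop[OF inv cs(1)])
  have notin: "c \<notin> set (?B p)" for p using peel_invD(7)[OF inv', of c p] by blast
  have sub: "set (?B p) \<subseteq> set (B p)" "set (B p) \<subseteq> set (?B p) \<union> {c}" for p using cs(1) by auto
  have "fuel_ok {c} Rm ?B fu" using fuel sub unfolding fuel_ok_def by blast
  moreover have "chain (a BktNx) (((a BktHd)(j := a BktNx c)) p) (?B p)" for p using bkt cs(2) by simp
  ultimately have "peel_state j {c} Rm Act ?B fu (a(BktHd := (a BktHd)(j := a BktNx c)))"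
    using inv' deg gone unfolding peel_state_def by simp
  moreover have cB: "c \<in> set (B j)" using cs(1) by simp
  note peel_invD(7)[OF inv cB]
  moreover have "1 \<le> fu c \<and> (w j \<in> letters c \<longrightarrow> 2 \<le> fu c)" using fuel cB unfolding fuel_ok_def by blast
  ultimately show thesis using that notin by blast
qed

lemma on_its_own_later:
  assumes "on_its_own c j" "j \<le> p" "p \<le> Suc l" "\<forall>i. j \<le> i \<and> i < p \<longrightarrow> w i \<in> letters c"
  shows "on_its_own c p"
proof (cases "p = j")
  case False
  have own: "c \<in> alive k \<longleftrightarrow> (\<forall>i \<in> {j..k}. w i \<in> letters c)" if "j \<le> k" "k \<le> l" for k
    using assms(1) that unfolding on_its_own_def by blast
  have "c \<in> alive (p - 1)" using own[of "p - 1"] assms False by auto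
  moreover have "c \<in> alive k \<longleftrightarrow> (\<forall>i \<in> {p..k}. w i \<in> letters c)" if "p \<le> k" "k \<le> l" for k
    unfolding own[OF le_trans[OF assms(2) that(1)] that(2)]
    using assms(2,4) by (metis atLeastAtMost_iff le_trans not_le)
  ultimately show ?thesis unfolding on_its_own_def by blast
qed (use assms in simp)

text \<open>At the position \<open>p\<close> the component lacks the letter, so the next visit is
  the last one and a single unit of fuel suffices.\<close>

lemma peel_state_push:
  assumes st: "peel_state j {c} Rm Act B fu a" and c: "c \<in> reps" "c \<notin> Rm" "into Act c = {}" "\<And>p. c \<notin> set (B p)"
    and p: "on_its_own c p" "j \<le> p" "p \<le> Suc l" "w p \<notin> letters c"
  shows "\<exists>B. peel_state j {} Rm Act B (fu(c := 1)) (a(BktNx := (a BktNx)(c := a BktHd p), BktHd := (a BktHd)(p := c)))"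
proof -
  have inv: "peel_inv j {c} Rm Act B (a Flg)" and fuel: "fuel_ok {c} Rm B fu"
    and bkt: "\<And>p. chain (a BktNx) (a BktHd p) (B p)" and deg: "\<forall>d \<in> reps. a Deg d = card (into Act d)"
    and gone: "\<forall>c \<in> reps. a Gone c = 0 \<longleftrightarrow> c \<notin> Rm"
    using st unfolding peel_state_def by blast+
  let ?B = "B(p := c # B p)"
  have "peel_inv j ({c} - {c}) Rm Act ?B (a Flg)" by (rule peel_inv_push[OF inv c p(1-3)])
  then have inv': "peel_inv j {} Rm Act ?B (a Flg)" by simp
  have mem: "d \<in> set (?B q) \<longleftrightarrow> d \<in> set (B q) \<or> (d = c \<and> q = p)" for d q by auto
  have f1: "2 \<le> fu d" if "d \<in> reps" "d \<notin> Rm" "d \<noteq> c" "\<forall>p. d \<notin> set (B p)" for d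
    using fuel that unfolding fuel_ok_def by blast
  have f2: "1 \<le> fu d \<and> (w q \<in> letters d \<longrightarrow> 2 \<le> fu d)" if "d \<in> set (B q)" for d q
    using fuel that unfolding fuel_ok_def by blast
  have "fuel_ok {} Rm ?B (fu(c := 1))" unfolding fuel_ok_def
  proof (intro conjI allI ballI impI)
    fix d assume "d \<in> reps" "d \<notin> Rm" and d: "\<forall>q. d \<notin> set (?B q)"
    moreover have "d \<noteq> c" "\<forall>q. d \<notin> set (B q)" using d mem by blast+
    ultimately show "2 \<le> (fu(c := 1)) d" using f1 by simp
  next
    fix q d assume d: "d \<in> set (?B q)"
    show "1 \<le> (fu(c := 1)) d"
      using f2[of d q] d mem by (cases "d = c") auto
    assume "w q \<in> letters d"
    then have "d \<noteq> c" using d mem c(4) p(4) by blast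
    then show "2 \<le> (fu(c := 1)) d" using f2[of d q] d mem \<open>w q \<in> letters d\<close> by simp
  qed
  moreover have "c \<noteq> 0" using reps_in[OF c(1)] by auto
  then have "\<forall>q. chain ((a BktNx)(c := a BktHd p)) (((a BktHd)(p := c)) q) (?B q)" using bkt c(4) by simp
  ultimately have "peel_state j {} Rm Act ?B (fu(c := 1))
      (a(BktNx := (a BktNx)(c := a BktHd p), BktHd := (a BktHd)(p := c)))"
    using inv' deg gone unfolding peel_state_def by simp
  then show ?thesis by blast
qed

lemma peel_state_remove:
  assumes st: "peel_state j {c} Rm Act B fu a" and c: "c \<in> reps" "into Act c = {}" "\<And>p. c \<notin> set (B p)"
    and j: "on_its_own c j" "j \<le> l" "w j \<notin> letters c"
  shows "peel_state j {} (insert c Rm) Act B (fu(c := 0)) (a(Gone := (a Gone)(c := 1)))"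
proof -
  have inv: "peel_inv j {c} Rm Act B (a Flg)" and fuel: "fuel_ok {c} Rm B fu"
    and bkt: "\<And>p. chain (a BktNx) (a BktHd p) (B p)" and deg: "\<forall>d \<in> reps. a Deg d = card (into Act d)"
    and gone: "\<forall>c \<in> reps. a Gone c = 0 \<longleftrightarrow> c \<notin> Rm"
    using st unfolding peel_state_def by blast+
  have "peel_inv j {} (insert c Rm) Act B (a Flg)" by (rule peel_inv_remove[OF inv c(1,2) j])
  moreover have "fuel_ok {} (insert c Rm) B (fu(c := 0))"
    using fuel c(3) unfolding fuel_ok_def by (simp, metis)
  moreover have "\<forall>x \<in> reps. ((a Gone)(c := 1)) x = 0 \<longleftrightarrow> x \<notin> insert c Rm" using gone by simp
  ultimately show ?thesis using bkt deg unfolding peel_state_def by simp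
qed

text \<open>A visit costs at most 8 units per inner transition, for marking and walking, 22 per
  leaving transition, and 17 besides. So 25 units per unit of weight pay for it, the summand 1
  covering components without transitions.\<close>

definition weight :: "nat \<Rightarrow> nat" where
  "weight c = length (inner_list c) + length (leaving_list c) + 1"

definition potential :: "(nat \<Rightarrow> nat) \<Rightarrow> nat" where
  "potential fu = (\<Sum>c\<in>{1..n}. fu c * weight c)"

lemma potential_upd:
  "c \<in> {1..n} \<Longrightarrow> potential (fu(c := k)) + fu c * weight c = potential fu + k * weight c"
  unfolding potential_def using sum_upd[of c n "\<lambda>k x. k * weight x" fu k] by simp

text \<open>Marks are never erased. A stale mark is harmless: it names a component that does own the
  letter, so after \<open>c\<close> has marked its letters, exactly these carry the mark
  \<open>c\<close>.\<close>

definition marks_ok :: "(arr \<Rightarrow> nat \<Rightarrow> nat) \<Rightarrow> bool" where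
  "marks_ok a \<longleftrightarrow> (\<forall>x. a Mrk x \<noteq> 0 \<longrightarrow> x \<in> letters (a Mrk x))"

definition bucket_inv :: "nat \<Rightarrow> nat \<Rightarrow> nat \<Rightarrow> (var \<Rightarrow> nat) \<Rightarrow> (arr \<Rightarrow> nat \<Rightarrow> nat) \<Rightarrow> bool" where
  "bucket_inv T j t v a \<longleftrightarrow> (\<exists>Rm B fu. peel_state j {} Rm (unprocessed Rm) B fu a \<and> marks_ok a \<and>
     v vC = a BktHd j \<and> t + 25 * potential fu \<le> T)"

lemma wp_empty_bucket:
  assumes prep: "prepared v a" and j: "v vJ = j" "1 \<le> j" "j \<le> l" and links: "links j (a Rgt) (a Lft)"
    and inv: "bucket_inv T j t v a"
  shows "wp inp empty_bucket (\<lambda>t' v' a'. \<exists>Rm B fu. peel_state j {} Rm (unprocessed Rm) B fu a' \<and>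
    B j = [] \<and> marks_ok a' \<and> t' + 25 * potential fu \<le> Suc T) t v a"
  unfolding empty_bucket_def
proof (rule wp_While_frame[where T = T and I = "bucket_inv T j"], goal_cases)
  case 1
  then show ?case by (rule inv)
next
  case (2 t' v' a')
  note defs = mark_letters_def find_exit_def release_def push_bucket_def
  have prep': "prepared v' a'"
    by (rule prepared_cong[OF prep]; rule 2(4,5)) (auto simp: defs)
  have fr: "v' vZ = 0" "v' vJ = j" "a' Rgt = a Rgt" "a' Lft = a Lft"
    using 2(4,5) prep j(1) by (auto simp: defs prepared_def loaded_def)
  obtain Rm B fu where st: "peel_state j {} Rm (unprocessed Rm) B fu a'" and marks: "marks_ok a'"
    and vC: "v' vC = a' BktHd j" and time: "t' + 25 * potential fu \<le> T"
    using 2(1) unfolding bucket_inv_def by blast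
  define c where "c = v' vC"
  have c0: "c \<noteq> 0" "a' BktHd j = c" "v' vC = c" using 2(2) fr vC by (auto simp: c_def)
  let ?a1 = "a'(BktHd := (a' BktHd)(j := a' BktNx c))"
  obtain B1 where st1: "peel_state j {c} Rm (unprocessed Rm) B1 fu ?a1"
    and c: "c \<in> reps" "c \<notin> Rm" "into (unprocessed Rm) c = {}" "on_its_own c j" and fu: "1 \<le> fu c"
      "w j \<in> letters c \<Longrightarrow> 2 \<le> fu c" and cB: "\<And>p. c \<notin> set (B1 p)"
    by (rule peel_state_pop[OF st c0(2,1)]) blast
  have cn: "c \<in> {1..n}" using reps_in c(1) by blast
  let ?v1 = "v'(vH := a' BktNx c)"
  let ?t1 = "Suc (Suc (Suc t'))"
  let ?li = "length (inner_list c)" and ?lo = "length (leaving_list c)"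
  let ?tail = "wp inp (Branch (Same vP vJ) release (push_bucket vC)) (wp inp (Do [Get vC BktHd vJ]) (bucket_inv T j))"
  have prep1: "prepared ?v1 ?a1" by (rule prepared_cong[OF prep']) auto
  have "wp inp mark_letters (wp inp find_exit ?tail) ?t1 ?v1 ?a1"
  proof (rule wp_conseq[OF wp_mark_letters[OF prep1, of c]], goal_cases)
    case 1
    then show ?case using c0 by simp
  next
    case (2 t2 v2 a2)
    have prep2: "prepared v2 a2" by (rule prepared_cong[OF prep1]; rule 2(3,4)) (auto simp: defs)
    have v2: "v2 vC = c" "v2 vJ = j" "a2 Rgt = a Rgt" "a2 Lft = a Lft"
      using 2(3,4) c0 fr by (auto simp: defs)
    have st2: "peel_state j {c} Rm (unprocessed Rm) B1 fu a2"
      by (rule peel_state_cong[OF st1]; rule 2(4)) (auto simp: defs)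
    have mrk: "a2 Mrk x = (if x \<in> letters c then c else a' Mrk x)" for x using 2(2) by simp
    have mrk': "a2 Mrk x = c \<longleftrightarrow> x \<in> letters c" for x
      using mrk[of x] marks c0(1) unfolding marks_ok_def by metis
    have marks2: "marks_ok a2" using marks mrk unfolding marks_ok_def by metis
    have links2: "links j (a2 Rgt) (a2 Lft)" using links v2 by simp
    show ?case
    proof (rule wp_conseq[OF wp_find_exit[OF prep2 v2(1) c0(1) j(2,3) links2 mrk']], goal_cases)
      case (1 t3 v3 a3)
      have a3: "a3 = a2" using 1(4) by (auto simp: defs)
      have v3: "v3 vC = c" "v3 vJ = j" using 1(3) v2 by (auto simp: defs)
      have prep3: "prepared v3 a3" by (rule prepared_cong[OF prep2]; (rule 1(3))?) (auto simp: defs a3)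
      have t3: "t3 \<le> t' + 8 * ?li + 9" using 2(2) 1(2) by simp
      have vP: "j \<le> v3 vP" "v3 vP \<le> Suc l" "\<forall>i. j \<le> i \<and> i < v3 vP \<longrightarrow> w i \<in> letters c" "w (v3 vP) \<notin> letters c"
        using 1(2) by auto
      show ?case
      proof (cases "v3 vP = j")
        case True
        let ?fu = "fu(c := 0)"
        have st3: "peel_state j {} (insert c Rm) (unprocessed Rm) B1 ?fu (a2(Gone := (a2 Gone)(c := 1)))"
          by (rule peel_state_remove[OF st2 c(1,3) cB c(4) j(3)]) (use vP(4) True in simp)
        have pot: "25 * potential ?fu + 25 * weight c \<le> 25 * potential fu"
        proof -
          have "potential ?fu + fu c * weight c = potential fu" using potential_upd[OF cn, of fu 0] by simp
          moreover have "weight c \<le> fu c * weight c" using fu(1) by simp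
          ultimately show ?thesis by linarith
        qed
        have "c \<in> alive (j - 1)" using c(4) by (simp add: on_its_own_def)
        note rel = wp_release[OF prep3 v3(2) j(2,3) v3(1) c(1) this, unfolded a3, OF refl st3 refl c(2)]
        have "wp inp release (wp inp (Do [Get vC BktHd vJ]) (bucket_inv T j)) (Suc t3) v3 a2"
        proof (rule wp_conseq[OF rel], goal_cases)
          case (1 t4 v4 a4)
          then obtain B4 where st4: "peel_state j {} (insert c Rm) (unprocessed (insert c Rm)) B4 ?fu a4" by blast
          have "a4 Mrk = a2 Mrk" "v4 vJ = j" using 1(3,4) v3 by (auto simp: defs)
          moreover have "marks_ok a4" using marks2 calculation unfolding marks_ok_def by simp
          moreover have "Suc t4 + 25 * potential ?fu \<le> T"
            using conjunct1[OF 1(2)] t3 time pot unfolding weight_def by simp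
          ultimately show ?case using st4 unfolding bucket_inv_def wp_Cons wp_Nil
            by (intro exI[of _ "insert c Rm"] exI[of _ B4] exI[of _ ?fu]) simp
        qed
        then show ?thesis using True v3 by (simp add: a3)
      next
        case False
        let ?fu = "fu(c := 1)"
        \<comment> \<open>An exit beyond \<open>j\<close> means that the current letter is owned, so
          this is the first visit and two units of fuel are left.\<close>
        have "w j \<in> letters c" using vP(1,3) False by simp
        then have fu2: "2 \<le> fu c" by (rule fu(2))
        have pot: "25 * potential ?fu + 25 * weight c \<le> 25 * potential fu"
        proof -
          have "potential ?fu + fu c * weight c = potential fu + weight c" using potential_upd[OF cn, of fu 1] by simp
          moreover have "2 * weight c \<le> fu c * weight c" using fu2 by simp
          ultimately show ?thesis by linarith
        qed
        have "on_its_own c (v3 vP)" by (rule on_its_own_later[OF c(4) vP(1-3)])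
        from peel_state_push[OF st2 c(1-3) cB this vP(1,2,4)]
        obtain B4 where st4: "peel_state j {} Rm (unprocessed Rm) B4 ?fu
          (a2(BktNx := (a2 BktNx)(c := a2 BktHd (v3 vP)), BktHd := (a2 BktHd)(v3 vP := c)))" by blast
        have "marks_ok (a2(BktNx := (a2 BktNx)(c := a2 BktHd (v3 vP)), BktHd := (a2 BktHd)(v3 vP := c)))"
          using marks2 unfolding marks_ok_def by simp
        moreover have "Suc (Suc (Suc (Suc (Suc t3)))) + 25 * potential ?fu \<le> T"
          using t3 time pot unfolding weight_def by simp
        ultimately have "bucket_inv T j (Suc (Suc (Suc (Suc (Suc t3)))))
          (v3(vH := a2 BktHd (v3 vP), vC := ((a2 BktHd)(v3 vP := c)) j))
          (a2(BktNx := (a2 BktNx)(c := a2 BktHd (v3 vP)), BktHd := (a2 BktHd)(v3 vP := c)))"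
          using st4 unfolding bucket_inv_def by (intro exI[of _ Rm] exI[of _ B4] exI[of _ ?fu]) simp
        then show ?thesis using False v3 by (simp add: a3 push_bucket_def)
      qed
    qed
  qed
  then show ?case using c0 fr by simp
next
  case (3 t' v' a')
  then obtain Rm B fu where st: "peel_state j {} Rm (unprocessed Rm) B fu a'" and marks: "marks_ok a'"
    and vC: "v' vC = a' BktHd j" and time: "t' + 25 * potential fu \<le> T"
    unfolding bucket_inv_def by blast
  have "v' vZ = 0" using 3(4) prep
    by (auto simp: mark_letters_def find_exit_def release_def push_bucket_def prepared_def loaded_def)
  then have "a' BktHd j = 0" using 3(2) vC by simp
  moreover have "chain (a' BktNx) (a' BktHd j) (B j)" using st unfolding peel_state_def by blast
  ultimately have "B j = []" by simp
  moreover have "Suc t' + 25 * potential fu \<le> Suc T" using time by simp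
  ultimately show ?case using st marks by blast
next
  case (4 t' v' a')
  then obtain fu where "t' + 25 * potential fu \<le> T" unfolding bucket_inv_def by blast
  then show ?case by simp
qed

section \<open>From one letter to the next\<close>

lemma peel_state_next:
  assumes st: "peel_state j {} Rm (unprocessed Rm) B fu a" and B: "B j = []"
  shows "peel_state (Suc j) {} Rm (unprocessed Rm) B fu a" "\<forall>c \<in> Rm. c \<notin> alive j"
proof -
  have inv: "peel_inv j {} Rm (unprocessed Rm) B (a Flg)" using st unfolding peel_state_def by blast
  have "peel_inv (Suc j) {} Rm (unprocessed Rm) B (a Flg)" by (rule peel_inv_next[OF inv B]) blast
  then show "peel_state (Suc j) {} Rm (unprocessed Rm) B fu a" using st unfolding peel_state_def by blast
  show "\<forall>c \<in> Rm. c \<notin> alive j" using peel_invD(2)[OF inv] by blast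
qed

text \<open>Every state is reachable from \<open>q0\<close>, so a transition into the component of
  \<open>q0\<close> would close a cycle through its own source. Together with
  \<open>into_empty\<close> this makes it the only component without predecessors, hence the only
  one filed at the start.\<close>

lemma into_source: "into cross (cmp q0) = {}"
proof -
  have "cmp (dst e) \<noteq> cmp q0" if "e \<in> cross" for e
  proof
    assume eq: "cmp (dst e) = cmp q0"
    have e: "1 \<le> e" "e \<le> m" "cmp (src e) \<noteq> cmp (dst e)" using that by (auto simp: cross_def)
    have "(q0, src e) \<in> E\<^sup>*" using reach_q0[OF src_in[OF e(1,2)]] by (simp add: E_def)
    moreover have "(dst e, q0) \<in> E\<^sup>*" using cmp_eq[OF dst_in[OF e(1,2)] q0_in] eq by simp
    moreover have "(src e, dst e) \<in> E" using E_I e by simp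
    ultimately have "mutual E (src e) (dst e)" by (meson r_into_rtrancl rtrancl_trans)
    then show False using cmp_eq[OF src_in[OF e(1,2)] dst_in[OF e(1,2)]] e(3) by simp
  qed
  then show ?thesis by (auto simp: into_def)
qed

lemma into_empty: "c \<in> reps \<Longrightarrow> into cross c = {} \<Longrightarrow> c = cmp q0"
proof (rule ccontr)
  assume c: "c \<in> reps" "into cross c = {}" "c \<noteq> cmp q0"
  have cn: "c \<in> {1..n}" "cmp c = c" using reps_in[OF c(1)] by blast+
  have "(q0, c) \<in> E\<^sup>*" using reach_q0[OF cn(1)] by (simp add: E_def)
  then obtain e where "e \<in> cross" "cmp (dst e) = cmp c"
    using enter_component[OF _ q0_in] c(3) cn(2) by metis
  then show False using c(2) cn(2) by (auto simp: into_def)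
qed

text \<open>The inner and the leaving transitions of \<open>c\<close> are disjoint sets of
  transitions with source in \<open>c\<close>; summed over all components they count no transition
  twice.\<close>

lemma potential_init: "potential (\<lambda>_. 2) \<le> 2 * (m + n)"
proof -
  have "weight c \<le> length (selected (\<lambda>e. cmp (src e) = c) m) + 1" for c
  proof -
    have len: "length (selected R m) = card {e. 1 \<le> e \<and> e \<le> m \<and> R e}" for R
      using distinct_card[OF distinct_selected, of R m] by simp
    have "card {e. 1 \<le> e \<and> e \<le> m \<and> inner_edge c e} + card {e. 1 \<le> e \<and> e \<le> m \<and> leaving c e} =
        card ({e. 1 \<le> e \<and> e \<le> m \<and> inner_edge c e} \<union> {e. 1 \<le> e \<and> e \<le> m \<and> leaving c e})"
      by (rule card_Un_disjoint[symmetric]) (auto simp: inner_edge_def leaving_def)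
    also have "\<dots> \<le> card {e. 1 \<le> e \<and> e \<le> m \<and> cmp (src e) = c}"
      by (rule card_mono) (auto simp: inner_edge_def leaving_def)
    finally show ?thesis by (simp add: weight_def len del: One_nat_def)
  qed
  then have "potential (\<lambda>_. 2) \<le> (\<Sum>c\<in>{1..n}. 2 * (length (selected (\<lambda>e. cmp (src e) = c) m) + 1))"
    unfolding potential_def by (intro sum_mono mult_le_mono) auto
  also have "\<dots> = 2 * ((\<Sum>c\<in>{1..n}. length (selected (\<lambda>e. cmp (src e) = c) m)) + n)"
    unfolding sum_distrib_left[symmetric] sum.distrib by simp
  also have "(\<Sum>c\<in>{1..n}. length (selected (\<lambda>e. cmp (src e) = c) m)) = m"
    by (rule sum_selected) (use src_in cmp_in in blast)
  finally show ?thesis .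
qed

lemma peel_state_init:
  assumes deg: "\<forall>c. a Deg c = length (selected (entering c) m)"
    and zero: "a Flg = (\<lambda>_. 0)" "a Gone = (\<lambda>_. 0)" "a BktNx = (\<lambda>_. 0)" "a BktHd = (\<lambda>_. 0)"
  shows "peel_state 1 {} {} (unprocessed {}) (\<lambda>p. if p = 1 then [cmp q0] else []) (\<lambda>_. 2)
    (a(BktHd := (a BktHd)(1 := cmp q0)))"
proof -
  let ?B = "\<lambda>p. if p = 1 then [cmp q0] else []"
  have un: "unprocessed {} = cross" by simp
  have q0: "cmp q0 \<in> reps" "cmp q0 \<in> {1..n}" using cmp_reps cmp_in q0_in by blast+
  have noedge: "cmp (dst e) \<noteq> cmp q0" if "e \<in> cross" for e using into_source that by (auto simp: into_def)
  have own: "on_its_own (cmp q0) 1"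
    by (rule on_its_own_intro[OF q0(1)]) (use noedge q0(2) in auto)
  have "peel_inv 1 {} {} cross ?B (\<lambda>_. 0)"
  proof (rule peel_invI)
    show "reps - {} \<subseteq> alive (1 - 1)" using reps_in by auto
    show "1 \<le> p \<and> p \<le> Suc l \<and> c \<in> reps \<and> c \<notin> {} \<and> c \<notin> {} \<and> into cross c = {} \<and> on_its_own c p"
      if "c \<in> set (?B p)" for p c using that own q0(1) into_source by (auto split: if_splits)
    show "\<exists>p. c \<in> set (?B p)" if "c \<in> reps" "into cross c = {}" for c
      using into_empty[OF that] by (intro exI[of _ 1]) simp
  qed (auto split: if_splits)
  moreover have "fuel_ok {} {} ?B (\<lambda>_. 2)" by (simp add: fuel_ok_def)
  moreover have "a Deg d = card (into cross d)" for d
  proof -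
    have "into cross d = set (selected (entering d) m)" by (auto simp: into_def cross_def entering_def)
    then show ?thesis using deg by (simp add: distinct_card del: set_selected)
  qed
  moreover have "\<forall>p. chain (a BktNx) (((a BktHd)(1 := cmp q0)) p) (?B p)" using q0(2) zero by auto
  ultimately show ?thesis unfolding peel_state_def un using zero by simp
qed

abbreviation letters_inv :: "nat \<Rightarrow> nat \<Rightarrow> nat \<Rightarrow> (arr \<Rightarrow> nat \<Rightarrow> nat) \<Rightarrow> bool" where
  "letters_inv T t j a \<equiv> 1 \<le> j \<and> j \<le> Suc l \<and> links j (a Rgt) (a Lft) \<and> marks_ok a \<and>
     (\<exists>Rm B fu. peel_state j {} Rm (unprocessed Rm) B fu a \<and> (\<forall>c \<in> Rm. c \<notin> alive (j - 1)) \<and>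
       t + 25 * potential fu + 14 * (Suc l - j) \<le> T)"

lemma wp_read_letters:
  assumes prep: "prepared v a" and links: "links 1 (a Rgt) (a Lft)"
    and deg: "\<forall>c. a Deg c = length (selected (entering c) m)"
    and zero: "a Flg = (\<lambda>_. 0)" "a Gone = (\<lambda>_. 0)" "a BktNx = (\<lambda>_. 0)" "a BktHd = (\<lambda>_. 0)"
      "a Mrk = (\<lambda>_. 0)"
  shows "wp inp read_letters (\<lambda>t' v' a'. t' \<le> t + 50 * (m + n) + 14 * l + 5 \<and>
    (a' Gone (cmp qf) = 0 \<longleftrightarrow> qf \<in> alive l)) t v a"
  unfolding read_letters_def wp_Seq wp_Cons wp_Nil
proof (rule wp_While_frame[where T = "t + 50 * (m + n) + 14 * l + 4" and
    I = "\<lambda>t' v' a'. letters_inv (t + 50 * (m + n) + 14 * l + 4) t' (v' vJ) a'"], goal_cases)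
  case 1
  have "peel_state 1 {} {} (unprocessed {}) (\<lambda>p. if p = 1 then [cmp q0] else []) (\<lambda>_. 2)
    (a(BktHd := (a BktHd)(1 := cmp q0)))" by (rule peel_state_init[OF deg zero(1-4)])
  moreover have "v Init = q0" "a Cmp = cmp" using prep by (simp_all add: prepared_def loaded_def)
  moreover have "25 * potential (\<lambda>_. 2) \<le> 50 * (m + n)" using potential_init by simp
  moreover have "marks_ok (a(BktHd := (a BktHd)(1 := cmp q0)))" using zero by (simp add: marks_ok_def)
  moreover from calculation have "\<exists>Rm B fu. peel_state 1 {} Rm (unprocessed Rm) B fu
      (a(BktHd := (a BktHd)(1 := cmp q0))) \<and> (\<forall>c \<in> Rm. c \<notin> alive (1 - 1)) \<and> 25 * potential fu \<le> 50 * (m + n)"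
    by (intro exI[of _ "{}"] exI[of _ "\<lambda>p. if p = 1 then [cmp q0] else []"] exI[of _ "\<lambda>_. 2"]) blast
  ultimately show ?case using links by simp
next
  case (2 t' v' a')
  note defs = empty_bucket_def unlink_position_def mark_letters_def find_exit_def release_def push_bucket_def
  have prep': "prepared v' a'"
    by (rule prepared_cong[OF prep]) (use 2(4,5) in \<open>auto simp: defs\<close>)
  define j where "j = v' vJ"
  have vJ: "v' vJ = j" by (simp add: j_def)
  have "v' Sent = Suc l" using prep' by (simp add: prepared_def loaded_def)
  then have j: "1 \<le> j" "j \<le> l" using 2(1,2) vJ by auto
  obtain Rm B fu where st: "peel_state j {} Rm (unprocessed Rm) B fu a'" and marks: "marks_ok a'"
    and links: "links j (a' Rgt) (a' Lft)"
    and time: "t' + 25 * potential fu + 14 * (Suc l - j) \<le> t + 50 * (m + n) + 14 * l + 4"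
    using 2(1) unfolding vJ by blast
  let ?v = "v'(vC := a' BktHd j)"
  let ?T = "t' + 2 + 25 * potential fu"
  have inv: "bucket_inv ?T j (Suc (Suc t')) ?v a'"
    unfolding bucket_inv_def using st marks by (intro exI[of _ Rm] exI[of _ B] exI[of _ fu]) simp
  have "prepared ?v a'" by (rule prepared_cong[OF prep']) auto
  note wp1 = wp_empty_bucket[OF this _ j links inv]
  let ?I = "\<lambda>t' v' a'. letters_inv (t + 50 * (m + n) + 14 * l + 4) t' (v' vJ) a'"
  have "wp inp empty_bucket (wp inp unlink_position (wp inp (Do [Inc vJ]) ?I)) (Suc (Suc t')) ?v a'"
  proof (rule wp_conseq[OF wp1], goal_cases)
    case 1
    then show ?case using vJ by simp
  next
    case (2 t2 v2 a2)
    then obtain Rm2 B2 fu2 where st2: "peel_state j {} Rm2 (unprocessed Rm2) B2 fu2 a2" "B2 j = []"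
      and marks2: "marks_ok a2" and time2: "t2 + 25 * potential fu2 \<le> Suc ?T" by blast
    have prep2: "prepared v2 a2" by (rule prepared_cong[OF prep']) (use 2(3,4) in \<open>auto simp: defs\<close>)
    have v2: "v2 vJ = j" "a2 Rgt = a' Rgt" "a2 Lft = a' Lft" using 2(3,4) vJ by (auto simp: defs)
    have "a2 Nxt j = next_same j" "loaded v2 a2" using prep2 j by (auto simp: prepared_def)
    then have wp2: "wp inp unlink_position (\<lambda>t' v' a'. t' \<le> t2 + 9 \<and> links (Suc (v2 vJ)) (a' Rgt) (a' Lft)) t2 v2 a2"
      using j links v2 by (intro wp_unlink_position) auto
    show ?case
    proof (rule wp_conseq[OF wp2], goal_cases)
      case (1 t3 v3 a3)
      have J3: "v3 vJ = j" using 1(3) v2 by (simp add: defs)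
      have "peel_state j {} Rm2 (unprocessed Rm2) B2 fu2 a3"
        by (rule peel_state_cong[OF st2(1)]; rule 1(4)) (auto simp: defs)
      note st3 = peel_state_next[OF this st2(2)]
      have "a3 Mrk = a2 Mrk" using 1(4) by (simp add: defs)
      then have "marks_ok a3" using marks2 unfolding marks_ok_def by simp
      moreover have "links (Suc j) (a3 Rgt) (a3 Lft)" using 1(2) v2 by simp
      \<comment> \<open>Apart from the potential a letter costs at most 13 units: 3 for the two loop
        tests and the bucket head, 9 for the undo, 1 for the increment.\<close>
      moreover have "Suc t3 + 25 * potential fu2 + 14 * (Suc l - Suc j) \<le> t + 50 * (m + n) + 14 * l + 4"
      proof -
        have "14 * (Suc l - j) = 14 * (Suc l - Suc j) + 14" using j by simp
        then show ?thesis using conjunct1[OF 1(2)] time2 time by linarith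
      qed
      ultimately show ?case using st3 j J3 unfolding wp_Cons wp_Nil by auto
    qed
  qed
  then show ?case using vJ by simp
next
  case (3 t' v' a')
  note defs = empty_bucket_def unlink_position_def mark_letters_def find_exit_def release_def push_bucket_def
  have "v' Sent = Suc l" using 3(4) prep by (auto simp: defs prepared_def loaded_def)
  then have vJ: "v' vJ = Suc l" using 3(2) by simp
  then obtain Rm B fu where st: "peel_state (Suc l) {} Rm (unprocessed Rm) B fu a'"
    and Rm: "\<forall>c \<in> Rm. c \<notin> alive l" and time: "t' + 25 * potential fu \<le> t + 50 * (m + n) + 14 * l + 4"
    using 3(1) by auto
  have inv: "peel_inv (Suc l) {} Rm (unprocessed Rm) B (a' Flg)" using st unfolding peel_state_def by blast
  have qf: "cmp qf \<in> reps" by (rule cmp_reps[OF qf_in])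
  have "a' Gone (cmp qf) = 0 \<longleftrightarrow> cmp qf \<notin> Rm" using st qf unfolding peel_state_def by blast
  \<comment> \<open>At position \<open>l + 1\<close> the invariant says that unremoved components
    are alive before it, that is, after the whole word.\<close>
  also have "\<dots> \<longleftrightarrow> cmp qf \<in> alive l" using peel_invD(4)[OF inv] Rm qf by auto
  also have "\<dots> \<longleftrightarrow> qf \<in> alive l" by (rule alive_cmp[OF qf_in])
  finally show ?case using time by simp
next
  case (4 t' v' a')
  then obtain fu where "t' + 25 * potential fu + 14 * (Suc l - v' vJ) \<le> t + 50 * (m + n) + 14 * l + 4" by blast
  then show ?case by linarith
qed

lemma wp_answer:
  assumes "prepared v a" "v Ans = 0"
  shows "wp inp answer (\<lambda>t' v' a'. t' \<le> t + 4 \<and> v' Ans = (if a Gone (cmp qf) = 0 then 1 else 0)) t v a"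
  using assms by (simp add: answer_def prepared_def loaded_def)

end

section \<open>Total running time\<close>

context encoded
begin

lemma wp_supersequence_prog:
  "wp inp supersequence_prog (\<lambda>t v a. t \<le> 200 * (l + m + 1) \<and> v Ans = (if qf \<in> alive l then 1 else 0))
    0 (\<lambda>_. 0) (\<lambda>_ _. 0)"
  unfolding supersequence_prog_def wp_Seq
proof (rule wp_conseq[OF wp_read_input], goal_cases)
  case (1 t1 v1 a1)
  note defs = read_input_def read_word_def read_transitions_def
  have loaded1: "loaded v1 a1" using 1(2) by blast
  have zero: "a1 b = (\<lambda>_. 0)" if "b \<notin> warrs read_input" for b using 1(2) that by blast
  have ans1: "v1 Ans = 0" using 1(3)[of Ans] by (simp add: defs)
  have out: "\<forall>u. chain (a1 OutNx) (a1 OutHd u) (out_list u)"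
    and inc: "\<forall>u. chain (a1 InNx) (a1 InHd u) (in_list u)" using 1(2) by blast+
  have t1: "t1 \<le> 5 * l + 17 * m + 50" using 1(2) by blast
  have z1: "a1 Vis = (\<lambda>_. 0)" "a1 Par = (\<lambda>_. 0)" "a1 FinNx = (\<lambda>_. 0)"
    by (rule zero; simp add: defs)+
  show ?case
  proof (rule wp_conseq[OF wp_depth_first[OF loaded1 out z1]], goal_cases)
    case (1 t2 v2 a2)
    note fr2 = 1(3,4)
    have loaded2: "loaded v2 a2" using loaded1 fr2 by (simp add: loaded_def depth_first_def visit_def)
    have ans2: "v2 Ans = 0" using ans1 fr2 by (simp add: depth_first_def visit_def)
    obtain F where F: "chain (a2 FinNx) (v2 vX) F" "finish_order E F" "set F = {1..n}" "distinct F"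
      using 1(2) by blast
    have inc2: "\<forall>u. chain (a2 InNx) (a2 InHd u) (in_list u)"
      using inc fr2(2) by (simp add: depth_first_def visit_def)
    have t2: "t2 \<le> t1 + 20 * m + 20" using 1(2) by blast
    have a2: "a2 b = a1 b" if "b \<notin> {FinNx, OutHd, Vis, Par}" for b
      using that by (intro fr2(2)) (simp add: depth_first_def visit_def)
    have "a2 Cmp = (\<lambda>_. 0)" using a2[of Cmp] zero[of Cmp] by (simp add: defs)
    from wp_find_components[OF loaded2 inc2 this F]
    show ?case
    proof (rule wp_conseq, goal_cases)
      case (1 t3 v3 a3)
      note fr3 = 1(3,4)
      have loaded3: "loaded v3 a3" using loaded2 fr3 by (simp add: loaded_def find_components_def collect_def)
      have ans3: "v3 Ans = 0" using ans2 fr3 by (simp add: find_components_def collect_def)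
      have t3: "t3 \<le> t2 + 20 * m + 20 * n + 1" using 1(2) by blast
      interpret components n m l src lab dst w q0 qf "a3 Cmp" using 1(2) by blast
      interpret solved n m l src lab dst w q0 qf inp "a3 Cmp" ..
      have a3: "a3 b = a1 b" if "b \<notin> {FinNx, OutHd, Vis, Par, Cmp, Stk, InHd}" for b
      proof -
        have "a3 b = a2 b" using that by (intro fr3(2)) (simp add: find_components_def collect_def)
        then show ?thesis using a2 that by simp
      qed
      have z3: "a3 InnHd = (\<lambda>_. 0)" "a3 CrsHd = (\<lambda>_. 0)" "a3 Deg = (\<lambda>_. 0)"
        using a3 zero by (simp_all add: defs)
      show ?case
      proof (rule wp_conseq[OF wp_sort_transitions[OF loaded3 refl z3]], goal_cases)
        case (1 t4 v4 a4)
        note fr4 = 1(3,4)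
        have loaded4: "loaded v4 a4" using loaded3 fr4 by (simp add: loaded_def sort_transitions_def)
        have ans4: "v4 Ans = 0" using ans3 fr4 by (simp add: sort_transitions_def)
        have t4: "t4 \<le> t3 + 14 * m + 2" using 1(2) by blast
        have s4: "\<forall>c. chain (a4 CmpNx) (a4 InnHd c) (inner_list c)"
          "\<forall>c. chain (a4 CmpNx) (a4 CrsHd c) (leaving_list c)"
          "\<forall>c. a4 Deg c = length (selected (entering c) m)" using 1(2) by blast+
        have a4: "a4 b = a3 b" if "b \<notin> {InnHd, CrsHd, CmpNx, Deg}" for b
          using that by (intro fr4(2)) (simp add: sort_transitions_def)
        have z4: "a4 Rgt = (\<lambda>_. 0)" "a4 Lft = (\<lambda>_. 0)" "a4 Last = (\<lambda>_. 0)"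
          using a4 a3 zero by (simp_all add: defs)
        show ?case
        proof (rule wp_conseq[OF wp_link_positions[OF loaded4 z4]], goal_cases)
          case (1 t5 v5 a5)
          note fr5 = 1(3,4)
          have a5: "a5 b = a4 b" if "b \<notin> {Rgt, Lft, Last, Nxt}" for b
            using that by (intro fr5(2)) (simp add: link_positions_def)
          have "loaded v5 a5" using loaded4 fr5 by (simp add: loaded_def link_positions_def)
          moreover have "\<forall>i. 1 \<le> i \<and> i \<le> l \<longrightarrow> a5 Nxt i = next_same i" using 1(2) by blast
          ultimately have prep: "prepared v5 a5" using s4 a5 a4 by (simp add: prepared_def)
          have ans5: "v5 Ans = 0" using ans4 fr5 by (simp add: link_positions_def)
          have t5: "t5 \<le> t4 + 17 * l + 3" using 1(2) by blast
          have links: "links 1 (a5 Rgt) (a5 Lft)" using 1(2) by blast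
          have deg: "\<forall>c. a5 Deg c = length (selected (entering c) m)" using s4(3) a5 by simp
          have z5: "a5 Flg = (\<lambda>_. 0)" "a5 Gone = (\<lambda>_. 0)" "a5 BktNx = (\<lambda>_. 0)" "a5 BktHd = (\<lambda>_. 0)"
            "a5 Mrk = (\<lambda>_. 0)" using a5 a4 a3 zero by (simp_all add: defs)
          show ?case
          proof (rule wp_conseq[OF wp_read_letters[OF prep links deg z5]], goal_cases)
            case (1 t6 v6 a6)
            note fr6 = 1(3,4)
            note defs6 = read_letters_def empty_bucket_def unlink_position_def mark_letters_def
              find_exit_def release_def push_bucket_def
            have prep6: "prepared v6 a6"
              by (rule prepared_cong[OF prep]) (use fr6 in \<open>auto simp: defs6\<close>)
            have ans6: "v6 Ans = 0" using ans5 fr6 by (simp add: defs6)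
            show ?case
            proof (rule wp_conseq[OF wp_answer[OF prep6 ans6]], goal_cases)
              case (1 t7 v7 a7)
              \<comment> \<open>The phases sum to at most
                \<open>36 * l + 121 * m + 70 * n + 85\<close>, and \<open>n \<le> m + 1\<close>
                brings this below the claimed bound.\<close>
              then show ?case using \<open>t6 \<le> _ \<and> _\<close> t5 t4 t3 t2 t1 n_le by auto
            qed
          qed
        qed
      qed
    qed
  qed
qed

end

section \<open>Words and paths\<close>

lemma path_append: "path A p u q \<Longrightarrow> path A q v r \<Longrightarrow> path A p (u @ v) r"
  by (induction rule: path.induct) (auto intro: path.intros)

lemma path_states:
  assumes "is_enfa A" "path A p u q"
  shows "p \<in> states A \<and> q \<in> states A"
  using assms(2,1) by (induction rule: path.induct) (auto simp: is_enfa_def)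

lemma path_split:
  assumes "path A p x r" "is_enfa A" "x = u @ v"
  shows "\<exists>q. path A p u q \<and> path A q v r"
  using assms(1,3)
proof (induction arbitrary: u rule: path.induct)
  case (path_refl q)
  then show ?case by (auto intro: path.path_refl)
next
  case (path_eps p q x r)
  then show ?case by (blast intro: path.path_eps)
next
  case (path_sym p a q x r)
  show ?case
  proof (cases u)
    case Nil
    have "path A p (a # x) r" using path_sym.hyps by (rule path.path_sym)
    then have "path A p [] p" using path_states[OF assms(2)] by (blast intro: path.path_refl)
    then show ?thesis using Nil path_sym.prems \<open>path A p (a # x) r\<close> by auto
  next
    case (Cons b u')
    then show ?thesis using path_sym by (auto intro: path.path_sym)
  qed
qed

lemma path_ConsE:
  assumes "path A p x r" "is_enfa A" "x = a # v"
  shows "\<exists>p1 p2. path A p [] p1 \<and> (p1, Some a, p2) \<in> transitions A \<and> path A p2 v r"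
  using assms(1,3)
proof (induction rule: path.induct)
  case (path_eps p q x r)
  then show ?case by (blast intro: path.path_eps)
next
  case (path_sym p b q x r)
  have "p \<in> states A" using path_sym.hyps(1) assms(2) by (auto simp: is_enfa_def)
  then show ?case using path_sym by (auto intro: path.path_refl)
qed simp

lemma path_rtrancl: "path A p u q \<Longrightarrow> (p, q) \<in> {(p, q). \<exists>a. (p, a, q) \<in> transitions A}\<^sup>*"
  by (induction rule: path.induct) (auto intro: converse_rtrancl_into_rtrancl)

lemma rtrancl_path:
  assumes "(p, q) \<in> {(p, q). \<exists>a. (p, a, q) \<in> transitions A}\<^sup>*" "q \<in> states A"
  shows "\<exists>u. path A p u q"
  using assms
proof (induction rule: converse_rtrancl_induct)
  case (step p p')
  then obtain a u where "(p, a, p') \<in> transitions A" "path A p' u q" by auto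
  then show ?case by (cases a) (auto intro: path.intros)
qed (auto intro: path_refl)

text \<open>\<open>alive\<close> extends a prefix of the word at its right end, so the decomposition
  is needed at the last letter; what follows it in \<open>u\<close> is arbitrary.\<close>

lemma subseq_snoc_iff: "subseq (xs @ [a]) u \<longleftrightarrow> (\<exists>u1 u2. u = u1 @ a # u2 \<and> subseq xs u1)"
proof
  assume "subseq (xs @ [a]) u"
  then obtain us vs where u: "u = us @ vs" "subseq xs us" "subseq [a] vs"
    by (auto dest: list_emb_appendD)
  then obtain vs1 vs2 where "vs = vs1 @ a # vs2" by (auto dest: list_emb_ConsD)
  then show "\<exists>u1 u2. u = u1 @ a # u2 \<and> subseq xs u1"
    using u by (intro exI[of _ "us @ vs1"] exI[of _ vs2]) (simp add: list_emb_prefix)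
next
  assume "\<exists>u1 u2. u = u1 @ a # u2 \<and> subseq xs u1"
  then obtain u1 u2 where u: "u = u1 @ a # u2" "subseq xs u1" by blast
  have "subseq [a] (a # u2)" by simp
  then show "subseq (xs @ [a]) u" using u by (auto intro: list_emb_append_mono)
qed

lemma length_encode_transitions: "length (concat (map encode_transition ts)) = 3 * length ts"
  by (induction ts) (auto simp: encode_transition_def split: prod.splits)

lemma nth_encode_transitions:
  assumes "i < length ts"
  shows "concat (map encode_transition ts) ! (3 * i) = fst (ts ! i)"
    "concat (map encode_transition ts) ! (3 * i + 1) = (case fst (snd (ts ! i)) of None \<Rightarrow> 0 | Some x \<Rightarrow> x)"
    "concat (map encode_transition ts) ! (3 * i + 2) = snd (snd (ts ! i))"
  using assms
proof (induction ts arbitrary: i)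
  case (Cons tr ts)
  obtain p b q where tr: "tr = (p, b, q)" by (cases tr)
  {
    case 1
    then show ?case using Cons(1) by (cases i) (simp_all add: encode_transition_def tr)
  next
    case 2
    then show ?case using Cons(2) by (cases i) (simp_all add: encode_transition_def tr)
  next
    case 3
    then show ?case using Cons(3) by (cases i) (simp_all add: encode_transition_def tr)
  }
qed auto

section \<open>From the encoded input back to the automaton\<close>

locale decision_instance =
  fixes aut :: "(nat, nat) enfa" and word :: "nat list" and ts :: "(nat \<times> nat option \<times> nat) list"
  assumes enfa: "is_enfa aut" and trim: "trimmed aut" and used: "all_symbols_used aut"
    and names: "integer_names aut" and word: "word \<in> lists (alphabet aut)"
    and ts: "distinct ts" "set ts = transitions aut"
begin

definition tsrc :: "nat \<Rightarrow> nat" where "tsrc e = fst (ts ! (e - 1))"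
definition tlab :: "nat \<Rightarrow> nat" where
  "tlab e = (case fst (snd (ts ! (e - 1))) of None \<Rightarrow> 0 | Some x \<Rightarrow> x)"
definition tdst :: "nat \<Rightarrow> nat" where "tdst e = snd (snd (ts ! (e - 1)))"
definition letter :: "nat \<Rightarrow> nat" where
  "letter i = (if 1 \<le> i \<and> i \<le> length word then word ! (i - 1) else 0)"

abbreviation "xs \<equiv> encode_input word aut ts"

lemma mem_states: "q \<in> states aut \<longleftrightarrow> 1 \<le> q \<and> q \<le> card (states aut)"
  using names unfolding integer_names_def by (metis atLeastAtMost_iff)

lemma alphabet_pos: "x \<in> alphabet aut \<Longrightarrow> 0 < x"
  using names unfolding integer_names_def by (metis atLeastAtMost_iff less_eq_Suc_le One_nat_def)

lemma transitionE:
  assumes "1 \<le> e" "e \<le> length ts"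
  obtains p b q where "(p, b, q) \<in> transitions aut" "tsrc e = p" "tdst e = q"
    "tlab e = (case b of None \<Rightarrow> 0 | Some x \<Rightarrow> x)"
proof -
  have "ts ! (e - 1) \<in> transitions aut" using assms ts(2) by (metis Suc_diff_1 Suc_le_eq less_eq_Suc_le nth_mem One_nat_def)
  then show thesis using that by (metis prod.collapse tdst_def tlab_def tsrc_def)
qed

lemma transition_index:
  assumes "(p, b, q) \<in> transitions aut"
  obtains e where "1 \<le> e" "e \<le> length ts" "tsrc e = p" "tdst e = q"
    "tlab e = (case b of None \<Rightarrow> 0 | Some x \<Rightarrow> x)"
proof -
  obtain i where "i < length ts" "ts ! i = (p, b, q)" using assms ts(2) by (metis in_set_conv_nth)
  then show thesis using that[of "Suc i"] by (simp add: tsrc_def tdst_def tlab_def)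
qed

lemma edges_eq: "{(tsrc e, tdst e) | e. 1 \<le> e \<and> e \<le> length ts} = {(p, q). \<exists>a. (p, a, q) \<in> transitions aut}"
proof (intro subset_antisym subrelI)
  fix p q assume "(p, q) \<in> {(tsrc e, tdst e) | e. 1 \<le> e \<and> e \<le> length ts}"
  then obtain e where e: "1 \<le> e" "e \<le> length ts" "p = tsrc e" "q = tdst e" by blast
  obtain b where "(tsrc e, b, tdst e) \<in> transitions aut" using transitionE[OF e(1,2)] by metis
  then show "(p, q) \<in> {(p, q). \<exists>a. (p, a, q) \<in> transitions aut}" using e by blast
next
  fix p q assume "(p, q) \<in> {(p, q). \<exists>a. (p, a, q) \<in> transitions aut}"
  then obtain b where "(p, b, q) \<in> transitions aut" by blast
  then show "(p, q) \<in> {(tsrc e, tdst e) | e. 1 \<le> e \<and> e \<le> length ts}"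
    by (elim transition_index) blast
qed

lemma transition_states: "(p, b, q) \<in> transitions aut \<Longrightarrow> p \<in> states aut \<and> q \<in> states aut"
  using enfa by (auto simp: is_enfa_def)

lemma length_xs: "length xs = 6 + length word + 3 * length ts"
  by (simp add: encode_input_def length_encode_transitions)

lemma nth_xs:
  "xs ! 0 = length word" "xs ! 3 = length ts" "xs ! 4 = initial aut" "xs ! 5 = final aut"
  "i < length word \<Longrightarrow> xs ! (6 + i) = word ! i"
  "xs ! (6 + length word + i) = concat (map encode_transition ts) ! i"
  by (simp_all add: encode_input_def nth_append)

abbreviation "input \<equiv> \<lambda>i. if i < length xs then xs ! i else 0"

sublocale encoded "card (states aut)" "length ts" "length word" tsrc tlab tdst letter
  "initial aut" "final aut" input
proof
  show "tsrc e \<in> {1..card (states aut)}" "tdst e \<in> {1..card (states aut)}" if "1 \<le> e" "e \<le> length ts" for e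
    using transitionE[OF that] transition_states unfolding atLeastAtMost_iff mem_states by metis+
  show "initial aut \<in> {1..card (states aut)}" "final aut \<in> {1..card (states aut)}"
    using enfa by (auto simp: is_enfa_def mem_states)
  show "(initial aut, q) \<in> {(tsrc e, tdst e) | e. 1 \<le> e \<and> e \<le> length ts}\<^sup>*" if "q \<in> {1..card (states aut)}" for q
  proof -
    have "q \<in> states aut" using that by (simp add: mem_states)
    then obtain u where "path aut (initial aut) u q" using trim unfolding trimmed_def by blast
    then show ?thesis unfolding edges_eq by (rule path_rtrancl)
  qed
  show "0 < letter i" if "1 \<le> i" "i \<le> length word" for i
    using that word alphabet_pos by (auto simp: letter_def)
  show "letter i = 0" if "i < 1 \<or> length word < i" for i using that by (auto simp: letter_def)
  show "input 0 = length word" "input 3 = length ts" "input 4 = initial aut" "input 5 = final aut"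
    using length_xs nth_xs by simp_all
  show "input (5 + i) = letter i" if "1 \<le> i" "i \<le> length word" for i
    using that length_xs nth_xs(5)[of "i - 1"] by (simp add: letter_def)
  show "input (3 + length word + 3 * e) = tsrc e \<and> input (4 + length word + 3 * e) = tlab e \<and>
      input (5 + length word + 3 * e) = tdst e" if e: "1 \<le> e" "e \<le> length ts" for e
  proof -
    obtain k where k: "e = Suc k" "k < length ts" using e by (cases e) auto
    have *: "3 + length word + 3 * e = 6 + length word + 3 * k" "4 + length word + 3 * e = 6 + length word + (3 * k + 1)"
      "5 + length word + 3 * e = 6 + length word + (3 * k + 2)" using k by simp_all
    show ?thesis unfolding * nth_xs length_xs using nth_encode_transitions[OF k(2)] k
      by (simp add: tsrc_def tlab_def tdst_def)
  qed
qed

lemma E_eq: "E = {(p, q). \<exists>a. (p, a, q) \<in> transitions aut}"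
  unfolding E_def by (rule edges_eq)

text \<open>Split the run at the transition that is matched with the last letter. The run behind it
  may spell anything, which is why reachability in \<open>E\<close> captures it. For the empty
  prefix, trimmedness provides a run to every state.\<close>

lemma alive_iff:
  "j \<le> length word \<Longrightarrow> q \<in> alive j \<longleftrightarrow> (\<exists>u. path aut (initial aut) u q \<and> subseq (take j word) u)"
proof (induction j arbitrary: q)
  case 0
  have "q \<in> alive 0 \<longleftrightarrow> q \<in> states aut" by (simp add: mem_states)
  then show ?case using trim path_states[OF enfa] unfolding trimmed_def by auto
next
  case (Suc j)
  let ?x = "word ! j"
  have take: "take (Suc j) word = take j word @ [?x]" using Suc.prems by (simp add: take_Suc_conv_app_nth)
  have lx: "letter (Suc j) = ?x" using Suc.prems by (simp add: letter_def)
  have xpos: "0 < ?x" using Suc.prems word alphabet_pos by auto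
  have IH: "p \<in> alive j \<longleftrightarrow> (\<exists>u. path aut (initial aut) u p \<and> subseq (take j word) u)" for p
    using Suc.IH Suc.prems by simp
  show ?case
  proof
    assume "q \<in> alive (Suc j)"
    then obtain e where e: "1 \<le> e" "e \<le> length ts" "tlab e = ?x" "tsrc e \<in> alive j" "(tdst e, q) \<in> E\<^sup>*"
      using lx by auto
    obtain b where b: "(tsrc e, b, tdst e) \<in> transitions aut" "tlab e = (case b of None \<Rightarrow> 0 | Some x \<Rightarrow> x)"
      using transitionE[OF e(1,2)] by metis
    \<comment> \<open>Label 0 would mean \<epsilon>, but letters are positive.\<close>
    then have tr: "(tsrc e, Some ?x, tdst e) \<in> transitions aut" using e(3) xpos by (cases b) auto
    obtain u1 where u1: "path aut (initial aut) u1 (tsrc e)" "subseq (take j word) u1" using IH e(4) by blast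
    have "q \<in> states aut" using E_rtrancl_in[OF e(5) dst_in[OF e(1,2)]] by (simp add: mem_states)
    then obtain u2 where "path aut (tdst e) u2 q" using rtrancl_path[OF e(5)[unfolded E_eq]] by blast
    then have "path aut (initial aut) (u1 @ ?x # u2) q" using path_append[OF u1(1) path_sym[OF tr]] by blast
    then show "\<exists>u. path aut (initial aut) u q \<and> subseq (take (Suc j) word) u"
      unfolding take subseq_snoc_iff using u1(2) by blast
  next
    assume "\<exists>u. path aut (initial aut) u q \<and> subseq (take (Suc j) word) u"
    then obtain u1 u2 where u: "path aut (initial aut) (u1 @ ?x # u2) q" "subseq (take j word) u1"
      unfolding take subseq_snoc_iff by blast
    obtain p where p: "path aut (initial aut) u1 p" "path aut p (?x # u2) q"
      using path_split[OF u(1) enfa refl] by blast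
    obtain p1 p2 where p12: "path aut p [] p1" "(p1, Some ?x, p2) \<in> transitions aut" "path aut p2 u2 q"
      using path_ConsE[OF p(2) enfa refl] by blast
    have "path aut (initial aut) u1 p1" using path_append[OF p(1) p12(1)] by simp
    then have "p1 \<in> alive j" using IH u(2) by blast
    moreover obtain e where "1 \<le> e" "e \<le> length ts" "tsrc e = p1" "tdst e = p2" "tlab e = ?x"
      using transition_index[OF p12(2)] by auto
    moreover have "(p2, q) \<in> E\<^sup>*" unfolding E_eq by (rule path_rtrancl[OF p12(3)])
    ultimately show "q \<in> alive (Suc j)" using lx by auto
  qed
qed

lemma final_alive: "final aut \<in> alive (length word) \<longleftrightarrow> (\<exists>u. subseq word u \<and> u \<in> language aut)"
  using alive_iff[of "length word"] by (auto simp: language_def)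

text \<open>Every symbol labels a transition; the value of \<open>the\<close> at
  \<epsilon>-transitions only enlarges the image. The bound is needed because symbols and the
  alphabet size are themselves input words that have to be small.\<close>

lemma card_alphabet_le: "card (alphabet aut) \<le> length ts"
proof -
  have fin: "finite (transitions aut)" using ts(2) by (metis List.finite_set)
  have "alphabet aut \<subseteq> (\<lambda>tr. the (fst (snd tr))) ` transitions aut"
    using used unfolding all_symbols_used_def by force
  then have "card (alphabet aut) \<le> card (transitions aut)" using fin by (rule surj_card_le[rotated])
  then show ?thesis using ts distinct_card by fastforce
qed

lemma xs_le: "x \<in> set xs \<Longrightarrow> x \<le> length word + length ts + 1"
proof -
  assume x: "x \<in> set xs"
  have st: "q \<le> length ts + 1" if "q \<in> states aut" for q
    using that n_le by (simp add: mem_states)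
  have al: "y \<le> length ts" if "y \<in> alphabet aut" for y
    using that names card_alphabet_le unfolding integer_names_def by (metis atLeastAtMost_iff le_trans)
  have tr: "x \<le> length ts + 1" if "(p, b, q) \<in> transitions aut" "x \<in> set (encode_transition (p, b, q))" for p b q
  proof -
    have "p \<in> states aut" "q \<in> states aut" "b = None \<or> the b \<in> alphabet aut"
      using that(1) enfa by (auto simp: is_enfa_def)
    then show ?thesis using that(2) st al by (cases b) (auto simp: encode_transition_def le_SucI)
  qed
  have "initial aut \<le> length ts + 1" "final aut \<le> length ts + 1" using st enfa by (auto simp: is_enfa_def)
  moreover have "x \<le> length ts + 1" if "x \<in> set (concat (map encode_transition ts))"
    using that tr ts(2) by auto
  moreover have "x \<le> length ts" if "x \<in> set word" using that word al by auto
  moreover have "x \<in> {length word, card (states aut), card (alphabet aut), length ts, initial aut, final aut} \<or>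
      x \<in> set word \<or> x \<in> set (concat (map encode_transition ts))"
    using x unfolding encode_input_def by (simp del: set_concat)
  ultimately show ?thesis using n_le card_alphabet_le by (auto simp del: set_concat)
qed

end

text \<open>The factor \<open>Suc r\<close> gives \<open>(N + 2) ^ Suc r \<le> 2 ^ b\<close>. Of
  these factors, \<open>r\<close> are traded for the constant \<open>r\<close>, since
  \<open>r < 2 ^ r\<close>. Thus a constant-factor memory overhead is absorbed by the choice of
  \<open>k\<close>.\<close>

lemma room_enough:
  assumes "word_size_ok (Suc r) N b"
  shows "r * (N + 2) < 2 ^ b"
proof -
  have "real (N + 2) ^ Suc r = 2 powr (real (Suc r) * log 2 (real (N + 2)))"
    by (simp add: powr_realpow[symmetric] powr_powr[symmetric] mult.commute[of _ "log _ _"] del: power_Suc)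
  also have "\<dots> \<le> 2 powr real b" using assms by (intro powr_mono) (auto simp: word_size_ok_def)
  finally have "real (N + 2) ^ Suc r \<le> 2 ^ b" by (simp add: powr_realpow)
  then have "(N + 2) ^ Suc r \<le> 2 ^ b" by (metis of_nat_le_iff of_nat_numeral of_nat_power)
  moreover have "r < (N + 2) ^ r"
    using less_exp[of r] power_mono[of 2 "N + 2" r] by linarith
  then have "r * (N + 2) < (N + 2) ^ r * (N + 2)" by (rule mult_less_mono1) simp
  then have "r * (N + 2) < (N + 2) ^ Suc r" by (simp only: power_Suc2)
  ultimately show ?thesis by linarith
qed

theorem theorem4p7:
  "\<exists>(P :: instr list) (c :: nat) (k :: nat).
     \<forall>(A :: (nat, nat) enfa) (w :: nat list) (m :: nat) (ts :: (nat \<times> nat option \<times> nat) list) (b :: nat).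
       is_enfa A \<longrightarrow> trimmed A \<longrightarrow> all_symbols_used A \<longrightarrow> integer_names A \<longrightarrow>
       w \<in> lists (alphabet A) \<longrightarrow>
       m = card (transitions A) \<longrightarrow>
       distinct ts \<longrightarrow> set ts = transitions A \<longrightarrow>
       word_size_ok k (length w + m) b \<longrightarrow>
       ram_decides b P (encode_input w A ts) (c * (length w + m + 1))
         (\<exists>u. subseq w u \<and> u \<in> language A)"
proof -
  \<comment> \<open>With \<open>N = |w| + m\<close>, the input length is at most
    \<open>6 * (N + 2)\<close>. Values are bounded by \<open>N + 1\<close> plus the time
    \<open>200 * (N + 1)\<close>, which gives at most \<open>201 * (N + 2)\<close> rows of the array
    area.\<close>
  define r where "r = 6 + 201 * width TYPE(arr)"
  have "ram_decides b (program Ans supersequence_prog) (encode_input w A ts) (1608 * (length w + m + 1))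
      (\<exists>u. subseq w u \<and> u \<in> language A)"
    if "is_enfa A" "trimmed A" "all_symbols_used A" "integer_names A" "w \<in> lists (alphabet A)"
      "m = card (transitions A)" "distinct ts" "set ts = transitions A" "word_size_ok (Suc r) (length w + m) b"
    for A :: "(nat, nat) enfa" and w m ts b
  proof -
    interpret decision_instance A w ts by unfold_locales (use that in auto)
    have m: "length ts = m" using that(6-8) distinct_card by metis
    let ?N = "length w + m"
    let ?T = "200 * (?N + 1)"
    have "ram_decides b (program Ans supersequence_prog) (encode_input w A ts) (8 * ?T + 8)
        (\<exists>u. subseq w u \<and> u \<in> language A)"
    proof (rule program_decides[where X = "?N + 1"])
      show "wp input supersequence_prog
          (\<lambda>t v a. t \<le> ?T \<and> v Ans = (if \<exists>u. subseq w u \<and> u \<in> language A then 1 else 0))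
          0 (\<lambda>_. 0) (\<lambda>_ _. 0)"
        using wp_supersequence_prog[unfolded final_alive] unfolding m .
      show "length (encode_input w A ts) = 6 + encode_input w A ts ! 0 + 3 * encode_input w A ts ! 3"
        using length_xs nth_xs by simp
      show "x \<le> ?N + 1" if "x \<in> set (encode_input w A ts)" for x using xs_le[OF that] m by simp
      have "width TYPE(arr) * (?N + 1 + ?T + 2) \<le> width TYPE(arr) * (201 * (?N + 2))"
        by (rule mult_le_mono2) simp
      moreover have "length (encode_input w A ts) \<le> 6 * (?N + 2)" using length_xs m by simp
      ultimately have "length (encode_input w A ts) + width TYPE(arr) * (?N + 1 + ?T + 2) \<le> r * (?N + 2)"
        unfolding r_def by (simp add: algebra_simps)
      then show "length (encode_input w A ts) + width TYPE(arr) * (?N + 1 + ?T + 2) < 2 ^ b"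
        using room_enough[OF that(9)] by simp
    qed
    \<comment> \<open>\<open>1608 = 8 * 200 + 8\<close>: the slowdown of the compilation times the
      time bound, plus the eight instructions around the compiled code.\<close>
    moreover have "8 * ?T + 8 \<le> 1608 * (?N + 1)" by simp
    ultimately show ?thesis unfolding ram_decides_def by (meson le_trans)
  qed
  then show ?thesis by blast
qed

end
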